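(* Let $0<p,q\le\infty$, $0<s<1$ and $d>1$. Then $f\in L_p(\mathbb{R}^n)$ belongs to $\mathbf{B}^s_{p,q}(\mathbb{R}^n)$ if, and only if, it can be represented as $$f=\sum_{j=0}^\infty\sum_{m\in\mathbb{Z}^n}\lambda_{j,m}a_{j,m},\qquad (\ast)$$ where the $a_{j,m}$ are $\mathrm{Lip}$-atoms with $\operatorname{supp}a_{j,m}\subset dQ_{j,m}$ for $j\in\mathbb{N}_0$, $m\in\mathbb{Z}^n$, and $\lambda=\{\lambda_{j,m}\}\in b^s_{p,q}$, the convergence being in $L_p(\mathbb{R}^n)$. Furthermore, $\inf\|\lambda|b^s_{p,q}\|$, where the infimum is taken over all admissible representations $(\ast)$, is an equivalent quasi-norm on $\mathbf{B}^s_{p,q}(\mathbb{R}^n)$.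
   Context: Notation: $\mathbb{N}_0=\{0,1,2,\dots\}$. For $j\in\mathbb{N}_0$, $m\in\mathbb{Z}^n$, $Q_{j,m}$ is the cube in $\mathbb{R}^n$ with sides parallel to the axes, centre $2^{-j}m$ and side length $2^{-j+1}$; $dQ_{j,m}$ is the concentric cube with side length $d$ times that of $Q_{j,m}$. $[s]$ is the integer part of $s$. Sequence spaces: for $\lambda=\{\lambda_{j,m}\in\mathbb{C}: j\in\mathbb{N}_0,m\in\mathbb{Z}^n\}$, $\lambda\in b^s_{p,q}$ iff $$\|\lambda|b^s_{p,q}\|=\Big(\sum_{j=0}^\infty 2^{j(s-n/p)q}\Big(\sum_{m\in\mathbb{Z}^n}|\lambda_{j,m}|^p\Big)^{q/p}\Big)^{1/q}<\infty$$ (usual modification if $p=\infty$ and/or $q=\infty$). Smooth atoms: for $K\in\mathbb{N}_0$, $d>1$, a $K$-times continuously differentiable function $a:\mathbb{R}^n\to\mathbb{C}$ (continuous if $K=0$) is a $K$-atom located at $Q_{j,m}$ if $\operatorname{supp}a\subset dQ_{j,m}$ and $|D^\alpha a(x)|\le 2^{|\alpha|j}$ for $|\alpha|\le K$. Besov spaces: let $s>0$, $0<p,q\le\infty$, and fix $d>1$ and $K\in\mathbb{N}_0$ with $K\ge 1+[s]$. $\mathbf{B}^s_{p,q}(\mathbb{R}^n)$ is the set of all $f\in L_p(\mathbb{R}^n)$ which can be written $f=\sum_{j}\sum_m\lambda_{j,m}a_{j,m}$ (convergence in $L_p(\mathbb{R}^n)$) with $K$-atoms $a_{j,m}$ located at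 $Q_{j,m}$ and $\lambda\in b^s_{p,q}$; $\|f|\mathbf{B}^s_{p,q}(\mathbb{R}^n)\|$ is the infimum of $\|\lambda|b^s_{p,q}\|$ over all such representations. The spaces are independent of $d$ and $K$ up to equivalent quasi-norms. Lip-atoms: $\mathrm{Lip}(\mathbb{R}^n)$ is the space of $f:\mathbb{R}^n\to\mathbb{R}$ with $\max\{\sup_x|f(x)|,\ \sup_{x\ne y}|f(x)-f(y)|/|x-y|\}<\infty$. A function $a\in\mathrm{Lip}(\mathbb{R}^n)$ is a $\mathrm{Lip}$-atom (located at $Q_{j,m}$) if $\operatorname{supp}a\subset dQ_{j,m}$, $|a(x)|\le1$ and $|a(x)-a(y)|\le2^j|x-y|$ for all $x,y\in\mathbb{R}^n$. *)

theory Defs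
  imports "HOL-Probability.Essential_Supremum"
begin

text \<open>Exponents \<open>p, q \<in> (0, \<infinity>]\<close> have type \<^typ>\<open>ennreal\<close>, the space \<open>\<real>\<^sup>n\<close> is \<open>real^'n\<close> with
  \<open>n = CARD('n)\<close>, and the lattice \<open>\<int>\<^sup>n\<close> is \<open>int^'n\<close>.  Quasi-norms take values in \<^typ>\<open>ennreal\<close>.\<close>

definition epowr :: "ennreal \<Rightarrow> real \<Rightarrow> ennreal" where  \<comment> \<open>only used for \<open>r > 0\<close>\<close>
  "epowr x r = (if x = \<infinity> then \<infinity> else ennreal (enn2real x powr r))"


section \<open>Lebesgue spaces\<close>

definition Lp_norm :: "ennreal \<Rightarrow> (real^'n \<Rightarrow> complex) \<Rightarrow> ennreal" where
  "Lp_norm p f =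
     (if p = \<infinity> then esssup lebesgue (\<lambda>x. ennreal (norm (f x)))
      else epowr (\<integral>\<^sup>+ x. ennreal (norm (f x) powr enn2real p) \<partial>lebesgue) (1 / enn2real p))"

text \<open>Elements of \<open>L\<^sub>p\<close> are represented by functions, not by classes modulo null sets.\<close>

definition Lp :: "ennreal \<Rightarrow> (real^'n \<Rightarrow> complex) set" where
  "Lp p = {f. f \<in> borel_measurable lebesgue \<and> Lp_norm p f < \<infinity>}"


section \<open>Cubes and sequence spaces\<close>

text \<open>The cube \<open>d Q\<^sub>j\<^sub>,\<^sub>m\<close> (closed): its side length is \<open>d 2\<^sup>-\<^sup>j\<^sup>+\<^sup>1\<close>, i.e. twice \<open>d 2\<^sup>-\<^sup>j\<close>.\<close>

definition dcube :: "real \<Rightarrow> nat \<Rightarrow> int^'n \<Rightarrow> (real^'n) set" where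
  "dcube d j m = {x. \<forall>i. \<bar>x $ i - of_int (m $ i) / 2 ^ j\<bar> \<le> d / 2 ^ j}"

definition lp_norm :: "ennreal \<Rightarrow> (int^'n \<Rightarrow> complex) \<Rightarrow> ennreal" where
  "lp_norm p c =
     (if p = \<infinity> then (SUP m. ennreal (norm (c m)))
      else epowr (\<Sum>\<^sub>\<infinity>m. ennreal (norm (c m) powr enn2real p)) (1 / enn2real p))"

text \<open>Here \<open>enn2real (1 / p)\<close> is \<open>0\<close> if \<open>p = \<infinity>\<close>, in accordance with \<open>n / \<infinity> = 0\<close>.\<close>

definition b_norm :: "real \<Rightarrow> ennreal \<Rightarrow> ennreal \<Rightarrow> (nat \<Rightarrow> int^'n \<Rightarrow> complex) \<Rightarrow> ennreal" where
  "b_norm s p q lam =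
     (let w = (\<lambda>j. ennreal (2 powr (real j * (s - real CARD('n) * enn2real (1 / p))))
                     * lp_norm p (lam j))
      in if q = \<infinity> then (SUP j. w j)
         else epowr (\<Sum>j. epowr (w j) (enn2real q)) (1 / enn2real q))"

definition b_space :: "real \<Rightarrow> ennreal \<Rightarrow> ennreal \<Rightarrow> (nat \<Rightarrow> int^'n \<Rightarrow> complex) set" where
  "b_space s p q = {lam. b_norm s p q lam < \<infinity>}"


section \<open>Atoms\<close>

definition supp :: "(real^'n \<Rightarrow> 'b::zero) \<Rightarrow> (real^'n) set" where
  "supp a = closure {x. a x \<noteq> 0}"

definition partial_deriv :: "'n \<Rightarrow> (real^'n \<Rightarrow> complex) \<Rightarrow> (real^'n \<Rightarrow> complex)" where
  "partial_deriv i f x = frechet_derivative f (at x) (axis i 1)"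

primrec cont_diff :: "nat \<Rightarrow> (real^'n \<Rightarrow> complex) \<Rightarrow> bool" where
  "cont_diff 0 f \<longleftrightarrow> continuous_on UNIV f"
| "cont_diff (Suc k) f \<longleftrightarrow> f differentiable_on UNIV \<and> (\<forall>i. cont_diff k (partial_deriv i f))"

definition multi_order :: "nat^'n \<Rightarrow> nat" where
  "multi_order \<alpha> = (\<Sum>i\<in>UNIV. \<alpha> $ i)"

text \<open>\<open>D\<^sup>\<alpha> f\<close>: the index type carries no order, so some enumeration of the differentiations is chosen.
  For functions that are \<open>|\<alpha>|\<close> times continuously differentiable the choice is immaterial.\<close>

definition multi_deriv :: "nat^'n \<Rightarrow> (real^'n \<Rightarrow> complex) \<Rightarrow> (real^'n \<Rightarrow> complex)" where
  "multi_deriv \<alpha> f = foldr partial_deriv (SOME xs. \<forall>i. count_list xs i = \<alpha> $ i) f"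

definition K_atom :: "real \<Rightarrow> nat \<Rightarrow> nat \<Rightarrow> int^'n \<Rightarrow> (real^'n \<Rightarrow> complex) \<Rightarrow> bool" where
  "K_atom d K j m a \<longleftrightarrow>
     cont_diff K a \<and> supp a \<subseteq> dcube d j m \<and>
     (\<forall>\<alpha> x. multi_order \<alpha> \<le> K \<longrightarrow> norm (multi_deriv \<alpha> a x) \<le> 2 ^ (multi_order \<alpha> * j))"

definition Lip :: "(real^'n \<Rightarrow> real) set" where
  "Lip = {f. bounded (range f) \<and> (\<exists>L. L-lipschitz_on UNIV f)}"

definition Lip_atom :: "real \<Rightarrow> nat \<Rightarrow> int^'n \<Rightarrow> (real^'n \<Rightarrow> real) \<Rightarrow> bool" where
  "Lip_atom d j m a \<longleftrightarrow>
     a \<in> Lip \<and> supp a \<subseteq> dcube d j m \<and>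
     (\<forall>x. \<bar>a x\<bar> \<le> 1) \<and> (\<forall>x y. \<bar>a x - a y\<bar> \<le> 2 ^ j * norm (x - y))"


section \<open>Atomic representations and the spaces \<open>B\<^sup>s\<^sub>p\<^sub>,\<^sub>q\<close>\<close>

text \<open>\<open>f = \<Sum>\<^sub>j \<Sum>\<^sub>m \<lambda>\<^sub>j\<^sub>,\<^sub>m a\<^sub>j\<^sub>,\<^sub>m\<close> with convergence in \<open>L\<^sub>p\<close>.  For fixed \<open>j\<close> the sum over \<open>m\<close> has at each
  point only finitely many nonzero terms, because of the supports of the atoms, and is taken
  pointwise; the series over \<open>j\<close> converges in the \<open>L\<^sub>p\<close> quasi-norm.  (For \<open>p = \<infinity>\<close> the sum over \<open>m\<close>
  in general does not converge in \<open>L\<^sub>\<infinity>\<close>.)\<close>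

definition Lp_expansion ::
  "ennreal \<Rightarrow> (real^'n \<Rightarrow> complex) \<Rightarrow> (nat \<Rightarrow> int^'n \<Rightarrow> complex) \<Rightarrow>
     (nat \<Rightarrow> int^'n \<Rightarrow> real^'n \<Rightarrow> complex) \<Rightarrow> bool" where
  "Lp_expansion p f lam a \<longleftrightarrow>
     (\<lambda>N. Lp_norm p (\<lambda>x. f x - (\<Sum>j<N. \<Sum>\<^sub>\<infinity>m. lam j m * a j m x))) \<longlonglongrightarrow> 0"

definition K_rep ::
  "real \<Rightarrow> nat \<Rightarrow> real \<Rightarrow> ennreal \<Rightarrow> ennreal \<Rightarrow> (real^'n \<Rightarrow> complex) \<Rightarrow>
     (nat \<Rightarrow> int^'n \<Rightarrow> complex) \<Rightarrow> (nat \<Rightarrow> int^'n \<Rightarrow> real^'n \<Rightarrow> complex) \<Rightarrow> bool" where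
  "K_rep d K s p q f lam a \<longleftrightarrow>
     (\<forall>j m. K_atom d K j m (a j m)) \<and> lam \<in> b_space s p q \<and> Lp_expansion p f lam a"

definition Besov ::
  "real \<Rightarrow> nat \<Rightarrow> real \<Rightarrow> ennreal \<Rightarrow> ennreal \<Rightarrow> (real^'n \<Rightarrow> complex) set" where
  "Besov d K s p q = {f \<in> Lp p. \<exists>lam a. K_rep d K s p q f lam a}"

definition Besov_norm ::
  "real \<Rightarrow> nat \<Rightarrow> real \<Rightarrow> ennreal \<Rightarrow> ennreal \<Rightarrow> (real^'n \<Rightarrow> complex) \<Rightarrow> ennreal" where
  "Besov_norm d K s p q f = Inf {b_norm s p q lam | lam a. K_rep d K s p q f lam a}"

text \<open>\<open>Lip\<close>-atoms are real-valued, the coefficients are complex.\<close>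

definition Lip_rep ::
  "real \<Rightarrow> real \<Rightarrow> ennreal \<Rightarrow> ennreal \<Rightarrow> (real^'n \<Rightarrow> complex) \<Rightarrow>
     (nat \<Rightarrow> int^'n \<Rightarrow> complex) \<Rightarrow> (nat \<Rightarrow> int^'n \<Rightarrow> real^'n \<Rightarrow> real) \<Rightarrow> bool" where
  "Lip_rep d s p q f lam a \<longleftrightarrow>
     (\<forall>j m. Lip_atom d j m (a j m)) \<and> lam \<in> b_space s p q \<and>
     Lp_expansion p f lam (\<lambda>j m x. complex_of_real (a j m x))"

definition Lip_norm ::
  "real \<Rightarrow> real \<Rightarrow> ennreal \<Rightarrow> ennreal \<Rightarrow> (real^'n \<Rightarrow> complex) \<Rightarrow> ennreal" where
  "Lip_norm d s p q f = Inf {b_norm s p q lam | lam a. Lip_rep d s p q f lam a}"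


section \<open>Equivalent quasi-norms\<close>

text \<open>Quasi-norms on spaces of functions modulo equality almost everywhere.\<close>

definition quasi_norm_on :: "(real^'n \<Rightarrow> complex) set \<Rightarrow> ((real^'n \<Rightarrow> complex) \<Rightarrow> ennreal) \<Rightarrow> bool" where
  "quasi_norm_on V N \<longleftrightarrow>
     (\<forall>f\<in>V. N f < \<infinity>) \<and>
     (\<forall>f\<in>V. \<forall>g\<in>V. (AE x in lebesgue. f x = g x) \<longrightarrow> N f = N g) \<and>
     (\<forall>f\<in>V. N f = 0 \<longleftrightarrow> (AE x in lebesgue. f x = 0)) \<and>
     (\<forall>f\<in>V. \<forall>c. N (\<lambda>x. c * f x) = ennreal (norm c) * N f) \<and>
     (\<exists>C::real. \<forall>f\<in>V. \<forall>g\<in>V. N (\<lambda>x. f x + g x) \<le> ennreal C * (N f + N g))"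

definition equivalent_on ::
  "(real^'n \<Rightarrow> complex) set \<Rightarrow> ((real^'n \<Rightarrow> complex) \<Rightarrow> ennreal) \<Rightarrow>
     ((real^'n \<Rightarrow> complex) \<Rightarrow> ennreal) \<Rightarrow> bool" where
  "equivalent_on V N N' \<longleftrightarrow>
     (\<exists>c C::real. 0 < c \<and> 0 < C \<and> (\<forall>f\<in>V. ennreal c * N f \<le> N' f \<and> N' f \<le> ennreal C * N f))"

end

theory Submission
  imports Defs
begin

text \<open>Let a \<open>rough\<close> atom at the cube \<open>(k, m)\<close> be a complex function that is supported in a fixed multiple of the
cube, is bounded by a constant \<open>A\<close> and has Lipschitz constant \<open>A 2\<^sup>k\<close>.  Both kinds of atoms are rough:
\<open>Lip\<close>-atoms by definition, \<open>K\<close>-atoms by the mean value theorem, because \<open>s > 0\<close> forces \<open>K \<ge> 1\<close>.  So it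
suffices to pass from an expansion of \<open>f\<close> in rough atoms, with coefficients \<open>\<lambda>\<close>, to expansions in
\<open>K\<close>-atoms and in \<open>Lip\<close>-atoms whose coefficients have a quasi-norm at most \<open>C \<parallel>\<lambda>\<parallel>\<close>
(\<open>K_rep_of_rough\<close>, \<open>Lip_rep_of_rough\<close>).

For \<open>p < 1\<close> the function \<open>f\<close> need not be locally integrable, so it cannot be mollified.  The partial sums
\<open>P\<^sub>j\<close> of the given expansion are continuous, however, and can be sampled.  Let \<open>\<psi>\<^sub>j\<^sub>,\<^sub>m\<close>, with \<open>m\<close> ranging over
\<open>2\<int>\<^sup>n\<close>, be a smooth partition of unity at scale \<open>2\<^sup>-\<^sup>j\<close>, and let
\<open>T\<^sub>j u = \<Sum>\<^sub>m u(2\<^sup>-\<^sup>j m) \<psi>\<^sub>j\<^sub>,\<^sub>m\<close>.  Then \<open>f = \<Sum>\<^sub>j h\<^sub>j\<close> with \<open>h\<^sub>j = T\<^sub>j\<^sub>+\<^sub>1 P\<^sub>j\<^sub>+\<^sub>1 - T\<^sub>j P\<^sub>j\<close>, since the sum telescopes and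
\<open>T\<^sub>j P\<^sub>j - P\<^sub>j\<close> tends to \<open>0\<close> in \<open>L\<^sub>p\<close>.  The function \<open>h\<^sub>j\<close> is smooth at scale \<open>2\<^sup>-\<^sup>j\<close>, and near \<open>z = 2\<^sup>-\<^sup>j m\<close> it
only sees the oscillation of \<open>P\<^sub>j\<close> and the terms of level \<open>j\<close>, which are bounded by a multiple of
\<open>\<nu>\<^sub>j\<^sub>,\<^sub>m = \<Sum>\<^sub>k\<^sub>\<le>\<^sub>j 2\<^sup>-\<^sup>(\<^sup>j\<^sup>-\<^sup>k\<^sup>) \<Sum>\<^sub>l |\<lambda>\<^sub>k\<^sub>,\<^sub>l|\<close>, the inner sum being over the cubes of level \<open>k\<close> near \<open>z\<close>.
Multiplying \<open>h\<^sub>j\<close> by a second copy of the partition of unity cuts it into atoms with coefficients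
\<open>C \<nu>\<^sub>j\<^sub>,\<^sub>m\<close> (\<open>smooth_decomposition\<close>).  The inequality \<open>\<parallel>\<nu>\<parallel> \<le> C \<parallel>\<lambda>\<parallel>\<close> is a Hardy inequality and is the
place where \<open>s < 1\<close> enters (\<open>b_norm_spread_le\<close>).

\<open>Lip\<close>-atoms are real.  To represent a complex \<open>h\<^sub>j\<close> with one real atom for each cube, its real part is
cut along \<open>2\<int>\<^sup>n\<close> and its imaginary part along the disjoint lattice \<open>2\<int>\<^sup>n + (1, \<dots>, 1)\<close>; the cubes of side
length \<open>2\<^sup>-\<^sup>j\<^sup>+\<^sup>1\<close> centred at either lattice still cover the space.

The quasi-norm axioms follow from the same circle of ideas.  For the triangle inequality
\<open>\<lambda> a + \<mu> b\<close> is \<open>|\<lambda>| + |\<mu>|\<close> times a rough atom, and for definiteness \<open>\<parallel>f\<parallel>\<^sub>p \<le> C \<parallel>\<lambda>\<parallel>\<close> for every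
representation (\<open>Lp_norm_le_b_norm\<close>).

Throughout, sums over levels with geometric weights and over boundedly many neighbours are replaced by
suprema.  The \<open>p\<close>-th power of a supremum is at most the sum of the \<open>p\<close>-th powers, for every \<open>p > 0\<close>, so that
all exponents are treated alike.\<close>

section \<open>Powers and \<open>\<ell>\<^sub>q\<close>-norms of functions with values in \<open>[0, \<infinity>]\<close>\<close>

lemma epowr_0 [simp]: "epowr 0 r = 0"
  by (simp add: epowr_def)

lemma epowr_top [simp]: "epowr top r = top"
  by (simp add: epowr_def)

lemma epowr_ennreal: "0 \<le> x \<Longrightarrow> epowr (ennreal x) r = ennreal (x powr r)"
  by (simp add: epowr_def)

lemma epowr_mono: "x \<le> y \<Longrightarrow> 0 \<le> r \<Longrightarrow> epowr x r \<le> epowr y r"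
  by (cases x; cases y) (auto simp: epowr_ennreal top.extremum_unique intro!: ennreal_leI powr_mono2)

lemma epowr_mult: "0 < r \<Longrightarrow> epowr (x * y) r = epowr x r * epowr y r"
proof (cases x; cases y)
  fix a assume r: "0 < r" "0 \<le> a" "x = ennreal a" "y = top"
  then show ?thesis
    by (cases "a = 0") (auto simp: epowr_ennreal ennreal_mult_top)
next
  fix a assume r: "0 < r" "0 \<le> a" "y = ennreal a" "x = top"
  then show ?thesis
    by (cases "a = 0") (auto simp: epowr_ennreal ennreal_top_mult)
qed (auto simp: epowr_ennreal powr_mult simp flip: ennreal_mult)

lemma epowr_powr: "0 < r \<Longrightarrow> epowr (epowr x r) t = epowr x (r * t)"
  by (cases x) (auto simp: epowr_ennreal powr_powr)

lemma epowr_1 [simp]: "epowr x 1 = x"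
  by (cases x) (auto simp: epowr_ennreal)

lemma epowr_inverse [simp]: "0 < r \<Longrightarrow> epowr (epowr x r) (1 / r) = x"
    "0 < r \<Longrightarrow> epowr (epowr x (1 / r)) r = x"
  by (simp_all add: epowr_powr)

lemma epowr_eq_0_iff [simp]: "epowr x r = 0 \<longleftrightarrow> x = 0"
  by (cases x) (auto simp: epowr_ennreal)

lemma epowr_measurable [measurable]: "(\<lambda>x. epowr x r) \<in> borel_measurable borel"
  unfolding epowr_def by measurable

text \<open>Only the crude \<open>x + y \<le> 2 max x y\<close> is used, so that all exponents are covered at once.\<close>

lemma epowr_add_le:
  assumes "0 < r"
  shows "epowr (x + y) r \<le> ennreal (2 powr r) * (epowr x r + epowr y r)"
proof -
  have "x + y \<le> 2 * max x y"
    by (metis add_mono max.cobounded1 max.cobounded2 mult_2)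
  then have "epowr (x + y) r \<le> epowr 2 r * epowr (max x y) r"
    using epowr_mono[of "x + y" "2 * max x y" r] assms by (simp add: epowr_mult)
  also have "epowr (max x y) r \<le> epowr x r + epowr y r"
    by (cases "x \<le> y") (auto simp: max_def)
  also have "epowr 2 r = ennreal (2 powr r)"
    using epowr_ennreal[of 2 r] by simp
  finally show ?thesis by (simp add: mult_left_mono)
qed

lemma elem_le_count_nn_integral:
  fixes F :: "'i \<Rightarrow> ennreal"
  shows "F i \<le> (\<integral>\<^sup>+i. F i \<partial>count_space UNIV)"
  using nn_integral_ge_point[of i UNIV F] by simp

text \<open>Each \<open>x i\<close> is bounded by the root of the sum on the right, hence so is their supremum.\<close>

lemma epowr_SUP_le:
  assumes "0 < r" and "F \<le> (SUP i. x i)"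
  shows "epowr F r \<le> (\<integral>\<^sup>+i. epowr (x i) r \<partial>count_space UNIV)"
proof -
  let ?S = "\<integral>\<^sup>+i. epowr (x i) r \<partial>count_space UNIV"
  have "x i \<le> epowr ?S (1 / r)" for i
    using epowr_mono[OF elem_le_count_nn_integral[of "\<lambda>i. epowr (x i) r" i], of "1 / r"] assms(1)
    by simp
  then have "F \<le> epowr ?S (1 / r)"
    using assms(2) by (meson SUP_least order_trans)
  then have "epowr F r \<le> epowr (epowr ?S (1 / r)) r"
    using assms(1) by (intro epowr_mono) auto
  then show ?thesis using assms(1) by simp
qed

text \<open>This turns the sums that define \<open>lp_norm\<close> into integrals, for which Fubini is at hand.\<close>

lemma infsum_eq_count_nn_integral:
  fixes F :: "'i::countable \<Rightarrow> ennreal"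
  shows "(\<Sum>\<^sub>\<infinity>i. F i) = (\<integral>\<^sup>+i. F i \<partial>count_space UNIV)"
proof (cases "finite (UNIV :: 'i set)")
  case True
  then show ?thesis by (simp add: nn_integral_count_space_finite)
next
  case False
  let ?h = "from_nat_into (UNIV :: 'i set)"
  have bij: "bij_betw ?h UNIV UNIV"
    using False by (simp add: bij_betw_from_nat_into)
  have "(\<Sum>\<^sub>\<infinity>i. F i) = (\<Sum>\<^sub>\<infinity>k. F (?h k))"
    using infsum_reindex_bij_betw[OF bij, of F] by simp
  also have "\<dots> = (\<Sum>k. F (?h k))"
  proof -
    have "((\<lambda>k. F (?h k)) has_sum (\<Sum>\<^sub>\<infinity>k. F (?h k))) UNIV"
      by (intro has_sum_infsum nonneg_summable_on_complete) auto
    then have "(\<lambda>k. F (?h k)) sums (\<Sum>\<^sub>\<infinity>k. F (?h k))"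
      by (rule has_sum_imp_sums)
    then show ?thesis by (simp add: sums_unique)
  qed
  also have "\<dots> = (\<integral>\<^sup>+k. F (?h k) \<partial>count_space UNIV)"
    by (simp add: nn_integral_count_space_nat)
  also have "\<dots> = (\<integral>\<^sup>+i. F i \<partial>count_space UNIV)"
    by (rule nn_integral_bij_count_space[OF bij])
  finally show ?thesis .
qed

lemma exponent_cases:
  fixes p :: ennreal
  assumes "0 < p"
  obtains "p = \<infinity>" | "p \<noteq> \<infinity>" "0 < enn2real p" "enn2real (1 / p) = 1 / enn2real p"
proof (cases p)
  case (real r)
  then have "0 < r" using assms by auto
  with real have "1 / p = ennreal (1 / r)"
    by (metis divide_ennreal ennreal_1 zero_le_one)
  with real \<open>0 < r\<close> show ?thesis by (intro that(2)) auto
qed (use that in auto)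

text \<open>The common form of the inner norm over \<open>\<int>\<^sup>n\<close> and the outer norm over the levels of \<open>b_norm\<close>.\<close>

definition lq_norm :: "ennreal \<Rightarrow> ('i \<Rightarrow> ennreal) \<Rightarrow> ennreal" where
  "lq_norm p F =
     (if p = \<infinity> then (SUP i. F i)
      else epowr (\<integral>\<^sup>+i. epowr (F i) (enn2real p) \<partial>count_space UNIV) (1 / enn2real p))"

lemma lp_norm_eq: "lp_norm p c = lq_norm p (\<lambda>m. ennreal (norm (c m)))"
  by (simp add: lp_norm_def lq_norm_def epowr_ennreal infsum_eq_count_nn_integral)

lemma b_norm_eq:
  fixes lam :: "nat \<Rightarrow> int^'n \<Rightarrow> complex"
  shows "b_norm s p q lam = lq_norm q (\<lambda>j. ennreal (2 powr (real j * (s - real CARD('n) * enn2real (1 / p))))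
                     * lq_norm p (\<lambda>m. ennreal (norm (lam j m))))"
  by (simp add: b_norm_def Let_def lq_norm_def[of q] lp_norm_eq nn_integral_count_space_nat)

lemma lq_norm_mono: "0 < p \<Longrightarrow> (\<And>i. F i \<le> G i) \<Longrightarrow> lq_norm p F \<le> lq_norm p G"
  unfolding lq_norm_def
  by (auto intro!: SUP_mono' epowr_mono nn_integral_mono simp: )

lemma elem_le_lq_norm:
  assumes "0 < p" shows "F i \<le> lq_norm p F"
  using assms
proof (cases rule: exponent_cases)
  case 2
  have "epowr (epowr (F i) (enn2real p)) (1 / enn2real p) \<le> lq_norm p F"
    using 2 by (auto simp: lq_norm_def simp del: epowr_inverse intro!: epowr_mono elem_le_count_nn_integral)
  then show ?thesis by (simp only: epowr_inverse 2)
qed (auto simp: lq_norm_def intro: SUP_upper)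

lemma lq_norm_cmult:
  assumes "0 < p" shows "lq_norm p (\<lambda>i. c * F i) = c * lq_norm p F"
  using assms
proof (cases rule: exponent_cases)
  case 2
  then show ?thesis
    by (simp add: lq_norm_def epowr_mult nn_integral_cmult)
qed (auto simp: lq_norm_def SUP_mult_left_ennreal)

lemma lq_norm_add:
  assumes "0 < p"
  shows "\<exists>C::real. 0 < C \<and> (\<forall>F G :: 'i \<Rightarrow> ennreal. lq_norm p (\<lambda>i. F i + G i)
    \<le> ennreal C * (lq_norm p F + lq_norm p G))"
  using assms
proof (cases rule: exponent_cases)
  case 1
  have "F i + G i \<le> (SUP i. F i) + (SUP i. G i)" for F G :: "'i \<Rightarrow> ennreal" and i
    by (intro add_mono SUP_upper) auto
  then show ?thesis
    using 1 by (intro exI[of _ 1]) (auto simp: lq_norm_def intro!: SUP_least)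
next
  case 2
  let ?r = "enn2real p"
  let ?C = "2 powr (1 / ?r) * 2"
  show ?thesis
  proof (intro exI[of _ ?C] conjI allI)
    fix F G :: "'i \<Rightarrow> ennreal"
    have "(\<integral>\<^sup>+i. epowr (F i + G i) ?r \<partial>count_space UNIV)
        \<le> (\<integral>\<^sup>+i. ennreal (2 powr ?r) * (epowr (F i) ?r + epowr (G i) ?r) \<partial>count_space UNIV)"
      using 2 by (intro nn_integral_mono epowr_add_le)
    also have "\<dots> = ennreal (2 powr ?r) *
       ((\<integral>\<^sup>+i. epowr (F i) ?r \<partial>count_space UNIV) + (\<integral>\<^sup>+i. epowr (G i) ?r \<partial>count_space UNIV))"
      by (simp add: nn_integral_cmult nn_integral_add)
    finally have "lq_norm p (\<lambda>i. F i + G i) \<le> epowr (ennreal (2 powr ?r) *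
       ((\<integral>\<^sup>+i. epowr (F i) ?r \<partial>count_space UNIV) + (\<integral>\<^sup>+i. epowr (G i) ?r \<partial>count_space UNIV))) (1 / ?r)"
      using 2 by (simp add: lq_norm_def epowr_mono)
    also have "\<dots> = 2 * epowr ((\<integral>\<^sup>+i. epowr (F i) ?r \<partial>count_space UNIV) + (\<integral>\<^sup>+i. epowr
      (G i) ?r \<partial>count_space UNIV)) (1 / ?r)"
      using 2 by (simp add: epowr_mult epowr_ennreal powr_powr)
    also have "\<dots> \<le> 2 * (ennreal (2 powr (1 / ?r)) * (lq_norm p F + lq_norm p G))"
      using 2 epowr_add_le[of "1 / ?r"] by (intro mult_left_mono) (auto simp: lq_norm_def)
    also have "\<dots> = ennreal ?C * (lq_norm p F + lq_norm p G)"
      by (simp add: ennreal_mult mult_ac)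
    finally show "lq_norm p (\<lambda>i. F i + G i) \<le> ennreal ?C * (lq_norm p F + lq_norm p G)" .
  qed auto
qed

text \<open>A Schur test for suprema instead of sums: \<open>epowr_SUP_le\<close> followed by Tonelli.  It is the
integral inequality behind all estimates of norms below.\<close>

lemma nn_integral_sup_kernel:
  fixes G :: "'i::countable \<Rightarrow> ennreal"
  assumes r: "0 < r"
    and F: "\<And>x. F x \<le> (SUP i. \<kappa> i x * G i)"
    and [measurable]: "\<And>i. \<kappa> i \<in> borel_measurable M"
    and B: "\<And>i. (\<integral>\<^sup>+x. epowr (\<kappa> i x) r \<partial>M) \<le> B"
  shows "(\<integral>\<^sup>+x. epowr (F x) r \<partial>M) \<le> B * (\<integral>\<^sup>+i. epowr (G i) r \<partial>count_space UNIV)"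
proof -
  have "(\<integral>\<^sup>+x. epowr (F x) r \<partial>M)
      \<le> (\<integral>\<^sup>+x. (\<integral>\<^sup>+i. epowr (\<kappa> i x) r * epowr (G i) r \<partial>count_space UNIV) \<partial>M)"
    using epowr_SUP_le[OF r F] r by (intro nn_integral_mono) (simp add: epowr_mult)
  also have "\<dots> = (\<integral>\<^sup>+i. (\<integral>\<^sup>+x. epowr (\<kappa> i x) r * epowr (G i) r \<partial>M) \<partial>count_space UNIV)"
    by (rule nn_integral_count_space_nn_integral) auto
  also have "\<dots> = (\<integral>\<^sup>+i. (\<integral>\<^sup>+x. epowr (\<kappa> i x) r \<partial>M) * epowr (G i) r \<partial>count_space UNIV)"
    by (simp add: nn_integral_multc)
  also have "\<dots> \<le> (\<integral>\<^sup>+i. B * epowr (G i) r \<partial>count_space UNIV)"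
    by (intro nn_integral_mono mult_right_mono B) auto
  also have "\<dots> = B * (\<integral>\<^sup>+i. epowr (G i) r \<partial>count_space UNIV)"
    by (simp add: nn_integral_cmult)
  finally show ?thesis .
qed

lemma lq_norm_sup_kernel:
  fixes G :: "'i::countable \<Rightarrow> ennreal"
  assumes p: "0 < p"
    and F: "\<And>x. F x \<le> (SUP i. \<kappa> i x * G i)"
    and B: "\<And>i. lq_norm p (\<kappa> i) \<le> B"
  shows "lq_norm p F \<le> B * lq_norm p G"
  using p
proof (cases rule: exponent_cases)
  case 1
  have inf: "\<kappa> i x \<le> B" for i x
    using elem_le_lq_norm[OF p, of "\<kappa> i" x] B[of i] by (rule order_trans)
  have "\<kappa> i x * G i \<le> B * (SUP i. G i)" for i x
    by (intro mult_mono inf SUP_upper) auto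
  then have "F x \<le> B * (SUP i. G i)" for x
    using F[of x] by (meson SUP_least order_trans)
  then show ?thesis using 1 by (auto simp: lq_norm_def intro!: SUP_least)
next
  case 2
  have fin: "(\<integral>\<^sup>+x. epowr (\<kappa> i x) (enn2real p) \<partial>count_space UNIV) \<le> epowr B (enn2real p)" for i
    using epowr_mono[OF B[of i], of "enn2real p"] 2 by (simp add: lq_norm_def)
  from 2 have "lq_norm p F
    \<le> epowr (epowr B (enn2real p) * (\<integral>\<^sup>+i. epowr (G i) (enn2real p) \<partial>count_space UNIV)) (1 / enn2real p)"
    using fin by (auto simp: lq_norm_def intro!: epowr_mono nn_integral_sup_kernel[OF _ F])
  also have "\<dots> = B * lq_norm p G"
    using 2 by (simp add: epowr_mult lq_norm_def)
  finally show ?thesis .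
qed

lemma Lp_norm_finite_eq:
  assumes "p \<noteq> \<infinity>"
  shows "Lp_norm p f = epowr (\<integral>\<^sup>+x. epowr (ennreal (norm (f x))) (enn2real p) \<partial>lebesgue) (1 / enn2real p)"
  using assms by (simp add: Lp_norm_def epowr_ennreal)

lemma Lp_norm_sup_kernel:
  fixes G :: "'i::countable \<Rightarrow> ennreal" and f :: "real^'n \<Rightarrow> complex"
  assumes p: "0 < p" and f[measurable]: "f \<in> borel_measurable lebesgue"
    and F: "\<And>x. ennreal (norm (f x)) \<le> (SUP i. \<kappa> i x * G i)"
    and meas: "\<And>i. \<kappa> i \<in> borel_measurable lebesgue"
    and inf: "\<And>i x. p = \<infinity> \<Longrightarrow> \<kappa> i x \<le> B"
    and fin: "\<And>i. p \<noteq> \<infinity> \<Longrightarrow> 0 < enn2real p \<Longrightarrow> (\<integral>\<^sup>+x. epowr (\<kappa> i x) (enn2real p) \<partial>lebesgue) \<le> epowr B (enn2real p)"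
  shows "Lp_norm p f \<le> B * lq_norm p G"
  using p
proof (cases rule: exponent_cases)
  case 1
  have "\<kappa> i x * G i \<le> B * (SUP i. G i)" for i x
    by (intro mult_mono inf 1 SUP_upper) auto
  then have "ennreal (norm (f x)) \<le> B * (SUP i. G i)" for x
    using F[of x] by (meson SUP_least order_trans)
  then show ?thesis using 1 by (auto simp: Lp_norm_def lq_norm_def intro!: esssup_I)
next
  case 2
  then have "Lp_norm p f
    \<le> epowr (epowr B (enn2real p) * (\<integral>\<^sup>+i. epowr (G i) (enn2real p) \<partial>count_space UNIV)) (1 / enn2real p)"
    using fin by (auto simp: Lp_norm_finite_eq intro!: epowr_mono nn_integral_sup_kernel[OF _ F meas])
  also have "\<dots> = B * lq_norm p G"
    using 2 by (simp add: epowr_mult lq_norm_def)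
  finally show ?thesis .
qed

lemma Lp_norm_cong_AE:
  assumes f: "f \<in> borel_measurable lebesgue" and g: "g \<in> borel_measurable lebesgue"
    and "AE x in lebesgue. f x = g x"
  shows "Lp_norm p f = Lp_norm p g"
proof -
  have "esssup lebesgue (\<lambda>x. ennreal (norm (f x))) = esssup lebesgue (\<lambda>x. ennreal (norm (g x)))"
    using assms by (intro esssup_AE_cong) auto
  moreover have "(\<integral>\<^sup>+ x. ennreal (norm (f x) powr enn2real p) \<partial>lebesgue)
    = (\<integral>\<^sup>+ x. ennreal (norm (g x) powr enn2real p) \<partial>lebesgue)"
    using assms(3) by (intro nn_integral_cong_AE) auto
  ultimately show ?thesis by (simp add: Lp_norm_def)
qed

lemma Lp_norm_triangle:
  assumes "0 < p"
  shows "\<exists>C::real. 0 < C \<and> (\<forall>f\<in>borel_measurable lebesgue. \<forall>g\<in>borel_measurable lebesgue.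
           Lp_norm p (\<lambda>x::real^'n. f x + g x) \<le> ennreal C * (Lp_norm p f + Lp_norm p g))"
  using assms
proof (cases rule: exponent_cases)
  case 1
  show ?thesis
  proof (intro exI[of _ 1] conjI ballI)
    fix f g :: "real^'n \<Rightarrow> complex" assume [measurable]: "f \<in> borel_measurable lebesgue" "g
      \<in> borel_measurable lebesgue"
    have "AE x in lebesgue. ennreal (norm (f x)) \<le> Lp_norm p f"
      using 1 by (simp add: Lp_norm_def esssup_AE)
    moreover have "AE x in lebesgue. ennreal (norm (g x)) \<le> Lp_norm p g"
      using 1 by (simp add: Lp_norm_def esssup_AE)
    ultimately have "AE x in lebesgue. ennreal (norm (f x + g x)) \<le> Lp_norm p f + Lp_norm p g"
    proof eventually_elim
      case (elim x)
      have "ennreal (norm (f x + g x)) \<le> ennreal (norm (f x)) + ennreal (norm (g x))"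
        by (simp add: norm_triangle_ineq flip: ennreal_plus)
      with elim show ?case by (meson add_mono order_trans)
    qed
    then show "Lp_norm p (\<lambda>x. f x + g x) \<le> ennreal 1 * (Lp_norm p f + Lp_norm p g)"
      by (subst Lp_norm_def) (simp add: 1 esssup_I)
  qed auto
next
  case 2
  let ?r = "enn2real p"
  let ?C = "2 powr (1 / ?r) * 2"
  let ?I = "\<lambda>f. \<integral>\<^sup>+x. epowr (ennreal (norm (f x))) ?r \<partial>(lebesgue :: (real^'n) measure)"
  show ?thesis
  proof (intro exI[of _ ?C] conjI ballI)
    fix f g :: "real^'n \<Rightarrow> complex" assume [measurable]: "f \<in> borel_measurable lebesgue" "g
      \<in> borel_measurable lebesgue"
    have "epowr (ennreal (norm (f x + g x))) ?r
      \<le> ennreal (2 powr ?r) * (epowr (ennreal (norm (f x))) ?r + epowr (ennreal (norm (g x))) ?r)" for x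
    proof -
      have "ennreal (norm (f x + g x)) \<le> ennreal (norm (f x)) + ennreal (norm (g x))"
        by (simp add: norm_triangle_ineq flip: ennreal_plus)
      then show ?thesis
        using 2 epowr_mono epowr_add_le by (meson less_imp_le order_trans)
    qed
    then have "?I (\<lambda>x. f x + g x)
      \<le> (\<integral>\<^sup>+x. ennreal (2 powr ?r) * (epowr (ennreal (norm (f x))) ?r + epowr (ennreal (norm
        (g x))) ?r) \<partial>lebesgue)"
      by (intro nn_integral_mono)
    also have "\<dots> = ennreal (2 powr ?r) * (?I f + ?I g)"
      by (simp add: nn_integral_cmult nn_integral_add)
    finally have "Lp_norm p (\<lambda>x. f x + g x) \<le> epowr (ennreal (2 powr ?r) * (?I f + ?I g)) (1 / ?r)"
      using 2 by (simp add: Lp_norm_finite_eq epowr_mono)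
    also have "\<dots> = 2 * epowr (?I f + ?I g) (1 / ?r)"
      using 2 by (simp add: epowr_mult epowr_ennreal powr_powr)
    also have "\<dots> \<le> 2 * (ennreal (2 powr (1 / ?r)) * (Lp_norm p f + Lp_norm p g))"
      using 2 epowr_add_le[of "1 / ?r"] by (intro mult_left_mono) (auto simp: Lp_norm_finite_eq)
    also have "\<dots> = ennreal ?C * (Lp_norm p f + Lp_norm p g)"
      by (simp add: ennreal_mult mult_ac)
    finally show "Lp_norm p (\<lambda>x. f x + g x) \<le> ennreal ?C * (Lp_norm p f + Lp_norm p g)" .
  qed auto
qed

lemma Lp_norm_cmult_le:
  fixes f :: "real^'n \<Rightarrow> complex"
  assumes "0 < p" and [measurable]: "f \<in> borel_measurable lebesgue"
  shows "Lp_norm p (\<lambda>x. c * f x) \<le> ennreal (norm c) * Lp_norm p f"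
  using assms(1)
proof (cases rule: exponent_cases)
  case 1
  have "AE x in lebesgue. ennreal (norm (f x)) \<le> Lp_norm p f"
    using 1 by (simp add: Lp_norm_def esssup_AE)
  then have "AE x in lebesgue. ennreal (norm (c * f x)) \<le> ennreal (norm c) * Lp_norm p f"
    by eventually_elim (simp add: norm_mult ennreal_mult mult_left_mono)
  then show ?thesis
    by (subst Lp_norm_def) (simp add: 1 esssup_I)
next
  case 2
  then show ?thesis
    by (simp add: Lp_norm_finite_eq norm_mult ennreal_mult epowr_mult nn_integral_cmult)
qed

lemma Lp_norm_0_iff:
  fixes f :: "real^'n \<Rightarrow> complex"
  assumes "0 < p" and [measurable]: "f \<in> borel_measurable lebesgue"
  shows "Lp_norm p f = 0 \<longleftrightarrow> (AE x in lebesgue. f x = 0)"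
  using assms(1)
proof (cases rule: exponent_cases)
  case 1
  show ?thesis
  proof
    assume "Lp_norm p f = 0"
    then show "AE x in lebesgue. f x = 0"
      using esssup_AE[of "\<lambda>x. ennreal (norm (f x))" lebesgue] 1 by (simp add: Lp_norm_def)
  next
    assume "AE x in lebesgue. f x = 0"
    then have "esssup lebesgue (\<lambda>x. ennreal (norm (f x))) \<le> 0"
      by (intro esssup_I) auto
    then show "Lp_norm p f = 0" using 1 by (simp add: Lp_norm_def)
  qed
next
  case 2
  then show ?thesis
    by (simp add: Lp_norm_finite_eq nn_integral_0_iff_AE)
qed

section \<open>Smooth functions at scale \<open>1 / r\<close>\<close>

text \<open>The derivatives of order \<open>i \<le> k\<close> are bounded by \<open>A r\<^sup>i\<close>.  With \<open>r = 2\<^sup>j\<close> and \<open>A = 1\<close> these are the bounds of a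
\<open>K\<close>-atom; the recursion over partial derivatives matches that of \<open>cont_diff\<close> and makes closure under
products an induction.\<close>

primrec smooth_bd :: "nat \<Rightarrow> real \<Rightarrow> real \<Rightarrow> (real^'n \<Rightarrow> complex) \<Rightarrow> bool" where
  "smooth_bd 0 r A f \<longleftrightarrow> continuous_on UNIV f \<and> (\<forall>x. norm (f x) \<le> A)"
| "smooth_bd (Suc k) r A f \<longleftrightarrow> f differentiable_on UNIV \<and> (\<forall>x. norm (f x) \<le> A) \<and>
     (\<forall>i. smooth_bd k r (A * r) (partial_deriv i f))"

lemma partial_derivI: "(f has_derivative D) (at x) \<Longrightarrow> partial_deriv i f x = D (axis i 1)"
  using frechet_derivative_at by (force simp: partial_deriv_def)

lemma smooth_bd_bound: "smooth_bd k r A f \<Longrightarrow> norm (f x) \<le> A"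
  by (cases k) auto

lemma smooth_bd_nonneg: "smooth_bd k r A f \<Longrightarrow> 0 \<le> A"
  using smooth_bd_bound[of k r A f 0] norm_ge_zero order_trans by blast

lemma smooth_bd_Suc_D: "smooth_bd (Suc k) r A f \<Longrightarrow> smooth_bd k r A f"
proof (induction k arbitrary: A f)
  case 0
  then show ?case by (auto simp: differentiable_imp_continuous_on)
next
  case (Suc k)
  then show ?case by (auto simp del: smooth_bd.simps(2) simp: smooth_bd.simps(2)[of
    "Suc k"] smooth_bd.simps(2)[of k _ _ f])
qed

lemma smooth_bd_mono:
  "smooth_bd k r A f \<Longrightarrow> A \<le> B \<Longrightarrow> 0 \<le> r \<Longrightarrow> smooth_bd k r B f"
proof (induction k arbitrary: A B f)
  case 0
  then show ?case by (auto intro: order_trans)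
next
  case (Suc k)
  have "A * r \<le> B * r" using Suc.prems by (intro mult_right_mono) auto
  then have "smooth_bd k r (B * r) (partial_deriv i f)" for i
    using Suc.IH[of "A * r" _ "B * r"] Suc.prems by simp
  with Suc.prems show ?case by (auto intro: order_trans)
qed

text \<open>Changing from scale \<open>1 / (c r)\<close> to the coarser scale \<open>1 / r\<close> costs the factor \<open>c\<^sup>k\<close>; used to pass
from level \<open>j + 1\<close> to level \<open>j\<close>.\<close>

lemma smooth_bd_scale:
  assumes "1 \<le> c" "0 \<le> r"
  shows "smooth_bd k (c * r) A f \<Longrightarrow> smooth_bd k r (c ^ k * A) f"
proof (induction k arbitrary: A f)
  case 0
  then show ?case by simp
next
  case (Suc k)
  have "0 \<le> A" using smooth_bd_nonneg[OF Suc.prems] .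
  then have "A \<le> c ^ Suc k * A"
    using mult_right_mono[of 1 "c ^ Suc k" A] one_le_power[OF assms(1), of "Suc k"] by simp
  moreover have "smooth_bd k r (c ^ k * (A * (c * r))) (partial_deriv i f)" for i
    using Suc by auto
  moreover have "c ^ k * (A * (c * r)) = c ^ Suc k * A * r" by (simp add: mult_ac)
  ultimately show ?case using Suc.prems
    by (auto intro: order_trans)
qed

lemma smooth_bd_has_derivative:
  "smooth_bd (Suc k) r A f \<Longrightarrow> \<exists>D. (f has_derivative D) (at x)"
  by (auto simp: differentiable_on_def differentiable_def)

lemma smooth_bd_const:
  "norm c \<le> A \<Longrightarrow> 0 \<le> r \<Longrightarrow> smooth_bd k r A (\<lambda>x::real^'n. c)"
proof (induction k arbitrary: A c)
  case (Suc k)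
  have "0 \<le> A" using Suc.prems(1) norm_ge_zero order_trans by blast
  then have "smooth_bd k r (A * r) (\<lambda>x::real^'n. 0)" using Suc.prems Suc.IH[of 0 "A * r"] by simp
  moreover have "partial_deriv i (\<lambda>x. c) = (\<lambda>x. 0)" for i :: 'n
    by (rule ext) (simp add: partial_derivI[OF has_derivative_const])
  ultimately show ?case using Suc.prems by simp
qed auto

lemma smooth_bd_add:
  "smooth_bd k r A f \<Longrightarrow> smooth_bd k r B g \<Longrightarrow> smooth_bd k r (A + B) (\<lambda>x. f x + g x)"
proof (induction k arbitrary: A B f g)
  case 0
  then show ?case by (auto intro!: continuous_intros norm_triangle_mono)
next
  case (Suc k)
  have "partial_deriv i (\<lambda>x. f x + g x) = (\<lambda>x. partial_deriv i f x + partial_deriv i g x)" for i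
  proof
    fix x
    obtain D E where "(f has_derivative D) (at x)" "(g has_derivative E) (at x)"
      using smooth_bd_has_derivative Suc.prems by metis
    then show "partial_deriv i (\<lambda>x. f x + g x) x = partial_deriv i f x + partial_deriv i g x"
      by (simp add: partial_derivI[OF has_derivative_add] partial_derivI)
  qed
  then show ?case using Suc
    by (auto intro!: norm_triangle_mono derivative_intros simp: distrib_right)
qed

lemma smooth_bd_cmult:
  "smooth_bd k r A f \<Longrightarrow> smooth_bd k r (norm c * A) (\<lambda>x. c * f x)"
proof (induction k arbitrary: A f)
  case 0
  then show ?case by (auto intro!: continuous_intros mult_left_mono simp: norm_mult)
next
  case (Suc k)
  have "partial_deriv i (\<lambda>x. c * f x) = (\<lambda>x. c * partial_deriv i f x)" for i
  proof
    fix x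
    obtain D where "(f has_derivative D) (at x)"
      using smooth_bd_has_derivative Suc.prems by metis
    then show "partial_deriv i (\<lambda>x. c * f x) x = c * partial_deriv i f x"
      by (simp add: partial_derivI[OF has_derivative_mult_right] partial_derivI)
  qed
  moreover have "(\<lambda>x. c * f x) differentiable_on UNIV"
    using Suc.prems by (auto intro!: derivative_intros)
  ultimately show ?case using Suc
    by (auto intro!: mult_left_mono simp: norm_mult mult.assoc)
qed

text \<open>The factor \<open>2\<^sup>k\<close> counts the terms of the Leibniz rule.\<close>

lemma smooth_bd_mult:
  "smooth_bd k r A f \<Longrightarrow> smooth_bd k r B g \<Longrightarrow> smooth_bd k r (2 ^ k * A * B) (\<lambda>x. f x * g x)"
proof (induction k arbitrary: A B f g)
  case 0
  then have "norm (f x) * norm (g x) \<le> A * B" for x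
    using smooth_bd_nonneg[OF "0.prems"(1)] by (intro mult_mono) auto
  with 0 show ?case by (auto intro!: continuous_intros simp: norm_mult)
next
  case (Suc k)
  have nn: "0 \<le> A" "0 \<le> B" using Suc.prems smooth_bd_nonneg by blast+
  have eq: "partial_deriv i (\<lambda>x. f x * g x) = (\<lambda>x. f x * partial_deriv i g x + partial_deriv i f x * g x)" for i
  proof
    fix x
    obtain D E where "(f has_derivative D) (at x)" "(g has_derivative E) (at x)"
      using smooth_bd_has_derivative Suc.prems by metis
    then show "partial_deriv i (\<lambda>x. f x * g x) x = f x * partial_deriv i g x + partial_deriv i f x * g x"
      by (simp add: partial_derivI[OF has_derivative_mult] partial_derivI)
  qed
  have "smooth_bd k r A f" "smooth_bd k r B g"
    using Suc.prems smooth_bd_Suc_D by blast+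
  then have "smooth_bd k r (2 ^ k * A * (B * r) + 2 ^ k * (A * r) * B) (\<lambda>x. f x * partial_deriv i g x
    + partial_deriv i f x * g x)" for i
    using Suc by (intro smooth_bd_add Suc.IH) auto
  moreover have "2 ^ k * A * (B * r) + 2 ^ k * (A * r) * B = 2 ^ Suc k * A * B * r"
    by simp
  ultimately have "smooth_bd k r (2 ^ Suc k * A * B * r) (partial_deriv i (\<lambda>x. f x * g x))" for i
    by (simp add: eq)
  moreover have "norm (f x * g x) \<le> 2 ^ Suc k * A * B" for x
  proof -
    have "norm (f x) * norm (g x) \<le> A * B"
      using Suc.prems nn by (intro mult_mono) auto
    also have "\<dots> \<le> 2 ^ Suc k * (A * B)"
      using mult_right_mono[of 1 "2 ^ Suc k" "A * B"] one_le_power[of "2::real" "Suc k"] nn by simp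
    finally show ?thesis by (simp add: norm_mult mult.assoc)
  qed
  ultimately show ?case using Suc.prems
    by (auto intro!: derivative_intros)
qed

lemma smooth_bd_sum:
  assumes "finite S" "0 \<le> r" "\<And>i. i \<in> S \<Longrightarrow> smooth_bd k r (A i) (f i)"
  shows "smooth_bd k r (\<Sum>i\<in>S. A i) (\<lambda>x. \<Sum>i\<in>S. f i x)"
  using assms by (induction S) (auto intro!: smooth_bd_const smooth_bd_add)

lemma smooth_bd_prod:
  assumes "finite S" "0 \<le> r" "\<And>i. i \<in> S \<Longrightarrow> smooth_bd k r A (f i)"
  shows "smooth_bd k r ((2 ^ k * A) ^ card S) (\<lambda>x. \<Prod>i\<in>S. f i x)"
  using assms by (induction S) (auto intro!: smooth_bd_const smooth_bd_mult)

lemma smooth_bd_cong: "smooth_bd k r A f \<Longrightarrow> (\<And>x. f x = g x) \<Longrightarrow> smooth_bd k r A g"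
  by (metis ext)

lemma smooth_bd_imp_cont_diff: "smooth_bd k r A f \<Longrightarrow> cont_diff k f"
  by (induction k arbitrary: A f) auto

lemma smooth_bd_continuous: "smooth_bd k r A f \<Longrightarrow> continuous_on UNIV f"
  by (cases k) (auto simp: differentiable_imp_continuous_on)

text \<open>\<open>foldr\<close> applies the last entry of the list first, whereas \<open>smooth_bd\<close> peels off the innermost derivative;
hence the list is taken apart from the right.\<close>

lemma smooth_bd_foldr:
  "smooth_bd k r A f \<Longrightarrow> length xs \<le> k \<Longrightarrow> norm (foldr partial_deriv xs f x) \<le> A * r ^ length xs"
proof (induction k arbitrary: xs A f)
  case 0
  then show ?case by auto
next
  case (Suc k)
  show ?case
  proof (cases xs rule: rev_cases)
    case Nil
    then show ?thesis using Suc.prems by auto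
  next
    case (snoc ys y)
    then have "norm (foldr partial_deriv ys (partial_deriv y f) x) \<le> A * r * r ^ length ys"
      using Suc by (intro Suc.IH) auto
    with snoc show ?thesis by (simp add: mult.assoc)
  qed
qed

text \<open>The enumeration chosen by \<open>multi_deriv\<close> is arbitrary, but its length is determined.\<close>

lemma multi_order_eq_length:
  fixes \<alpha> :: "nat^'n"
  assumes "\<And>i. count_list xs i = \<alpha> $ i"
  shows "multi_order \<alpha> = length xs"
proof -
  have "multi_order \<alpha> = (\<Sum>i\<in>UNIV. count_list xs i)"
    using assms by (simp add: multi_order_def)
  also have "\<dots> = (\<Sum>i\<in>set xs. count_list xs i)"
    by (rule sum.mono_neutral_right) (auto simp: count_list_0_iff)
  finally show ?thesis using sum_count_set[of xs "set xs"] by simp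
qed

lemma count_list_exists:
  fixes c :: "'n::finite \<Rightarrow> nat"
  shows "\<exists>xs. \<forall>i. count_list xs i = c i"
proof -
  obtain M where M: "\<And>i. count M i = c i"
    using Abs_multiset_inverse[of c] by (metis (mono_tags, lifting) finite mem_Collect_eq)
  obtain xs where "mset xs = M" using ex_mset by blast
  with M show ?thesis by (metis count_mset)
qed

lemma smooth_bd_multi_deriv:
  assumes "smooth_bd k r A f" "multi_order \<alpha> \<le> k"
  shows "norm (multi_deriv \<alpha> f x) \<le> A * r ^ multi_order \<alpha>"
proof -
  let ?xs = "SOME xs. \<forall>i. count_list xs i = \<alpha> $ i"
  have "\<forall>i. count_list ?xs i = \<alpha> $ i"
    by (rule someI_ex) (rule count_list_exists)
  then have "multi_order \<alpha> = length ?xs" by (intro multi_order_eq_length) auto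
  then show ?thesis using assms smooth_bd_foldr[OF assms(1), of ?xs x]
    by (simp add: multi_deriv_def)
qed

text \<open>The crude bound of the operator norm of the derivative by the sum of the partial derivatives suffices.\<close>

lemma partial_bound_imp_lipschitz:
  fixes f :: "real^'n \<Rightarrow> complex"
  assumes "f differentiable_on UNIV" and "\<And>i x. norm (partial_deriv i f x) \<le> B"
  shows "norm (f x - f y) \<le> real CARD('n) * B * norm (x - y)"
proof -
  let ?D = "\<lambda>x. frechet_derivative f (at x)"
  have D: "(f has_derivative ?D x) (at x)" for x
    using assms(1) by (auto simp: differentiable_on_def frechet_derivative_works)
  have "norm (?D x v) \<le> (real CARD('n) * B) * norm v" for x v
  proof -
    have lin: "linear (?D x)" using D has_derivative_linear by blast
    have "?D x v = ?D x (\<Sum>i\<in>UNIV. v $ i *\<^sub>R axis i 1)"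
      by (simp add: basis_expansion flip: scalar_mult_eq_scaleR)
    also have "\<dots> = (\<Sum>i\<in>UNIV. v $ i *\<^sub>R partial_deriv i f x)"
      by (simp add: linear_sum[OF lin] linear_scale[OF lin] partial_deriv_def)
    also have "norm \<dots> \<le> (\<Sum>i\<in>(UNIV::'n set). norm v * B)"
      by (intro sum_norm_le) (auto intro!: mult_mono assms(2) component_le_norm_cart)
    finally show ?thesis by (simp add: mult_ac)
  qed
  then have "onorm (?D x) \<le> real CARD('n) * B" for x
    by (rule onorm_le)
  then show ?thesis
    using differentiable_bound[of UNIV f ?D "real CARD('n) * B" x y] D by simp
qed

lemma smooth_bd_lipschitz:
  fixes f :: "real^'n \<Rightarrow> complex"
  assumes "smooth_bd k r A f" "1 \<le> k"
  shows "norm (f x - f y) \<le> real CARD('n) * (A * r) * norm (x - y)"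
  using assms by (intro partial_bound_imp_lipschitz; cases k) (auto dest: smooth_bd_bound)

text \<open>Only the multi-indices \<open>0\<close> and the unit vectors are used; for these the enumeration chosen by
\<open>multi_deriv\<close> is forced to be the empty and a one-element list.\<close>

lemma K_atom_lipschitz:
  fixes a :: "real^'n \<Rightarrow> complex"
  assumes "K_atom d K j m a" "1 \<le> K"
  shows "norm (a x) \<le> 1" "norm (a x - a y) \<le> real CARD('n) * 2 ^ j * norm (x - y)"
proof -
  have md: "\<exists>xs. multi_deriv \<alpha> a = foldr partial_deriv xs a \<and> (\<forall>i. count_list xs i = \<alpha> $ i)" for \<alpha>
    unfolding multi_deriv_def using someI_ex[OF count_list_exists[of "\<lambda>i. \<alpha> $ i"]] by blast
  have bd: "norm (multi_deriv \<alpha> a x) \<le> 2 ^ (multi_order \<alpha> * j)" if "multi_order \<alpha> \<le> K" for \<alpha> x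
    using assms(1) that by (simp add: K_atom_def)
  have "multi_deriv 0 a = a"
  proof -
    obtain xs where "multi_deriv 0 a = foldr partial_deriv xs a" "\<And>i. count_list xs i = 0"
      using md[of 0] by auto
    moreover have "xs = []"
    proof (cases xs)
      case (Cons l ys)
      with calculation(2)[of l] show ?thesis by simp
    qed auto
    ultimately show ?thesis by simp
  qed
  then show "norm (a x) \<le> 1"
    using bd[of 0 x] by (simp add: multi_order_def)
  have "norm (partial_deriv i a x) \<le> 2 ^ j" for i x
  proof -
    obtain xs where xs: "multi_deriv (axis i 1) a = foldr partial_deriv xs a" "\<And>l. count_list xs l
      = axis i 1 $ l"
      using md[of "axis i 1"] by auto
    have o: "multi_order (axis i 1 :: nat^'n) = 1"
      by (simp add: multi_order_def axis_def if_distrib cong: if_cong)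
    then have "length xs = 1" using multi_order_eq_length[OF xs(2)] by simp
    then obtain l where l: "xs = [l]" by (auto simp: length_Suc_conv)
    with xs(2)[of i] have "l = i" by (auto simp: axis_def split: if_splits)
    with l xs o bd[of "axis i 1" x] assms(2) show ?thesis by simp
  qed
  moreover have "a differentiable_on UNIV"
    using assms by (cases K) (auto simp: K_atom_def)
  ultimately show "norm (a x - a y) \<le> real CARD('n) * 2 ^ j * norm (x - y)"
    by (rule partial_bound_imp_lipschitz[rotated])
qed

section \<open>A smooth partition of unity over cosets of \<open>2\<int>\<^sup>n\<close>\<close>

text \<open>The one-dimensional analogue, for the construction of the partition of unity as a tensor product.\<close>

primrec smooth_bd1 :: "nat \<Rightarrow> real \<Rightarrow> (real \<Rightarrow> real) \<Rightarrow> bool" where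
  "smooth_bd1 0 A f \<longleftrightarrow> continuous_on UNIV f \<and> (\<forall>t. \<bar>f t\<bar> \<le> A)"
| "smooth_bd1 (Suc k) A f \<longleftrightarrow> (\<forall>t. \<bar>f t\<bar> \<le> A) \<and>
     (\<exists>f'. (\<forall>t. (f has_real_derivative f' t) (at t)) \<and> smooth_bd1 k A f')"

lemma smooth_bd1_bound: "smooth_bd1 k A f \<Longrightarrow> \<bar>f t\<bar> \<le> A"
  by (cases k) auto

lemma smooth_bd1_mono: "smooth_bd1 k A f \<Longrightarrow> A \<le> B \<Longrightarrow> smooth_bd1 k B f"
proof (induction k arbitrary: f)
  case (Suc k)
  then obtain f' where "\<And>t. (f has_real_derivative f' t) (at t)" "smooth_bd1 k A f'" by auto
  with Suc show ?case by (auto intro: order_trans)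
qed (auto intro: order_trans)

lemma smooth_bd1_continuous: "smooth_bd1 k A f \<Longrightarrow> continuous_on UNIV f"
  by (cases k) (auto intro: DERIV_continuous_on has_field_derivative_at_within)

lemma smooth_bd1_combine:
  "smooth_bd1 k A f \<Longrightarrow> smooth_bd1 k B g \<Longrightarrow>
    smooth_bd1 k (\<bar>c\<bar> * (A + B)) (\<lambda>t. c * (f (t + a) - g (t + b)))"
proof (induction k arbitrary: f g)
  case 0
  have "\<bar>f (t + a) - g (t + b)\<bar> \<le> A + B" for t
    using 0 by (metis abs_triangle_ineq4 add_mono order_trans smooth_bd1.simps(1))
  with 0 show ?case
    by (auto intro!: continuous_intros mult_left_mono continuous_on_compose2[of UNIV _ UNIV "\<lambda>x. x
      + _"] simp: abs_mult)
next
  case (Suc k)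
  then obtain f' g' where
    d: "\<And>t. (f has_real_derivative f' t) (at t)" "\<And>t. (g has_real_derivative g' t) (at t)"
    and s: "smooth_bd1 k A f'" "smooth_bd1 k B g'" by auto
  have "\<bar>f (t + a) - g (t + b)\<bar> \<le> A + B" for t
    using smooth_bd1_bound[OF Suc.prems(1), of "t + a"] smooth_bd1_bound[OF Suc.prems(2), of "t + b"]
      by linarith
  moreover have "((\<lambda>t. c * (f (t + a) - g (t + b))) has_real_derivative c * (f' (t + a) - g' (t + b)))
    (at t)" for t
    using d[of "t + a"] d[of "t + b"] by (auto intro!: derivative_eq_intros simp: DERIV_shift)
  moreover have "smooth_bd1 k (\<bar>c\<bar> * (A + B)) (\<lambda>t. c * (f' (t + a) - g' (t + b)))"
    using s by (rule Suc.IH)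
  ultimately show ?case
    by (auto simp: abs_mult intro!: mult_left_mono exI[of _ "\<lambda>t. c * (f' (t + a) - g' (t + b))"])
qed

text \<open>Averaging a step of order \<open>k\<close> over intervals of length \<open>\<delta>\<close> gains one derivative, and the derivative is an
explicit difference of translates, so that bounds come for free.  All values of the average are values of
the original step, by the mean value theorem applied to a primitive.\<close>

lemma smooth_step_exists:
  "0 < \<delta> \<Longrightarrow> \<exists>\<theta> A. smooth_bd1 k A \<theta> \<and> (\<forall>t\<le>-\<delta>. \<theta> t = 0) \<and> (\<forall>t\<ge>\<delta>. \<theta> t = 1)"
proof (induction k arbitrary: \<delta>)
  case 0
  let ?\<theta> = "\<lambda>t. max 0 (min 1 ((t + \<delta>) / (2 * \<delta>)))"
  have "smooth_bd1 0 1 ?\<theta>"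
    using 0 by (auto intro!: continuous_intros)
  moreover have "\<forall>t\<le>-\<delta>. ?\<theta> t = 0" "\<forall>t\<ge>\<delta>. ?\<theta> t = 1"
    using 0 by (auto simp: divide_simps)
  ultimately show ?case by blast
next
  case (Suc k)
  obtain \<theta> A where \<theta>: "smooth_bd1 k A \<theta>" "\<And>t. t \<le> -(\<delta>/2) \<Longrightarrow> \<theta> t = 0" "\<And>t. t \<ge> \<delta>/2 \<Longrightarrow> \<theta> t = 1"
    using Suc.IH[of "\<delta>/2"] Suc.prems by auto
  have "isCont \<theta> t" for t
    using smooth_bd1_continuous[OF \<theta>(1)] by (simp add: continuous_on_eq_continuous_at)
  then obtain \<Phi> where \<Phi>: "\<And>t. (\<Phi> has_real_derivative \<theta> t) (at t)"
    using einterval_antiderivative[of "-\<infinity>" "\<infinity>" \<theta>]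
    by (auto simp: has_real_derivative_iff_has_vector_derivative)
  define \<Theta> where "\<Theta> t = (1 / \<delta>) * (\<Phi> (t + \<delta>/2) - \<Phi> (t + -\<delta>/2))" for t
  have mean: "\<exists>\<xi>. t - \<delta>/2 < \<xi> \<and> \<xi> < t + \<delta>/2 \<and> \<Theta> t = \<theta> \<xi>" for t
  proof -
    obtain z where "t - \<delta>/2 < z" "z < t + \<delta>/2" "\<Phi> (t + \<delta>/2) - \<Phi> (t - \<delta>/2) = (t + \<delta>/2 - (t - \<delta>/2)) * \<theta> z"
      using MVT2[of "t - \<delta>/2" "t + \<delta>/2" \<Phi> \<theta>] \<Phi> Suc.prems by auto
    then show ?thesis using Suc.prems by (intro exI[of _ z]) (auto simp: \<Theta>_def)
  qed
  let ?A = "max A (\<bar>1 / \<delta>\<bar> * (A + A))"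
  have "smooth_bd1 k ?A (\<lambda>t. (1 / \<delta>) * (\<theta> (t + \<delta>/2) - \<theta> (t + -\<delta>/2)))"
    by (rule smooth_bd1_mono[OF smooth_bd1_combine[OF \<theta>(1) \<theta>(1)]]) auto
  moreover have "\<forall>t. (\<Theta> has_real_derivative (1 / \<delta>) * (\<theta> (t + \<delta>/2) - \<theta> (t + -\<delta>/2))) (at t)"
    unfolding \<Theta>_def using \<Phi>
    by (intro allI DERIV_cmult DERIV_diff) (simp_all only: DERIV_shift[symmetric])
  moreover have "\<forall>t. \<bar>\<Theta> t\<bar> \<le> ?A"
    using mean smooth_bd1_bound[OF \<theta>(1)] by (metis max.coboundedI1)
  ultimately have "smooth_bd1 (Suc k) ?A \<Theta>" 
    unfolding smooth_bd1.simps
    by (intro conjI exI[of _ "\<lambda>t. (1 / \<delta>) * (\<theta> (t + \<delta>/2) - \<theta> (t + -\<delta>/2))"])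
  moreover have "\<Theta> t = 0" if "t \<le> -\<delta>" for t
    using mean[of t] \<theta>(2) that by force
  moreover have "\<Theta> t = 1" if "t \<ge> \<delta>" for t
    using mean[of t] \<theta>(3) that by force
  ultimately show ?case by blast
qed

lemma sum_telescope_int:
  fixes g :: "int \<Rightarrow> real"
  shows "(\<Sum>k\<in>{a..<a + int N}. g k - g (k + 1)) = g a - g (a + int N)"
proof (induction N)
  case (Suc N)
  have "{a..<a + int (Suc N)} = insert (a + int N) {a..<a + int N}" by auto
  with Suc show ?case by (simp add: add_ac)
qed simp

text \<open>A bump of radius \<open>\<rho>\<close> whose translates by \<open>2\<int>\<close> add up to \<open>1\<close>.  The sum is stated for every finite set of
indices that catches all nonzero terms.\<close>

definition partition_profile :: "nat \<Rightarrow> real \<Rightarrow> real \<Rightarrow> (real \<Rightarrow> real) \<Rightarrow> bool" where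
  "partition_profile k \<rho> A \<eta> \<longleftrightarrow> smooth_bd1 k A \<eta> \<and> (\<forall>t. \<eta> t \<noteq> 0 \<longrightarrow> \<bar>t\<bar> \<le> \<rho>) \<and>
     (\<forall>t S. finite S \<longrightarrow> (\<forall>l. \<bar>t - 2 * of_int l\<bar> \<le> \<rho> \<longrightarrow> l \<in> S) \<longrightarrow> (\<Sum>l\<in>S. \<eta> (t - 2 * of_int l)) = 1)"

text \<open>The difference \<open>\<theta> (t + 1) - \<theta> (t - 1)\<close> of two translates of a step of width \<open>\<rho> - 1\<close> has support in
\<open>[- \<rho>, \<rho>]\<close>, and its translates by \<open>2\<int>\<close> telescope.\<close>

lemma partition_profile_exists:
  assumes "1 < \<rho>" "\<rho> \<le> 2"
  shows "\<exists>A \<eta>. partition_profile k \<rho> A \<eta>"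
proof -
  obtain \<theta> A where \<theta>: "smooth_bd1 k A \<theta>" "\<And>t. t \<le> -(\<rho> - 1) \<Longrightarrow> \<theta> t = 0" "\<And>t. t \<ge> \<rho> - 1 \<Longrightarrow> \<theta> t = 1"
    using smooth_step_exists[of "\<rho> - 1" k] assms by auto
  define \<eta> where "\<eta> t = 1 * (\<theta> (t + 1) - \<theta> (t + -1))" for t
  have "smooth_bd1 k (\<bar>1\<bar> * (A + A)) \<eta>"
    unfolding \<eta>_def by (rule smooth_bd1_combine) (rule \<theta>)+
  moreover have supp: "\<bar>t\<bar> \<le> \<rho>" if "\<eta> t \<noteq> 0" for t
  proof (rule ccontr)
    assume "\<not> \<bar>t\<bar> \<le> \<rho>"
    then consider "t < -\<rho>" | "t > \<rho>" by linarith
    then have "\<eta> t = 0" using \<theta>(2)[of "t+1"] \<theta>(2)[of "t-1"] \<theta>(3)[of "t+1"] \<theta>(3)[of "t-1"]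
      by cases (auto simp: \<eta>_def)
    with that show False by simp
  qed
  moreover have "(\<Sum>l\<in>S. \<eta> (t - 2 * of_int l)) = 1"
    if S: "finite S" "\<And>l. \<bar>t - 2 * of_int l\<bar> \<le> \<rho> \<Longrightarrow> l \<in> S" for t S
  proof -
    obtain L where L: "\<And>l. l \<in> S \<Longrightarrow> \<bar>l\<bar> \<le> L"
      using finite_imageI[OF S(1), of abs] by (meson Max_ge imageI)
    define M where "M = nat (max L (\<lceil>\<bar>t\<bar>\<rceil> + 2))"
    \<comment> \<open>The interval of summation is so long that \<open>\<theta>\<close> is \<open>1\<close> at its left end and \<open>0\<close> at its right end.\<close>
    have M: "int M \<ge> L" "real M \<ge> \<bar>t\<bar> + 2" by (auto simp: M_def le_max_iff_disj) linarith+
    let ?g = "\<lambda>l::int. \<theta> (t - 2 * of_int l + 1)"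
    have "(\<Sum>l\<in>S. \<eta> (t - 2 * of_int l)) = (\<Sum>l\<in>{-int M..<-int M + int (2*M+1)}. \<eta> (t - 2 * of_int l))"
    proof (rule sum.mono_neutral_left)
      show "S \<subseteq> {-int M..<-int M + int (2*M+1)}"
        using L M(1) by (fastforce simp: abs_le_iff)
      show "\<forall>i\<in>{-int M..<-int M + int (2*M+1)} - S. \<eta> (t - 2 * of_int i) = 0"
        using supp S(2) by blast
    qed auto
    also have "\<dots> = (\<Sum>l\<in>{-int M..<-int M + int (2*M+1)}. ?g l - ?g (l + 1))"
      by (intro sum.cong) (auto simp: \<eta>_def algebra_simps)
    also have "\<dots> = ?g (-int M) - ?g (-int M + int (2*M+1))"
      by (rule sum_telescope_int)
    also have "\<dots> = 1"
      using \<theta>(2)[of "t - 2 * of_int (-int M + int (2*M+1)) + 1"] \<theta>(3)[of "t - 2 * of_int (-int M)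
        + 1"] M(2) assms
      by (auto simp: abs_le_iff)
    finally show ?thesis .
  qed
  ultimately show ?thesis unfolding partition_profile_def by blast
qed

lemma smooth_bd_coordinate:
  fixes i :: "'n::finite"
  assumes "0 \<le> c"
  shows "smooth_bd1 k A \<theta> \<Longrightarrow> smooth_bd k c A (\<lambda>x::real^'n. complex_of_real (\<theta> (c * x $ i - b)))"
proof (induction k arbitrary: \<theta>)
  case 0
  then have "continuous_on UNIV (\<lambda>x::real^'n. \<theta> (c * x $ i - b))"
    by (auto intro!: continuous_on_compose2[of UNIV \<theta> UNIV "\<lambda>x::real^'n. c * x $ i - b"] continuous_intros)
  with 0 show ?case by (auto intro!: continuous_intros)
next
  case (Suc k)
  then obtain \<theta>' where \<theta>': "\<And>t. (\<theta> has_real_derivative \<theta>' t) (at t)" "smooth_bd1 k A \<theta>'" by auto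
  have D: "((\<lambda>x::real^'n. complex_of_real (\<theta> (c * x $ i - b))) has_derivative
          (\<lambda>h. of_real (\<theta>' (c * x $ i - b) * (c * h $ i)))) (at x)" for x
  proof -
    have "((\<lambda>x::real^'n. c * x $ i - b) has_derivative (\<lambda>h. c * h $ i)) (at x)"
      by (auto intro!: derivative_eq_intros bounded_linear_imp_has_derivative bounded_linear_vec_nth)
    then have "((\<lambda>x::real^'n. \<theta> (c * x $ i - b)) has_derivative (\<lambda>h. \<theta>' (c * x $ i - b) * (c * h $ i))) (at x)"
      using \<theta>'(1) unfolding has_field_derivative_def by (rule has_derivative_compose)
    then show ?thesis by (rule has_derivative_of_real)
  qed
  have A0: "0 \<le> A" using smooth_bd1_bound[OF Suc.prems, of 0] by simp
  have "smooth_bd k c (A * c) (partial_deriv l (\<lambda>x::real^'n. complex_of_real (\<theta> (c * x $ i - b))))" for l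
  proof (cases "l = i")
    case True
    have "smooth_bd k c (norm (complex_of_real c) * A) (\<lambda>x::real^'n. complex_of_real c * complex_of_real
      (\<theta>' (c * x $ i - b)))"
      by (intro smooth_bd_cmult Suc.IH \<theta>')
    then show ?thesis using assms True
      by (rule_tac smooth_bd_cong[of _ _ _ "\<lambda>x::real^'n. complex_of_real c * complex_of_real (\<theta>' (c
        * x $ i - b))"])
         (auto simp: partial_derivI[OF D] axis_def mult_ac)
  next
    case False
    have "smooth_bd k c (A * c) (\<lambda>x::real^'n. 0)"
      using A0 assms by (intro smooth_bd_const) auto
    then show ?thesis
      by (rule smooth_bd_cong) (use False in \<open>auto simp: partial_derivI[OF D] axis_def\<close>)
  qed
  moreover have "(\<lambda>x::real^'n. complex_of_real (\<theta> (c * x $ i - b))) differentiable_on UNIV"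
    using D by (auto simp: differentiable_on_def differentiable_def)
  ultimately show ?case using Suc.prems by auto
qed

section \<open>Dyadic cubes and locally finite sums\<close>

definition node :: "nat \<Rightarrow> int^'n \<Rightarrow> real^'n" where
  "node j m = (\<chi> i. of_int (m $ i) / 2 ^ j)"

definition near :: "real \<Rightarrow> nat \<Rightarrow> real^'n \<Rightarrow> (int^'n) set" where
  "near E k z = {m. z \<in> dcube E k m}"

lemma dcube_iff: "x \<in> dcube d j m \<longleftrightarrow> (\<forall>i. \<bar>x $ i - node j m $ i\<bar> \<le> d / 2 ^ j)"
  by (simp add: dcube_def node_def)

lemma dcube_mono: "d \<le> d' \<Longrightarrow> dcube d j m \<subseteq> dcube d' j m"
proof
  fix x assume "d \<le> d'" "x \<in> dcube d j m"
  moreover have "d / 2 ^ j \<le> d' / 2 ^ j" using \<open>d \<le> d'\<close> by (simp add: divide_right_mono)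
  ultimately show "x \<in> dcube d' j m" unfolding dcube_iff by (meson order_trans)
qed

lemma dcube_eq_cbox:
  "dcube d j m = cbox (\<chi> i. node j m $ i - d / 2 ^ j) (\<chi> i. node j m $ i + d / 2 ^ j)"
  by (auto simp: dcube_iff mem_box_cart abs_le_iff algebra_simps)

lemma closed_dcube: "closed (dcube d j m)"
  by (simp add: dcube_eq_cbox closed_cbox)

lemma emeasure_dcube:
  fixes m :: "int^'n"
  assumes "0 \<le> d"
  shows "emeasure lebesgue (dcube d j m) = ennreal ((2 * d / 2 ^ j) ^ CARD('n))"
proof -
  have "emeasure lebesgue (dcube d j m) = emeasure lborel (dcube d j m)"
    by (simp add: dcube_eq_cbox)
  also have "\<dots> = ennreal (measure lborel (dcube d j m))"
    using emeasure_eq_ennreal_measure[of lborel "dcube d j m"] emeasure_bounded_finite[of "dcube d j m"]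
    by (simp add: dcube_eq_cbox less_top)
  also have "measure lborel (dcube d j m) = (2 * d / 2 ^ j) ^ CARD('n)"
  proof -
    have "node j m \<in> dcube d j m" using assms by (simp add: dcube_iff)
    then have "dcube d j m \<noteq> {}" by blast
    then show ?thesis
      unfolding dcube_eq_cbox by (subst content_cbox_cart) auto
  qed
  finally show ?thesis .
qed

lemma in_near_shift:
  assumes "x \<in> dcube D k m" "\<And>i. \<bar>x $ i - z $ i\<bar> \<le> R / 2 ^ k"
  shows "m \<in> near (D + R) k z"
proof -
  have "\<bar>z $ i - node k m $ i\<bar> \<le> D / 2 ^ k + R / 2 ^ k" for i
    using assms(1)[unfolded dcube_iff, rule_format, of i] assms(2)[of i] by linarith
  then show ?thesis by (simp add: near_def dcube_iff add_divide_distrib)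
qed

lemma vec_set_eq_image: "{l::'a^'n. \<forall>i. l $ i \<in> B i} = vec_lambda ` PiE UNIV B"
proof (intro set_eqI iffI)
  fix l :: "'a^'n" assume "l \<in> {l. \<forall>i. l $ i \<in> B i}"
  then show "l \<in> vec_lambda ` PiE UNIV B"
    by (intro image_eqI[of _ _ "vec_nth l"]) auto
qed auto

lemma inj_vec_lambda: "inj_on vec_lambda S"
  by (metis inj_onI vec_lambda_inject UNIV_I)

lemma card_vec_set:
  fixes B :: "'n::finite \<Rightarrow> 'a set"
  assumes "\<And>i. finite (B i)"
  shows "finite {l::'a^'n. \<forall>i. l $ i \<in> B i}" "card {l::'a^'n. \<forall>i. l $ i \<in> B i} = (\<Prod>i\<in>UNIV. card (B i))"
  using assms by (auto simp: vec_set_eq_image card_image inj_vec_lambda card_PiE intro!: finite_PiE)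

lemma card_int_interval_le:
  fixes y R :: real
  assumes "0 \<le> R"
  shows "finite {k::int. \<bar>y - of_int k\<bar> \<le> R}" "real (card {k::int. \<bar>y - of_int k\<bar> \<le> R}) \<le> 2 * R + 1"
proof -
  have eq: "{k::int. \<bar>y - of_int k\<bar> \<le> R} = {\<lceil>y - R\<rceil>..\<lfloor>y + R\<rfloor>}"
    by (auto simp: abs_le_iff ceiling_le_iff le_floor_iff)
  show "finite {k::int. \<bar>y - of_int k\<bar> \<le> R}" by (simp add: eq)
  have "of_int (\<lfloor>y + R\<rfloor> + 1 - \<lceil>y - R\<rceil>) \<le> 2 * R + 1"
    using of_int_floor_le[of "y + R"] le_of_int_ceiling[of "y - R"] by (simp, linarith)
  then show "real (card {k::int. \<bar>y - of_int k\<bar> \<le> R}) \<le> 2 * R + 1"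
    using assms by (auto simp: eq)
qed

lemma card_lattice_box_le:
  fixes y :: "real^'n"
  assumes "0 \<le> R"
  shows "finite {m::int^'n. \<forall>i. \<bar>y $ i - of_int (m $ i)\<bar> \<le> R}"
    and "real (card {m::int^'n. \<forall>i. \<bar>y $ i - of_int (m $ i)\<bar> \<le> R}) \<le> (2 * R + 1) ^ CARD('n)"
proof -
  have eq: "{m::int^'n. \<forall>i. \<bar>y $ i - of_int (m $ i)\<bar> \<le> R} = {m. \<forall>i. m $ i \<in> {k. \<bar>y $ i - of_int k\<bar> \<le> R}}"
    by simp
  show "finite {m::int^'n. \<forall>i. \<bar>y $ i - of_int (m $ i)\<bar> \<le> R}"
    unfolding eq by (intro card_vec_set card_int_interval_le assms)
  have "real (card {m::int^'n. \<forall>i. \<bar>y $ i - of_int (m $ i)\<bar> \<le> R})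
    = (\<Prod>i\<in>(UNIV::'n set). real (card {k::int. \<bar>y $ i - of_int k\<bar> \<le> R}))"
    unfolding eq by (subst card_vec_set(2)) (auto intro: card_int_interval_le assms)
  also have "\<dots> \<le> (\<Prod>i\<in>(UNIV::'n set). 2 * R + 1)"
    by (intro prod_mono) (auto intro: card_int_interval_le(2) assms)
  finally show "real (card {m::int^'n. \<forall>i. \<bar>y $ i - of_int (m $ i)\<bar> \<le> R}) \<le> (2 * R + 1) ^ CARD('n)"
    by simp
qed

lemma scaled_abs_le_iff: "\<bar>a - b / 2 ^ k\<bar> \<le> E / 2 ^ k \<longleftrightarrow> \<bar>2 ^ k * a - b\<bar> \<le> (E::real)"
proof -
  have "2 ^ k * a - b = 2 ^ k * (a - b / 2 ^ k)" by (simp add: algebra_simps)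
  then have "\<bar>2 ^ k * a - b\<bar> = 2 ^ k * \<bar>a - b / 2 ^ k\<bar>" by (simp only: abs_mult) simp
  then show ?thesis by (simp add: pos_le_divide_eq mult.commute)
qed

lemma card_near_le:
  fixes z :: "real^'n"
  assumes "0 \<le> E"
  shows "finite (near E k z)" "real (card (near E k z)) \<le> (2 * E + 1) ^ CARD('n)"
proof -
  have eq: "near E k z = {m. \<forall>i. \<bar>(\<chi> i. 2 ^ k * z $ i) $ i - of_int (m $ i)\<bar> \<le> E}"
    by (simp add: near_def dcube_def scaled_abs_le_iff)
  show "finite (near E k z)" "real (card (near E k z)) \<le> (2 * E + 1) ^ CARD('n)"
    unfolding eq by (rule card_lattice_box_le[OF assms])+
qed

text \<open>A cube of level \<open>k\<close> contains about \<open>2\<^sup>(\<^sup>j\<^sup>-\<^sup>k\<^sup>)\<^sup>n\<close> nodes of the finer level \<open>j\<close>; this is the source of the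
shift \<open>n / p\<close> in the smoothness index.\<close>

lemma card_nodes_in_dcube_le:
  fixes l :: "int^'n"
  assumes "0 \<le> E" "k \<le> j"
  shows "finite {m. node j m \<in> dcube E k l}"
    and "real (card {m. node j m \<in> dcube E k l}) \<le> ((2 * E + 1) * 2 ^ (j - k)) ^ CARD('n)"
proof -
  have pow: "(2::real) ^ j = 2 ^ (j - k) * 2 ^ k"
    using assms(2) by (simp flip: power_add)
  have "\<bar>a / 2 ^ j - b / 2 ^ k\<bar> \<le> E / 2 ^ k \<longleftrightarrow> \<bar>2 ^ (j - k) * b - a\<bar> \<le> E * 2 ^ (j - k)" for a b :: real
  proof -
    have "2 ^ (j - k) * b - a = - (2 ^ j * (a / 2 ^ j - b / 2 ^ k))"
      by (simp add: algebra_simps pow)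
    then have "\<bar>2 ^ (j - k) * b - a\<bar> = 2 ^ j * \<bar>a / 2 ^ j - b / 2 ^ k\<bar>"
      by (simp only: abs_minus abs_mult) simp
    also have "\<dots> \<le> E * 2 ^ (j - k) \<longleftrightarrow> \<bar>a / 2 ^ j - b / 2 ^ k\<bar> \<le> E * 2 ^ (j - k) / 2 ^ j"
      by (simp add: pos_le_divide_eq mult.commute)
    also have "E * 2 ^ (j - k) / 2 ^ j = E / 2 ^ k"
      by (simp add: pow)
    finally show ?thesis by simp
  qed
  then have eq: "{m. node j m \<in> dcube E k l}
    = {m. \<forall>i. \<bar>(\<chi> i. 2 ^ (j - k) * of_int (l $ i)) $ i - of_int (m $ i)\<bar> \<le> E * 2 ^ (j - k)}"
    by (simp add: dcube_def node_def)
  have E: "0 \<le> E * 2 ^ (j - k)" using assms by simp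
  show "finite {m. node j m \<in> dcube E k l}"
    unfolding eq by (rule card_lattice_box_le[OF E])
  have "real (card {m. node j m \<in> dcube E k l}) \<le> (2 * (E * 2 ^ (j - k)) + 1) ^ CARD('n)"
    unfolding eq by (rule card_lattice_box_le[OF E])
  also have "\<dots> \<le> ((2 * E + 1) * 2 ^ (j - k)) ^ CARD('n)"
    using assms by (intro power_mono) (auto simp: algebra_simps)
  finally show "real (card {m. node j m \<in> dcube E k l}) \<le> ((2 * E + 1) * 2 ^ (j - k)) ^ CARD('n)" .
qed

lemma infsum_eq_sum:
  fixes F :: "'i \<Rightarrow> complex"
  assumes "finite S" "\<And>m. F m \<noteq> 0 \<Longrightarrow> m \<in> S"
  shows "(\<Sum>\<^sub>\<infinity>m. F m) = (\<Sum>m\<in>S. F m)"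
proof -
  have "infsum F UNIV = infsum F S"
    by (rule infsum_cong_neutral) (use assms in auto)
  then show ?thesis using assms(1) by simp
qed

text \<open>In the neighbourhood of \<open>z\<close> of size \<open>R 2\<^sup>-\<^sup>k\<close> the sum runs over one fixed finite set of indices.\<close>

lemma infsum_localized:
  fixes F :: "int^'n \<Rightarrow> complex"
  assumes "\<And>m. F m \<noteq> 0 \<Longrightarrow> x \<in> dcube D k m" "\<And>i. \<bar>x $ i - z $ i\<bar> \<le> R / 2 ^ k" "0 \<le> D" "0 \<le> R"
  shows "(\<Sum>\<^sub>\<infinity>m. F m) = (\<Sum>m\<in>near (D + R) k z. F m)"
  by (rule infsum_eq_sum[OF card_near_le(1)]) (use assms(3,4) in_near_shift[OF assms(1) assms(2)] in auto)

lemma infsum_near: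
  fixes F :: "int^'n \<Rightarrow> complex"
  assumes "\<And>m. F m \<noteq> 0 \<Longrightarrow> x \<in> dcube D k m" "0 \<le> D"
  shows "(\<Sum>\<^sub>\<infinity>m. F m) = (\<Sum>m\<in>near D k x. F m)"
  using infsum_localized[of F x D k x 0] assms by simp

lemma continuous_on_locally_finite_sum:
  fixes F :: "int^'n \<Rightarrow> real^'n \<Rightarrow> complex"
  assumes "\<And>m x. F m x \<noteq> 0 \<Longrightarrow> x \<in> dcube D k m" "0 \<le> D" "\<And>m. continuous_on UNIV (F m)"
  shows "continuous_on UNIV (\<lambda>x. \<Sum>\<^sub>\<infinity>m. F m x)"
proof -
  have "isCont (\<lambda>x. \<Sum>\<^sub>\<infinity>m. F m x) z" for z
  proof -
    have "\<forall>\<^sub>F x in nhds z. (\<Sum>\<^sub>\<infinity>m. F m x) = (\<Sum>m\<in>near (D + 1) k z. F m x)"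
      unfolding eventually_nhds_metric
    proof (intro exI[of _ "1 / 2 ^ k"] conjI allI impI)
      fix x assume "dist x z < 1 / 2 ^ k"
      then have "\<bar>x $ i - z $ i\<bar> \<le> 1 / 2 ^ k" for i
        using component_le_norm_cart[of "x - z" i] by (simp add: dist_norm)
      then show "(\<Sum>\<^sub>\<infinity>m. F m x) = (\<Sum>m\<in>near (D + 1) k z. F m x)"
        using assms by (intro infsum_localized) auto
    qed auto
    moreover have "isCont (\<lambda>x. \<Sum>m\<in>near (D + 1) k z. F m x) z"
      using assms(3) by (intro continuous_intros) (auto simp: continuous_on_eq_continuous_at)
    ultimately show ?thesis by (subst isCont_cong)
  qed
  then show ?thesis by (simp add: continuous_on_eq_continuous_at)
qed

lemma norm_le_coordinates:
  fixes v :: "real^'n"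
  assumes "\<And>i. \<bar>v $ i\<bar> \<le> t"
  shows "norm v \<le> real CARD('n) * t"
proof -
  have "norm v \<le> (\<Sum>i\<in>UNIV. \<bar>v $ i\<bar>)" by (rule norm_le_l1_cart)
  also have "\<dots> \<le> (\<Sum>i\<in>(UNIV::'n set). t)" by (intro sum_mono assms)
  finally show ?thesis by simp
qed

definition bump :: "(real \<Rightarrow> real) \<Rightarrow> nat \<Rightarrow> int^'n \<Rightarrow> real^'n \<Rightarrow> complex" where
  "bump \<eta> j m x = (\<Prod>i\<in>UNIV. complex_of_real (\<eta> (2 ^ j * x $ i - of_int (m $ i))))"

definition coset :: "int \<Rightarrow> int^'n \<Rightarrow> int^'n" where
  "coset e l = (\<chi> i. 2 * l $ i + e)"

lemma inj_coset: "inj (coset e)"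
  by (rule injI) (simp add: coset_def vec_eq_iff)

lemma bump_support:
  assumes "partition_profile k \<rho> A \<eta>" "bump \<eta> j m x \<noteq> 0"
  shows "x \<in> dcube \<rho> j m"
  using assms by (auto simp: bump_def partition_profile_def dcube_def scaled_abs_le_iff)

lemma bump_smooth:
  fixes m :: "int^'n"
  assumes "partition_profile k \<rho> A \<eta>"
  shows "smooth_bd k (2 ^ j) ((2 ^ k * A) ^ CARD('n)) (bump \<eta> j m)"
  unfolding bump_def[abs_def]
  using assms by (intro smooth_bd_prod smooth_bd_coordinate) (auto simp: partition_profile_def)

text \<open>Expanding the product over the coordinates of the one-dimensional sums.\<close>

lemma bump_partition:
  fixes x :: "real^'n"
  assumes \<eta>: "partition_profile k \<rho> A \<eta>" and \<rho>: "0 \<le> \<rho>"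
    and S: "finite S" "\<And>l. x \<in> dcube \<rho> j (coset e l) \<Longrightarrow> l \<in> S"
  shows "(\<Sum>l\<in>S. bump \<eta> j (coset e l) x) = 1"
proof -
  define t where "t i = 2 ^ j * x $ i - of_int e" for i
  define B where "B i = {l::int. \<bar>t i - 2 * of_int l\<bar> \<le> \<rho>}" for i
  have fin: "finite (B i)" for i
  proof (rule finite_subset)
    show "B i \<subseteq> {l::int. \<bar>t i / 2 - of_int l\<bar> \<le> \<rho>}"
      using \<rho> unfolding B_def by (auto simp: abs_le_iff)
  qed (rule card_int_interval_le[OF \<rho>])
  have term_eq: "2 ^ j * x $ i - of_int (coset e l $ i) = t i - 2 * of_int (l $ i)" for l :: "int^'n" and i
    by (simp add: t_def coset_def)
  have "(\<Sum>l\<in>B i. \<eta> (t i - 2 * of_int l)) = 1" for i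
    using \<eta> fin[of i] unfolding partition_profile_def by (auto simp: B_def)
  then have "1 = (\<Prod>i\<in>UNIV. \<Sum>l\<in>B i. complex_of_real (\<eta> (t i - 2 * of_int l)))"
    by (simp flip: of_real_sum)
  also have "\<dots> = (\<Sum>g\<in>PiE UNIV B. \<Prod>i\<in>UNIV. complex_of_real (\<eta> (t i - 2 * of_int (g i))))"
    by (rule prod_sum_PiE) (auto simp: fin)
  also have "\<dots> = (\<Sum>l\<in>vec_lambda ` PiE UNIV B. bump \<eta> j (coset e l) x)"
    by (subst sum.reindex) (auto simp: inj_vec_lambda bump_def term_eq)
  also have "\<dots> = (\<Sum>l\<in>{l. \<forall>i. l $ i \<in> B i}. bump \<eta> j (coset e l) x)"
    by (simp add: vec_set_eq_image)
  also have "\<dots> = (\<Sum>l\<in>S. bump \<eta> j (coset e l) x)"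
  proof (rule sum.mono_neutral_left[OF S(1)])
    have *: "x \<in> dcube \<rho> j (coset e l) \<longleftrightarrow> (\<forall>i. l $ i \<in> B i)" for l
      unfolding dcube_def scaled_abs_le_iff term_eq[of _ l] mem_Collect_eq B_def ..
    show "{l. \<forall>i. l $ i \<in> B i} \<subseteq> S" using S(2) * by blast
    show "\<forall>l\<in>S - {l. \<forall>i. l $ i \<in> B i}. bump \<eta> j (coset e l) x = 0"
      using bump_support[OF \<eta>] * by blast
  qed
  finally show ?thesis by simp
qed

text \<open>Summation over all of \<open>\<int>\<^sup>n\<close>, with zeros off the coset, keeps the indices of the partition of unity in line
with those of the cubes.\<close>

definition unity_part :: "(real \<Rightarrow> real) \<Rightarrow> int \<Rightarrow> nat \<Rightarrow> int^'n \<Rightarrow> real^'n \<Rightarrow> complex" where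
  "unity_part \<eta> e j m x = (if m \<in> range (coset e) then bump \<eta> j m x else 0)"

lemma unity_part_support: "partition_profile k \<rho> A \<eta> \<Longrightarrow> unity_part \<eta> e j m x \<noteq> 0 \<Longrightarrow> x \<in> dcube \<rho> j m"
  using bump_support by (auto simp: unity_part_def split: if_splits)

lemma unity_part_smooth:
  fixes m :: "int^'n"
  assumes "partition_profile k \<rho> A \<eta>"
  shows "smooth_bd k (2 ^ j) ((2 ^ k * A) ^ CARD('n)) (unity_part \<eta> e j m)"
proof (cases "m \<in> range (coset e)")
  case True
  then have "unity_part \<eta> e j m = bump \<eta> j m" by (simp add: unity_part_def fun_eq_iff)
  then show ?thesis using bump_smooth[OF assms] by simp
next
  case False
  then have "unity_part \<eta> e j m = (\<lambda>x. 0)" by (simp add: unity_part_def fun_eq_iff)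
  then show ?thesis using smooth_bd_nonneg[OF bump_smooth[OF assms, of j m]] by (simp add: smooth_bd_const)
qed

lemma sum_pu_eq_1:
  fixes x :: "real^'n"
  assumes \<eta>: "partition_profile k \<rho> A \<eta>" and \<rho>: "0 \<le> \<rho>"
    and S: "finite S" "\<And>m. x \<in> dcube \<rho> j m \<Longrightarrow> m \<in> S"
  shows "(\<Sum>m\<in>S. unity_part \<eta> e j m x) = 1"
proof -
  have "(\<Sum>m\<in>S. unity_part \<eta> e j m x) = (\<Sum>m\<in>S \<inter> range (coset e). unity_part \<eta> e j m x)"
    using S(1) by (intro sum.mono_neutral_right) (auto simp: unity_part_def)
  also have "S \<inter> range (coset e) = coset e ` (coset e -` S)" by auto
  also have "(\<Sum>m\<in>\<dots>. unity_part \<eta> e j m x) = (\<Sum>l\<in>coset e -` S. bump \<eta> j (coset e l) x)"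
    by (subst sum.reindex) (auto simp: unity_part_def intro: inj_on_subset[OF inj_coset])
  also have "\<dots> = 1"
    using S by (intro bump_partition[OF \<eta> \<rho>] finite_vimageI inj_coset) auto
  finally show ?thesis .
qed

text \<open>The two cosets are told apart by the parity of any coordinate.\<close>

lemma coset_disjoint: "m \<in> range (coset 0) \<Longrightarrow> m \<notin> range (coset 1)"
proof
  assume "m \<in> range (coset 0)" "m \<in> range (coset 1)"
  then obtain l l' where "coset 0 l = m" "coset 1 l' = m" by auto
  then have "coset 0 l $ undefined = coset 1 l' $ undefined" by simp
  then have "2 * l $ undefined = 2 * l' $ undefined + 1" by (simp add: coset_def)
  then show False by presburger
qed

lemma dcube_cover: "\<exists>m. x \<in> dcube 1 j m"
proof
  have "\<bar>t - of_int \<lfloor>t\<rfloor>\<bar> \<le> 1" for t :: real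
    using of_int_floor_le[of t] real_of_int_floor_add_one_ge[of t] by linarith
  then show "x \<in> dcube 1 j (\<chi> i. \<lfloor>2 ^ j * x $ i\<rfloor>)"
    unfolding dcube_def scaled_abs_le_iff by simp
qed

section \<open>The Hardy inequality for \<open>b_norm\<close>\<close>

lemma lq_norm_zero [simp]: "0 < p \<Longrightarrow> lq_norm p (\<lambda>i. 0) = 0"
  using lq_norm_cmult[of p 0 "\<lambda>_. 0"] by simp

lemma lq_norm_pairs:
  fixes G :: "'k \<Rightarrow> 'l \<Rightarrow> ennreal"
  assumes "0 < p"
  shows "lq_norm p (\<lambda>(k, l). G k l) = lq_norm p (\<lambda>k. lq_norm p (G k))"
  using assms
proof (cases rule: exponent_cases)
  case 1
  have "(SUP kl. G (fst kl) (snd kl)) = (SUP k. SUP l. G k l)"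
    by (intro antisym SUP_least) (auto intro: SUP_upper2 SUP_upper SUP_upper2[of "(_, _)"])
  then show ?thesis using 1 by (simp add: lq_norm_def case_prod_beta)
next
  case 2
  have "(\<integral>\<^sup>+kl. epowr (case kl of (k, l) \<Rightarrow> G k l) (enn2real p) \<partial>count_space UNIV)
      = (\<integral>\<^sup>+k. \<integral>\<^sup>+l. epowr (G k l) (enn2real p) \<partial>count_space UNIV \<partial>count_space UNIV)"
    by (subst nn_integral_fst_count_space[symmetric]) simp
  with 2 show ?thesis by (simp add: lq_norm_def)
qed

text \<open>The kernel of a partial injection has at most one entry \<open>1\<close> for each \<open>i\<close>.\<close>

lemma lq_norm_reindex_le:
  fixes F :: "'i::countable \<Rightarrow> ennreal"
  assumes p: "0 < p" and inj: "\<And>j j'. P j \<Longrightarrow> P j' \<Longrightarrow> h j = h j' \<Longrightarrow> j = j'"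
  shows "lq_norm p (\<lambda>j. if P j then F (h j) else 0) \<le> lq_norm p F"
proof -
  let ?\<kappa> = "\<lambda>i j. if P j \<and> h j = i then 1 else 0 :: ennreal"
  have "lq_norm p (?\<kappa> i) \<le> 1" for i
    using p
  proof (cases rule: exponent_cases)
    case 1
    have "(SUP j. ?\<kappa> i j) \<le> 1" by (rule SUP_least) auto
    then show ?thesis unfolding lq_norm_def using 1 by simp
  next
    case 2
    have "\<exists>a. {j. P j \<and> h j = i} \<subseteq> {a}" using inj by blast
    then obtain a where a: "{j. P j \<and> h j = i} \<subseteq> {a}" ..
    have "epowr 1 (enn2real p) = 1" using epowr_ennreal[of 1] by simp
    then have "(\<integral>\<^sup>+j. epowr (?\<kappa> i j) (enn2real p) \<partial>count_space UNIV)
      \<le> (\<integral>\<^sup>+j. indicator {a} j \<partial>count_space UNIV)"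
      using a by (intro nn_integral_mono) auto
    also have "\<dots> = 1" by simp
    finally have "lq_norm p (?\<kappa> i) \<le> epowr 1 (1 / enn2real p)"
      using 2 unfolding lq_norm_def by (simp add: epowr_mono)
    also have "\<dots> = 1" using epowr_ennreal[of 1] by simp
    finally show ?thesis .
  qed
  moreover have "(if P j then F (h j) else 0) \<le> (SUP i. ?\<kappa> i j * F i)" for j
    by (auto intro!: SUP_upper2[of "h j"])
  ultimately have "lq_norm p (\<lambda>j. if P j then F (h j) else 0) \<le> 1 * lq_norm p F"
    by (intro lq_norm_sup_kernel[OF p])
  then show ?thesis by simp
qed

lemma lq_norm_single:
  assumes "0 < p"
  shows "lq_norm p (\<lambda>k. if k = N then a else 0) = a"
  using assms
proof (cases rule: exponent_cases)
  case 1
  then show ?thesis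
    by (auto simp: lq_norm_def intro!: antisym SUP_least SUP_upper2[of N])
next
  case 2
  have "(\<integral>\<^sup>+k. epowr (if k = N then a else 0) (enn2real p) \<partial>count_space UNIV) = (\<Sum>k\<in>{N}. epowr (if k
    = N then a else 0) (enn2real p))"
    by (rule nn_integral_count_space') auto
  with 2 show ?thesis by (simp add: lq_norm_def)
qed

lemma suminf_ennreal_geometric:
  assumes "0 \<le> t" "t < 1"
  shows "(\<Sum>k. ennreal (t ^ k)) = ennreal (1 / (1 - t))"
  using assms geometric_sums[of t] by (intro suminf_ennreal_eq) auto

lemma power_powr_swap: "0 < x \<Longrightarrow> (x ^ k) powr r = ((x::real) powr r) ^ k"
  by (simp add: powr_powr mult.commute flip: powr_realpow)

lemma lq_norm_geometric:
  assumes "0 < p" "0 < t" "t < 1"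
  shows "\<exists>c::real. 0 < c \<and> lq_norm p (\<lambda>k::nat. ennreal (t ^ k)) \<le> ennreal c"
  using assms(1)
proof (cases rule: exponent_cases)
  case 1
  then show ?thesis using assms
    by (intro exI[of _ 1]) (auto simp: lq_norm_def power_le_one intro!: SUP_least)
next
  case 2
  let ?r = "enn2real p" and ?t = "t powr enn2real p"
  have t: "0 < ?t" "?t < 1" using assms 2 powr_less_mono2[of ?r t 1] by auto
  have "epowr (ennreal (t ^ k)) ?r = ennreal (?t ^ k)" for k
    using assms by (simp add: epowr_ennreal power_powr_swap)
  then have "(\<integral>\<^sup>+k. epowr (ennreal (t ^ k)) ?r \<partial>count_space UNIV) = ennreal (1 / (1 - ?t))"
    unfolding nn_integral_count_space_nat using t by (simp only: suminf_ennreal_geometric less_imp_le)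
  then have "lq_norm p (\<lambda>k::nat. ennreal (t ^ k)) = epowr (ennreal (1 / (1 - ?t))) (1 / ?r)"
    using 2 by (simp add: lq_norm_def)
  also have "\<dots> = ennreal ((1 / (1 - ?t)) powr (1 / ?r))"
    using t by (simp add: epowr_ennreal)
  finally show ?thesis using t by (intro exI[of _ "(1 / (1 - ?t)) powr (1 / ?r)"]) simp
qed

lemma geometric_sum_le:
  fixes X :: ennreal
  assumes "0 < t" "t < 1" "\<And>k. k \<le> j \<Longrightarrow> x k \<le> X"
  shows "(\<Sum>k\<le>j. ennreal (t ^ (j - k)) * x k) \<le> ennreal (1 / (1 - t)) * X"
proof -
  have "(\<Sum>k\<le>j. ennreal (t ^ (j - k)) * x k) \<le> (\<Sum>k\<le>j. ennreal (t ^ (j - k)) * X)"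
    using assms by (intro sum_mono mult_left_mono) auto
  also have "\<dots> = (\<Sum>k\<le>j. ennreal (t ^ (j - k))) * X"
    by (simp add: sum_distrib_right)
  also have "(\<Sum>k\<le>j. ennreal (t ^ (j - k))) = (\<Sum>i\<le>j. ennreal (t ^ i))"
    by (rule sum.reindex_bij_witness[of _ "\<lambda>i. j - i" "\<lambda>i. j - i"]) auto
  also have "\<dots> \<le> (\<Sum>i. ennreal (t ^ i))"
    by (rule sum_le_suminf) auto
  also have "\<dots> = ennreal (1 / (1 - t))"
    using assms by (intro suminf_ennreal_geometric) auto
  finally show ?thesis by (simp add: mult_right_mono)
qed

text \<open>The coefficients \<open>\<lambda>\<^sub>k\<^sub>,\<^sub>l\<close> of the levels \<open>k \<le> j\<close> near \<open>z\<close>.  The weight \<open>2\<^sup>-\<^sup>(\<^sup>j\<^sup>-\<^sup>k\<^sup>)\<close> is the oscillation of a Lipschitz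
atom of level \<open>k\<close> over a distance \<open>2\<^sup>-\<^sup>j\<close>.\<close>

definition spread :: "real \<Rightarrow> (nat \<Rightarrow> int^'n \<Rightarrow> complex) \<Rightarrow> nat \<Rightarrow> real^'n \<Rightarrow> real" where
  "spread E lam j z = (\<Sum>k\<le>j. (1 / 2) ^ (j - k) * (\<Sum>l\<in>near E k z. norm (lam k l)))"

lemma spread_nonneg: "0 \<le> spread E lam j z"
  by (simp add: spread_def sum_nonneg)

text \<open>The factor \<open>2\<^sup>-\<^sup>n\<^sup>(\<^sup>j\<^sup>-\<^sup>k\<^sup>)\<^sup>/\<^sup>p\<close> compensates the number of nodes of level \<open>j\<close> in a cube of level \<open>k\<close>.\<close>

lemma lq_norm_node_kernel:
  fixes l :: "int^'n"
  assumes p: "0 < p" and "0 \<le> E" "k \<le> j"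
  defines "\<gamma> \<equiv> 2 powr (- (real CARD('n) * enn2real (1 / p)))"
  shows "lq_norm p (\<lambda>m. if node j m \<in> dcube E k l then ennreal (\<gamma> ^ (j - k)) else 0)
      \<le> ennreal ((2 * E + 1) powr (real CARD('n) * enn2real (1 / p)))"
  using p
proof (cases rule: exponent_cases)
  case 1
  have "(SUP m. if node j m \<in> dcube E k l then ennreal (\<gamma> ^ (j - k)) else 0) \<le> 1"
    using 1 by (intro SUP_least) (auto simp: \<gamma>_def)
  then show ?thesis using 1 assms by (simp add: lq_norm_def)
next
  case 2
  let ?r = "enn2real p" and ?n = "real CARD('n)" and ?S = "{m. node j m \<in> dcube E k l}"
  have S: "finite ?S" "real (card ?S) \<le> ((2 * E + 1) * 2 ^ (j - k)) ^ CARD('n)"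
    using card_nodes_in_dcube_le[of E k j l] assms by auto
  have g0: "0 \<le> \<gamma> ^ (j - k)" by (simp add: \<gamma>_def)
  have g: "(\<gamma> ^ (j - k)) powr ?r = 1 / (2 ^ (j - k)) ^ CARD('n)"
  proof -
    have "\<gamma> powr ?r = 2 powr (- ?n)"
      using 2 by (simp add: \<gamma>_def powr_powr)
    also have "\<dots> = 1 / 2 ^ CARD('n)"
      by (simp add: powr_minus_divide powr_realpow)
    finally have "(\<gamma> ^ (j - k)) powr ?r = (1 / 2 ^ CARD('n)) ^ (j - k)"
      by (simp add: power_powr_swap \<gamma>_def)
    also have "\<dots> = 1 / (2 ^ (j - k)) ^ CARD('n)"
      by (simp add: power_divide mult.commute flip: power_mult)
    finally show ?thesis .
  qed
  have "(\<integral>\<^sup>+m. epowr (if node j m \<in> dcube E k l then ennreal (\<gamma> ^ (j - k)) else 0) ?r \<partial>count_space UNIV)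
      = (\<Sum>m\<in>?S. epowr (if node j m \<in> dcube E k l then ennreal (\<gamma> ^ (j - k)) else 0) ?r)"
    using S by (intro nn_integral_count_space') auto
  also have "\<dots> = (\<Sum>m\<in>?S. ennreal (1 / (2 ^ (j - k)) ^ CARD('n)))"
    by (intro sum.cong refl) (simp add: epowr_ennreal[OF g0] g)
  also have "\<dots> = ennreal (real (card ?S) * (1 / (2 ^ (j - k)) ^ CARD('n)))"
    by (subst ennreal_mult) (simp_all add: ennreal_of_nat_eq_real_of_nat)
  also have "\<dots> \<le> ennreal ((2 * E + 1) ^ CARD('n))"
    using S(2) by (intro ennreal_leI) (simp add: pos_divide_le_eq power_mult_distrib)
  finally have "lq_norm p (\<lambda>m. if node j m \<in> dcube E k l then ennreal (\<gamma> ^ (j - k)) else 0)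
      \<le> epowr (ennreal ((2 * E + 1) ^ CARD('n))) (1 / ?r)"
    using 2 by (simp add: lq_norm_def epowr_mono)
  also have "\<dots> = ennreal ((2 * E + 1) powr (?n * enn2real (1 / p)))"
    using 2 assms by (simp add: epowr_ennreal powr_powr flip: powr_realpow)
  finally show ?thesis .
qed

text \<open>The hypothesis on \<open>W\<close> splits the total weight into \<open>\<gamma>\<^sup>j\<^sup>-\<^sup>k\<close>, which is spent on counting nodes, and three
equal geometric factors \<open>u\<^sup>j\<^sup>-\<^sup>k\<close>.  One of them turns the sum over \<open>k\<close> into a supremum here; the other two
serve for the \<open>p\<close>-norm and the \<open>q\<close>-norm afterwards.\<close>

lemma spread_le_SUP:
  fixes lam :: "nat \<Rightarrow> int^'n \<Rightarrow> complex"
  assumes E: "0 \<le> E" and pos: "0 < u" "u < 1" "0 < \<gamma>" "\<And>k. 0 < W k"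
    and W: "\<And>k. k \<le> j \<Longrightarrow> W j * (1 / 2) ^ (j - k)
      = u ^ (j - k) * (\<gamma> ^ (j - k) * (u ^ (j - k) * (u ^ (j - k) * W k)))"
  shows "ennreal (W j * spread E lam j (node j m)) \<le> ennreal (1 / (1 - u) * (2 * E + 1) ^ CARD('n)) *
      (SUP (k, l). (if k \<le> j \<and> node j m \<in> dcube E k l then ennreal (\<gamma> ^ (j - k)) else 0) *
         (if k \<le> j then ennreal (u ^ (j - k) * (u ^ (j - k) * W k)) * ennreal (norm (lam k l)) else 0))"
    (is "_ \<le> _ * ?Y")
proof -
  let ?N = "\<lambda>k. near E k (node j m)"
  let ?M = "(2 * E + 1) ^ CARD('n)"
  let ?T = "\<lambda>k l. ennreal (\<gamma> ^ (j - k)) * (ennreal (u ^ (j - k) * (u ^ (j - k) * W k)) * ennreal (norm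
    (lam k l)))"
  have T: "?T k l = ennreal (\<gamma> ^ (j - k) * (u ^ (j - k) * (u ^ (j - k) * W k)) * norm (lam k l))" for k l
    using pos by (simp add: ennreal_mult less_imp_le mult_ac)
  have "W j * spread E lam j (node j m)
      = (\<Sum>k\<le>j. (W j * (1 / 2) ^ (j - k)) * (\<Sum>l\<in>?N k. norm (lam k l)))"
    by (simp add: spread_def sum_distrib_left mult.assoc)
  also have "\<dots> = (\<Sum>k\<le>j. u ^ (j - k) * (\<Sum>l\<in>?N k. \<gamma> ^ (j - k) * (u ^ (j - k) * (u ^ (j - k) * W k)) * norm
    (lam k l)))"
    by (intro sum.cong refl) (simp add: W sum_distrib_left mult_ac)
  finally have eq: "W j * spread E lam j (node j m) = \<dots>" .
  have "ennreal (W j * spread E lam j (node j m)) = (\<Sum>k\<le>j. ennreal (u ^ (j - k) *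
      (\<Sum>l\<in>?N k. \<gamma> ^ (j - k) * (u ^ (j - k) * (u ^ (j - k) * W k)) * norm (lam k l))))"
    unfolding eq using pos by (intro sum_ennreal[symmetric]) (simp add: sum_nonneg less_imp_le)
  also have "\<dots> = (\<Sum>k\<le>j. ennreal (u ^ (j - k)) * (\<Sum>l\<in>?N k. ?T k l))"
  proof (intro sum.cong refl)
    fix k
    have "ennreal (a * (\<Sum>l\<in>?N k. f l)) = ennreal a * (\<Sum>l\<in>?N k. ennreal (f l))"
      if "0 \<le> a" "\<And>l. 0 \<le> f l" for a f
      using that by (simp add: ennreal_mult sum_nonneg)
    then show "ennreal (u ^ (j - k) * (\<Sum>l\<in>?N k. \<gamma> ^ (j - k) * (u ^ (j - k) * (u ^ (j - k) * W k)) * norm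
      (lam k l)))
        = ennreal (u ^ (j - k)) * (\<Sum>l\<in>?N k. ?T k l)"
      unfolding T using pos by (simp add: less_imp_le)
  qed
  also have "\<dots> \<le> ennreal (1 / (1 - u)) * (ennreal ?M * ?Y)"
  proof (rule geometric_sum_le[OF pos(1,2)])
    fix k assume k: "k \<le> j"
    have "(\<Sum>l\<in>?N k. ?T k l) \<le> (\<Sum>l\<in>?N k. ?Y)"
      using k by (intro sum_mono SUP_upper2[of "(k, _)"]) (auto simp: near_def)
    also have "\<dots> = ennreal (real (card (?N k))) * ?Y"
      by (simp add: ennreal_of_nat_eq_real_of_nat)
    also have "\<dots> \<le> ennreal ?M * ?Y"
      by (intro mult_right_mono ennreal_leI card_near_le E) auto
    finally show "(\<Sum>l\<in>?N k. ?T k l) \<le> ennreal ?M * ?Y" .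
  qed
  also have "\<dots> = ennreal (1 / (1 - u) * ?M) * ?Y"
    using pos E by (subst ennreal_mult) (auto simp: mult.assoc)
  finally show ?thesis .
qed

text \<open>By \<open>spread_le_SUP\<close> and the kernel bound for nodes, the \<open>j\<close>-th weighted norm of \<open>\<nu>\<close> is at most a constant times
\<open>X\<^sub>j = sup\<^sub>k\<^sub>\<le>\<^sub>j u\<^sup>j\<^sup>-\<^sup>k w\<^sub>k\<close>, where \<open>w\<^sub>k\<close> is the \<open>k\<close>-th weighted norm of \<open>\<lambda>\<close>.  A geometric kernel bounds the \<open>q\<close>-norm of
\<open>X\<close> by that of \<open>w\<close>.\<close>

theorem b_norm_spread_le:
  assumes p: "0 < p" and q: "0 < q" and s: "s < 1" and E: "0 \<le> E"
  shows "\<exists>C::real. 0 < C \<and> (\<forall>(lam :: nat \<Rightarrow> int^'n \<Rightarrow> complex) nu.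
     (\<forall>j m. norm (nu j m) \<le> spread E lam j (node j m)) \<longrightarrow> b_norm s p q nu \<le> ennreal C * b_norm s p q lam)"
proof -
  let ?n = "real CARD('n)" and ?e = "enn2real (1 / p)"
  define a where "a = s - ?n * ?e"
  define W where "W j = 2 powr (real j * a)" for j :: nat
  \<comment> \<open>The gain \<open>2\<^sup>-\<^sup>(\<^sup>1\<^sup>-\<^sup>s\<^sup>)\<^sup>(\<^sup>j\<^sup>-\<^sup>k\<^sup>)\<close> is divided into three equal parts.\<close>
  define u where "u = 2 powr (- ((1 - s) / 3))"
  define \<gamma> where "\<gamma> = 2 powr (- (?n * ?e))"
  have pos: "0 < u" "u < 1" "0 < \<gamma>" "\<And>k. 0 < W k"
    using s by (auto simp: u_def \<gamma>_def W_def powr_less_one)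
  have Wid: "W j * (1 / 2) ^ (j - k) = u ^ (j - k) * (\<gamma> ^ (j - k) * (u ^ (j - k) * (u ^ (j - k) * W k)))"
    if "k \<le> j" for j k
  proof -
    have half: "(1 / 2 :: real) = 2 powr (-1)" by (simp add: powr_minus_divide)
    define i where "i = j - k"
    with that have j: "j = k + i" by simp
    have pw: "(2 powr x) ^ i = 2 powr (real i * x)" for x :: real
      by (simp add: powr_powr mult.commute flip: powr_realpow)
    show ?thesis unfolding half W_def u_def \<gamma>_def j add_diff_cancel_left' pw powr_add[symmetric]
      by (rule arg_cong[where f = "(powr) 2"]) (simp add: a_def field_simps)
  qed
  obtain c where c: "0 < c" "lq_norm p (\<lambda>k::nat. ennreal (u ^ k)) \<le> ennreal c"
    using lq_norm_geometric[OF p pos(1,2)] by blast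
  obtain c' where c': "0 < c'" "lq_norm q (\<lambda>k::nat. ennreal (u ^ k)) \<le> ennreal c'"
    using lq_norm_geometric[OF q pos(1,2)] by blast
  define A where "A = 1 / (1 - u) * (2 * E + 1) ^ CARD('n)"
  define B where "B = (2 * E + 1) powr (?n * ?e)"
  have AB: "0 < A" "0 < B" using pos E by (auto simp: A_def B_def)
  show ?thesis
  proof (intro exI[of _ "A * B * c * c'"] conjI allI impI)
    show "0 < A * B * c * c'" using AB c c' by simp
    fix lam nu :: "nat \<Rightarrow> int^'n \<Rightarrow> complex"
    assume nu: "\<forall>j m. norm (nu j m) \<le> spread E lam j (node j m)"
    define w where "w k = ennreal (W k) * lq_norm p (\<lambda>m. ennreal (norm (lam k m)))" for k
    define X where "X j = (SUP k. (if k \<le> j then ennreal (u ^ (j - k)) else 0) * w k)" for j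
    have step: "ennreal (W j) * lq_norm p (\<lambda>m. ennreal (norm (nu j m))) \<le> ennreal (A * B * c) * X j" for j
    proof -
      define \<kappa> where "\<kappa> kl m = (case kl of (k, l) \<Rightarrow> if k \<le> j
        \<and> node j m \<in> dcube E k l then ennreal (\<gamma> ^ (j - k)) else 0)"
        for kl :: "nat \<times> (int^'n)" and m :: "int^'n"
      define G where "G k l = (if k
        \<le> j then ennreal (u ^ (j - k) * (u ^ (j - k) * W k)) * ennreal (norm (lam k l)) else 0)" for k l
      have "ennreal (W j) * lq_norm p (\<lambda>m. ennreal (norm (nu j m)))
          = lq_norm p (\<lambda>m. ennreal (W j) * ennreal (norm (nu j m)))"
        by (simp add: lq_norm_cmult[OF p])
      also have "\<dots> \<le> lq_norm p (\<lambda>m. ennreal A * (SUP kl. \<kappa> kl m * (case kl of (k, l) \<Rightarrow> G k l)))"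
      proof (rule lq_norm_mono[OF p])
        fix m
        have "ennreal (W j) * ennreal (norm (nu j m)) \<le> ennreal (W j * spread E lam j (node j m))"
          using nu pos(4)[of j]
            by (auto simp: spread_nonneg less_imp_le ennreal_mult[symmetric] intro!: ennreal_leI)
        also note spread_le_SUP[of E u \<gamma> W j lam m, OF E pos Wid, folded A_def]
        also have "(SUP (k, l). (if k \<le> j \<and> node j m \<in> dcube E k l then ennreal (\<gamma> ^ (j - k)) else 0) *
              (if k \<le> j then ennreal (u ^ (j - k) * (u ^ (j - k) * W k)) * ennreal (norm (lam k l)) else 0))
            = (SUP kl. \<kappa> kl m * (case kl of (k, l) \<Rightarrow> G k l))"
          by (intro arg_cong[where f = Sup] image_cong refl) (simp add: \<kappa>_def G_def split: prod.split)
        finally show "ennreal (W j) * ennreal (norm (nu j m))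
          \<le> ennreal A * (SUP kl. \<kappa> kl m * (case kl of (k, l) \<Rightarrow> G k l))" by simp
      qed
      also have "\<dots> = ennreal A * lq_norm p (\<lambda>m. SUP kl. \<kappa> kl m * (case kl of (k, l) \<Rightarrow> G k l))"
        by (rule lq_norm_cmult[OF p])
      also have "lq_norm p (\<lambda>m. SUP kl. \<kappa> kl m * (case kl of (k, l) \<Rightarrow> G k l))
        \<le> ennreal B * lq_norm p (\<lambda>(k, l). G k l)"
      proof (rule lq_norm_sup_kernel[OF p order_refl])
        fix kl :: "nat \<times> (int^'n)"
        obtain k l where kl: "kl = (k, l)" by (cases kl)
        have "lq_norm p (\<lambda>m::int^'n. 0) \<le> ennreal B"
          using p by simp
        then show "lq_norm p (\<kappa> kl) \<le> ennreal B"
          using lq_norm_node_kernel[OF p E, of k j l, folded \<gamma>_def B_def]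
          by (cases "k \<le> j") (simp_all add: \<kappa>_def[abs_def] kl)
      qed
      also have "lq_norm p (\<lambda>(k, l). G k l) = lq_norm p (\<lambda>k. lq_norm p (G k))"
        by (rule lq_norm_pairs[OF p])
      also have "\<dots> \<le> lq_norm p (\<lambda>k. X j * (if k \<le> j then ennreal (u ^ (j - k)) else 0))"
      proof (rule lq_norm_mono[OF p])
        fix k
        show "lq_norm p (G k) \<le> X j * (if k \<le> j then ennreal (u ^ (j - k)) else 0)"
        proof (cases "k \<le> j")
          case True
          have "lq_norm p (G k)
            = ennreal (u ^ (j - k) * (u ^ (j - k) * W k)) * lq_norm p (\<lambda>m. ennreal (norm (lam k m)))"
            unfolding G_def[abs_def] using True by (simp add: lq_norm_cmult[OF p])
          also have "\<dots> = ennreal (u ^ (j - k)) * (ennreal (u ^ (j - k)) * w k)"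
            using pos by (simp add: w_def ennreal_mult less_imp_le mult.assoc)
          also have "ennreal (u ^ (j - k)) * w k \<le> X j"
            unfolding X_def using True by (intro SUP_upper2[of k]) auto
          finally have "lq_norm p (G k) \<le> ennreal (u ^ (j - k)) * X j" by (simp add: mult_left_mono)
          then show ?thesis using True by (simp add: mult.commute)
        next
          case False
          then show ?thesis
            using p by (simp add: G_def[abs_def])
        qed
      qed
      also have "\<dots> = X j * lq_norm p (\<lambda>k. if k \<le> j then ennreal (u ^ (j - k)) else 0)"
        by (rule lq_norm_cmult[OF p])
      also have "lq_norm p (\<lambda>k. if k \<le> j then ennreal (u ^ (j - k)) else 0) \<le> ennreal c"
        by (rule order_trans[OF lq_norm_reindex_le[OF p, of "\<lambda>k. k
          \<le> j" "\<lambda>k. j - k" "\<lambda>i. ennreal (u ^ i)"] c(2)]) auto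
      finally have "ennreal (W j) * lq_norm p (\<lambda>m. ennreal (norm (nu j m)))
        \<le> ennreal A * (ennreal B * (X j * ennreal c))"
        by (simp add: mult_left_mono)
      then show ?thesis using AB c(1) by (simp add: ennreal_mult mult_ac)
    qed
    have "b_norm s p q nu = lq_norm q (\<lambda>j. ennreal (W j) * lq_norm p (\<lambda>m. ennreal (norm (nu j m))))"
      by (simp add: b_norm_eq W_def a_def)
    also have "\<dots> \<le> lq_norm q (\<lambda>j. ennreal (A * B * c) * X j)"
      by (rule lq_norm_mono[OF q step])
    also have "\<dots> = ennreal (A * B * c) * lq_norm q X"
      by (rule lq_norm_cmult[OF q])
    also have "lq_norm q X \<le> ennreal c' * lq_norm q w"
    proof (rule lq_norm_sup_kernel[OF q])
      show "X j \<le> (SUP k. (if k \<le> j then ennreal (u ^ (j - k)) else 0) * w k)" for j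
        by (simp add: X_def)
      show "lq_norm q (\<lambda>j. if k \<le> j then ennreal (u ^ (j - k)) else 0) \<le> ennreal c'" for k
        by (rule order_trans[OF lq_norm_reindex_le[OF q, of "\<lambda>j. k
          \<le> j" "\<lambda>j. j - k" "\<lambda>i. ennreal (u ^ i)"] c'(2)]) auto
    qed
    also have "lq_norm q w = b_norm s p q lam"
      by (simp add: b_norm_eq w_def[abs_def] W_def a_def)
    finally show "b_norm s p q nu \<le> ennreal (A * B * c * c') * b_norm s p q lam"
      using AB c(1) c'(1) by (simp add: ennreal_mult mult_left_mono mult.assoc)
  qed
qed

section \<open>Sums of rough atoms\<close>

text \<open>The indicator of a cube of level \<open>k\<close> has \<open>L\<^sub>p\<close>-norm \<open>(2D)\<^sup>n\<^sup>/\<^sup>p 2\<^sup>-\<^sup>k\<^sup>n\<^sup>/\<^sup>p\<close>; the kernel is normalized accordingly.\<close>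

lemma Lp_norm_cubes:
  fixes f :: "real^'n \<Rightarrow> complex" and \<beta> :: "nat \<Rightarrow> int^'n \<Rightarrow> ennreal"
  assumes p: "0 < p" and D: "0 < D" and f: "f \<in> borel_measurable lebesgue"
    and F: "\<And>x. ennreal (norm (f x)) \<le> (SUP (k, l). indicator (dcube D k l) x * \<beta> k l)"
  shows "Lp_norm p f \<le> ennreal ((2 * D) powr (real CARD('n) * enn2real (1 / p))) *
     lq_norm p (\<lambda>k. ennreal (2 powr (- (real k * (real CARD('n) * enn2real (1 / p))))) * lq_norm p (\<beta> k))"
proof -
  let ?n = "real CARD('n)" and ?e = "enn2real (1 / p)"
  define \<kappa> where "\<kappa> kl x
    = indicator (dcube D (fst kl) (snd kl)) x * ennreal (2 powr (real (fst kl) * (?n * ?e)))"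
    for kl :: "nat \<times> (int^'n)" and x :: "real^'n"
  define G where "G k l = ennreal (2 powr (- (real k * (?n * ?e)))) * \<beta> k l" for k l
  have "Lp_norm p f \<le> ennreal ((2 * D) powr (?n * ?e)) * lq_norm p (\<lambda>(k, l). G k l)"
  proof (rule Lp_norm_sup_kernel[OF p f])
    fix x
    have "ennreal (2 powr t) * ennreal (2 powr - t) = 1" for t :: real
      by (simp flip: ennreal_mult powr_add)
    moreover have "I * a * (a' * c) = I * c" if "a * a' = 1" for I a a' c :: ennreal
      by (metis mult.assoc mult.left_neutral that)
    ultimately have "\<kappa> kl x * (case kl of (k, l) \<Rightarrow> G k l)
      = (case kl of (k, l) \<Rightarrow> indicator (dcube D k l) x * \<beta> k l)" for kl
      unfolding \<kappa>_def G_def by (cases kl) (simp only: fst_conv snd_conv prod.case)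
    then show "ennreal (norm (f x)) \<le> (SUP kl. \<kappa> kl x * (case kl of (k, l) \<Rightarrow> G k l))"
      using F[of x] by simp
  next
    fix kl :: "nat \<times> (int^'n)"
    have [measurable]: "dcube D (fst kl) (snd kl) \<in> sets lebesgue"
      by (simp add: dcube_eq_cbox)
    show "\<kappa> kl \<in> borel_measurable lebesgue" unfolding \<kappa>_def by measurable
    {
      assume "p = \<infinity>"
      then show "\<kappa> kl x \<le> ennreal ((2 * D) powr (?n * ?e))" for x
        using D by (simp add: \<kappa>_def indicator_def)
    next
      assume fin: "p \<noteq> \<infinity>" "0 < enn2real p"
      let ?r = "enn2real p"
      obtain k l where kl: "kl = (k, l)" by (cases kl)
      have e: "?e = 1 / ?r" using exponent_cases[OF p] fin by metis
      have pw: "(2 powr (real k * (?n * ?e))) powr ?r = (2 ^ k) ^ CARD('n)"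
        using fin by (simp add: e powr_powr powr_realpow flip: power_mult of_nat_mult)
      have "(\<integral>\<^sup>+x. epowr (\<kappa> kl x) ?r \<partial>lebesgue)
        = (\<integral>\<^sup>+x. ennreal ((2 ^ k) ^ CARD('n)) * indicator (dcube D k l) x \<partial>lebesgue)"
        by (intro nn_integral_cong) (simp add: \<kappa>_def kl indicator_def epowr_ennreal pw)
      also have "\<dots> = ennreal ((2 ^ k) ^ CARD('n)) * ennreal ((2 * D / 2 ^ k) ^ CARD('n))"
        using D by (subst nn_integral_cmult_indicator) (simp_all add: emeasure_dcube, simp add: dcube_eq_cbox)
      also have "\<dots> = ennreal ((2 * D) ^ CARD('n))"
        using D by (simp add: power_divide flip: ennreal_mult)
      also have "\<dots> = epowr (ennreal ((2 * D) powr (?n * ?e))) ?r"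
        using D fin by (simp add: epowr_ennreal e powr_powr powr_realpow)
      finally show "(\<integral>\<^sup>+x. epowr (\<kappa> kl x) ?r \<partial>lebesgue) \<le> epowr (ennreal ((2 * D) powr (?n * ?e))) ?r" by simp
    }
  qed
  also have "lq_norm p (\<lambda>(k, l). G k l)
    = lq_norm p (\<lambda>k. ennreal (2 powr (- (real k * (?n * ?e)))) * lq_norm p (\<beta> k))"
    unfolding lq_norm_pairs[OF p] G_def by (simp add: lq_norm_cmult[OF p])
  finally show ?thesis .
qed

text \<open>The common generalization of \<open>K\<close>-atoms and \<open>Lip\<close>-atoms.\<close>

definition rough :: "real \<Rightarrow> real \<Rightarrow> nat \<Rightarrow> int^'n \<Rightarrow> (real^'n \<Rightarrow> complex) \<Rightarrow> bool" where
  "rough D A k m b \<longleftrightarrow> (\<forall>x. b x \<noteq> 0 \<longrightarrow> x \<in> dcube D k m) \<and> (\<forall>x. norm (b x) \<le> A) \<and>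
     (\<forall>x y. norm (b x - b y) \<le> A * 2 ^ k * norm (x - y))"

definition level :: "(nat \<Rightarrow> int^'n \<Rightarrow> complex) \<Rightarrow>
  (nat \<Rightarrow> int^'n \<Rightarrow> real^'n \<Rightarrow> complex) \<Rightarrow> nat \<Rightarrow> real^'n \<Rightarrow> complex" where
  "level lam b k x = (\<Sum>\<^sub>\<infinity>m. lam k m * b k m x)"

definition partial_sum :: "(nat \<Rightarrow> int^'n \<Rightarrow> complex) \<Rightarrow>
  (nat \<Rightarrow> int^'n \<Rightarrow> real^'n \<Rightarrow> complex) \<Rightarrow> nat \<Rightarrow> real^'n \<Rightarrow> complex" where
  "partial_sum lam b j x = (\<Sum>k<j. level lam b k x)"

lemma Lp_expansion_iff:
  "Lp_expansion p f lam b \<longleftrightarrow> (\<lambda>N. Lp_norm p (\<lambda>x. f x - partial_sum lam b N x)) \<longlonglongrightarrow> 0"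
  by (simp add: Lp_expansion_def partial_sum_def level_def)

context
  fixes D A :: real and lam :: "nat \<Rightarrow> int^'n \<Rightarrow> complex" and b :: "nat \<Rightarrow> int^'n \<Rightarrow> real^'n \<Rightarrow> complex"
  assumes D: "0 \<le> D" and rough: "\<And>k m. rough D A k m (b k m)"
begin

lemma level_eq_sum:
  assumes "0 \<le> R" "\<And>i. \<bar>x $ i - z $ i\<bar> \<le> R / 2 ^ k"
  shows "level lam b k x = (\<Sum>m\<in>near (D + R) k z. lam k m * b k m x)"
  unfolding level_def
proof (rule infsum_localized[OF _ assms(2) D assms(1)])
  fix m assume "lam k m * b k m x \<noteq> 0"
  then have "b k m x \<noteq> 0" by auto
  then show "x \<in> dcube D k m" using rough[of k m] unfolding rough_def by blast
qed

lemma level_le: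
  assumes "0 \<le> R" "\<And>i. \<bar>x $ i - z $ i\<bar> \<le> R / 2 ^ k"
  shows "norm (level lam b k x) \<le> A * (\<Sum>m\<in>near (D + R) k z. norm (lam k m))"
proof -
  have "norm (level lam b k x) \<le> (\<Sum>m\<in>near (D + R) k z. norm (lam k m) * A)"
    unfolding level_eq_sum[OF assms]
    using rough by (intro sum_norm_le) (auto simp: norm_mult rough_def intro: mult_left_mono)
  then show ?thesis by (simp add: sum_distrib_left mult.commute)
qed

lemma level_diff_le:
  assumes "0 \<le> R" "\<And>i. \<bar>x $ i - z $ i\<bar> \<le> R / 2 ^ k" "\<And>i. \<bar>y $ i - z $ i\<bar> \<le> R / 2 ^ k"
  shows "norm (level lam b k x - level lam b k y)
    \<le> A * 2 ^ k * norm (x - y) * (\<Sum>m\<in>near (D + R) k z. norm (lam k m))"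
proof -
  have "level lam b k x - level lam b k y = (\<Sum>m\<in>near (D + R) k z. lam k m * (b k m x - b k m y))"
    using level_eq_sum[OF assms(1,2)] level_eq_sum[OF assms(1,3)]
    by (simp add: sum_subtractf right_diff_distrib)
  also have "norm \<dots> \<le> (\<Sum>m\<in>near (D + R) k z. norm (lam k m) * (A * 2 ^ k * norm (x - y)))"
    using rough by (intro sum_norm_le) (auto simp: norm_mult rough_def intro: mult_left_mono)
  finally show ?thesis by (simp add: sum_distrib_left mult_ac)
qed

text \<open>Over the distance \<open>2 R 2\<^sup>-\<^sup>j\<close> the levels \<open>k < j\<close> oscillate by a multiple of \<open>2\<^sup>-\<^sup>(\<^sup>j\<^sup>-\<^sup>k\<^sup>)\<close>; level \<open>j\<close>, which is
present if \<open>i = Suc j\<close>, is merely bounded.\<close>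

lemma partial_sum_oscillation:
  fixes x y z :: "real^'n"
  assumes R: "0 \<le> R" and x: "\<And>i. \<bar>x $ i - z $ i\<bar> \<le> R / 2 ^ j" and y: "\<And>i. \<bar>y $ i - z $ i\<bar> \<le> R / 2 ^ j"
    and i: "i = j \<or> i = Suc j"
  shows "norm (partial_sum lam b i y - partial_sum lam b j x)
    \<le> A * (2 * real CARD('n) * R + 1) * spread (D + R) lam j z"
proof -
  let ?n = "real CARD('n)" and ?s = "\<lambda>k. \<Sum>m\<in>near (D + R) k z. norm (lam k m)"
  have A: "0 \<le> A" using rough[of 0 0] norm_ge_zero order_trans unfolding rough_def by blast
  have scale: "R / 2 ^ j \<le> R / 2 ^ k" if "k \<le> j" for k
    using that R by (intro divide_left_mono power_increasing) auto
  have nrm: "norm (y - x) \<le> ?n * (2 * R / 2 ^ j)"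
  proof (rule norm_le_coordinates)
    fix c show "\<bar>(y - x) $ c\<bar> \<le> 2 * R / 2 ^ j"
      using x[of c] y[of c] by simp
  qed
  have "norm (partial_sum lam b j y - partial_sum lam b j x)
    \<le> (\<Sum>k<j. A * (2 * ?n * R) * ((1 / 2) ^ (j - k) * ?s k))"
  proof -
    have "partial_sum lam b j y - partial_sum lam b j x = (\<Sum>k<j. level lam b k y - level lam b k x)"
      by (simp add: partial_sum_def sum_subtractf)
    also have "norm \<dots> \<le> (\<Sum>k<j. A * (2 * ?n * R) * ((1 / 2) ^ (j - k) * ?s k))"
    proof (rule sum_norm_le)
      fix k assume "k \<in> {..<j}"
      then have k: "k \<le> j" by simp
      have "norm (level lam b k y - level lam b k x) \<le> A * 2 ^ k * norm (y - x) * ?s k"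
        using scale[OF k] x y by (intro level_diff_le R) (meson order_trans)+
      also have "\<dots> \<le> A * 2 ^ k * (?n * (2 * R / 2 ^ j)) * ?s k"
        using nrm A by (intro mult_right_mono mult_left_mono sum_nonneg) auto
      also have "\<dots> = A * (2 * ?n * R) * ((1 / 2) ^ (j - k) * ?s k)"
        using k by (simp add: power_diff power_divide field_simps)
      finally show "norm (level lam b k y - level lam b k x) \<le> A * (2 * ?n * R) * ((1 / 2) ^ (j - k) * ?s k)" .
    qed
    finally show ?thesis .
  qed
  moreover have "norm (partial_sum lam b i y - partial_sum lam b j y) \<le> A * ?s j"
    using i level_le[OF R y] A by (auto simp: partial_sum_def sum_nonneg)
  ultimately have "norm (partial_sum lam b i y - partial_sum lam b j x)
      \<le> A * (2 * ?n * R) * (\<Sum>k<j. (1 / 2) ^ (j - k) * ?s k) + A * ?s j"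
    using norm_triangle_ineq[of "partial_sum lam b i y - partial_sum lam b j y"
      "partial_sum lam b j y - partial_sum lam b j x"]
    by (simp add: sum_distrib_left)
  also have "\<dots> \<le> A * (2 * ?n * R) * spread (D + R) lam j z + A * spread (D + R) lam j z"
  proof -
    have sp: "spread (D + R) lam j z = (\<Sum>k<j. (1 / 2) ^ (j - k) * ?s k) + ?s j"
      by (simp add: spread_def lessThan_Suc_atMost[symmetric])
    have nn: "0 \<le> (\<Sum>k<j. (1 / 2) ^ (j - k) * ?s k)" "0 \<le> ?s j"
      by (simp_all add: sum_nonneg)
    show ?thesis
      unfolding sp using A R nn by (intro add_mono mult_left_mono) auto
  qed
  finally show ?thesis by (simp add: algebra_simps)
qed

lemma level_continuous: "continuous_on UNIV (level lam b k)"
proof -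
  have "continuous_on UNIV (b k m)" for m
  proof (rule lipschitz_on_continuous_on)
    show "(\<bar>A\<bar> * 2 ^ k)-lipschitz_on UNIV (b k m)"
    proof (rule lipschitz_onI)
      fix x y
      have "norm (b k m x - b k m y) \<le> A * 2 ^ k * norm (x - y)"
        using rough[of k m] by (simp add: rough_def)
      also have "\<dots> \<le> \<bar>A\<bar> * 2 ^ k * norm (x - y)" by (intro mult_right_mono) auto
      finally show "dist (b k m x) (b k m y) \<le> \<bar>A\<bar> * 2 ^ k * dist x y" by (simp add: dist_norm)
    qed auto
  qed
  then have "continuous_on UNIV (\<lambda>x. \<Sum>\<^sub>\<infinity>m. lam k m * b k m x)"
    using rough D
    by (intro continuous_on_locally_finite_sum[where D = D and k = k] continuous_intros) (auto simp: rough_def)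
  then show ?thesis by (simp add: level_def[abs_def])
qed

lemma partial_sum_continuous: "continuous_on UNIV (partial_sum lam b j)"
  unfolding partial_sum_def[abs_def] using level_continuous by (intro continuous_intros) auto

end

lemma continuous_imp_lebesgue_measurable:
  fixes f :: "real^'n \<Rightarrow> complex"
  shows "continuous_on UNIV f \<Longrightarrow> f \<in> borel_measurable lebesgue"
  using borel_measurable_continuous_onI measurable_completion by (metis measurable_lborel2 )

lemma weighted_level_le_b_norm:
  fixes lam :: "nat \<Rightarrow> int^'n \<Rightarrow> complex"
  assumes "0 < q"
  shows "ennreal (2 powr (real k * (s - real CARD('n) * enn2real (1 / p)))) * lq_norm p (\<lambda>m. ennreal (norm
    (lam k m)))
    \<le> b_norm s p q lam"
  unfolding b_norm_eq using elem_le_lq_norm[OF assms] .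

text \<open>The \<open>k\<close>-th level is \<open>O(2\<^sup>-\<^sup>k\<^sup>s)\<close> in \<open>L\<^sub>p\<close>.  Since the triangle inequality may fail for \<open>p < 1\<close>, half of this decay
is used to replace the sum over the levels pointwise by a supremum, and the other half to sum the
\<open>p\<close>-th powers of the norms.\<close>

theorem Lp_norm_le_b_norm:
  fixes s D A :: real
  assumes p: "0 < p" and q: "0 < q" and s: "0 < s" and D: "0 < D" and A: "0 \<le> A"
  shows "\<exists>C::real. \<forall>(f :: real^'n \<Rightarrow> complex) lam b.
     f \<in> borel_measurable lebesgue \<longrightarrow> (\<forall>k m. rough D A k m (b k m)) \<longrightarrow> Lp_expansion p f lam b \<longrightarrow>
     Lp_norm p f \<le> ennreal C * b_norm s p q lam"
proof -
  let ?n = "real CARD('n)" and ?e = "enn2real (1 / p)"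
  define t where "t = 2 powr (- (s / 2))"
  have t: "0 < t" "t < 1" using s by (auto simp: t_def powr_less_one)
  obtain c where c: "0 < c" "lq_norm p (\<lambda>k::nat. ennreal (t ^ k)) \<le> ennreal c"
    using lq_norm_geometric[OF p t] by blast
  obtain C0 where C0: "0 < C0" "\<And>f g. f \<in> borel_measurable lebesgue \<Longrightarrow> g \<in> borel_measurable lebesgue \<Longrightarrow>
           Lp_norm p (\<lambda>x::real^'n. f x + g x) \<le> ennreal C0 * (Lp_norm p f + Lp_norm p g)"
    using Lp_norm_triangle[OF p, where 'n = 'n] by blast
  define M where "M = 1 / (1 - t) * (A * (2 * D + 1) ^ CARD('n))"
  have M: "0 \<le> M" using t A D by (simp add: M_def)
  define B where "B = (2 * D) powr (?n * ?e)"
  show ?thesis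
  proof (intro exI[of _ "C0 * (B * M * c)"] allI impI)
    fix f :: "real^'n \<Rightarrow> complex" and lam b
    assume f: "f \<in> borel_measurable lebesgue" and rough: "\<forall>k m. rough D A k m (b k m)"
      and ex: "Lp_expansion p f lam b"
    let ?b = "b_norm s p q lam"
    have rgh: "rough D A k m (b k m)" for k m using rough by blast
    note D0 = less_imp_le[OF D]
    have bound: "Lp_norm p (partial_sum lam b N) \<le> ennreal (B * M * c) * ?b" for N
    proof -
      define \<beta> where "\<beta> k l = ennreal M * (ennreal (1 / t ^ k) * ennreal (norm (lam k l)))" for k l
      have "Lp_norm p (partial_sum lam b N)
        \<le> ennreal B * lq_norm p (\<lambda>k. ennreal (2 powr (- (real k * (?n * ?e)))) * lq_norm p (\<beta> k))"
        unfolding B_def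
      proof (rule Lp_norm_cubes[OF p D])
        show "partial_sum lam b N \<in> borel_measurable lebesgue"
          by (rule continuous_imp_lebesgue_measurable[OF partial_sum_continuous[OF D0 rgh]])
        fix x :: "real^'n"
        define Y where "Y = (SUP (k, l). indicator (dcube D k l) x * (ennreal (1 / t ^ k) * ennreal (norm
          (lam k l))))"
        have "ennreal (norm (level lam b k x))
          \<le> ennreal (t ^ k) * (ennreal (A * (2 * D + 1) ^ CARD('n)) * Y)" for k
        proof -
          have "norm (level lam b k x) \<le> A * (\<Sum>m\<in>near (D + 0) k x. norm (lam k m))"
            by (rule level_le[OF D0 rgh]) auto
          also have "\<dots> = t ^ k * (A * (\<Sum>m\<in>near D k x. 1 / t ^ k * norm (lam k m)))"
            using t by (simp add: sum_distrib_left)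
          finally have "ennreal (norm (level lam b k x))
            \<le> ennreal (t ^ k * (A * (\<Sum>m\<in>near D k x. 1 / t ^ k * norm (lam k m))))"
            by (rule ennreal_leI)
          also have "\<dots> = ennreal (t ^ k) * (ennreal A * (\<Sum>m\<in>near D k x. ennreal (1 / t ^ k) * ennreal
            (norm (lam k m))))"
            using t A by (simp add: sum_nonneg flip: ennreal_mult)
          also have "(\<Sum>m\<in>near D k x. ennreal (1 / t ^ k) * ennreal (norm (lam k m))) \<le> (\<Sum>m\<in>near D k x. Y)"
          proof (rule sum_mono)
            fix l assume "l \<in> near D k x"
            then show "ennreal (1 / t ^ k) * ennreal (norm (lam k l)) \<le> Y"
              unfolding Y_def by (intro SUP_upper2[of "(k, l)"]) (auto simp: near_def)
          qed
          also have "\<dots> = ennreal (real (card (near D k x))) * Y"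
            by (simp add: ennreal_of_nat_eq_real_of_nat)
          also have "\<dots> \<le> ennreal ((2 * D + 1) ^ CARD('n)) * Y"
            by (intro mult_right_mono ennreal_leI card_near_le D0) auto
          finally show ?thesis using A D0 by (simp add: ennreal_mult mult_left_mono mult.assoc)
        qed
        then have "(\<Sum>k<N. ennreal (norm (level lam b k x)))
          \<le> (\<Sum>k<N. ennreal (t ^ k) * (ennreal (A * (2 * D + 1) ^ CARD('n)) * Y))"
          by (rule sum_mono)
        also have "\<dots> = (\<Sum>k<N. ennreal (t ^ k)) * (ennreal (A * (2 * D + 1) ^ CARD('n)) * Y)"
          by (simp only: sum_distrib_right)
        also have "(\<Sum>k<N. ennreal (t ^ k)) \<le> (\<Sum>k. ennreal (t ^ k))"
          by (rule sum_le_suminf) auto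
        also have "(\<Sum>k. ennreal (t ^ k)) = ennreal (1 / (1 - t))"
          using t by (intro suminf_ennreal_geometric) auto
        finally have "(\<Sum>k<N. ennreal (norm (level lam b k x)))
          \<le> ennreal (1 / (1 - t)) * (ennreal (A * (2 * D + 1) ^ CARD('n)) * Y)"
          by (simp add: mult_right_mono)
        also have "\<dots> = ennreal M * Y"
          unfolding M_def using t A D by (subst ennreal_mult[of "1 / (1 - t)"]) (auto simp: mult.assoc)
        also have "\<dots> = (SUP (k, l). indicator (dcube D k l) x * \<beta> k l)"
          unfolding Y_def \<beta>_def SUP_mult_left_ennreal
          by (intro arg_cong[where f = Sup] image_cong) (auto simp: mult_ac)
        finally have "(\<Sum>k<N. ennreal (norm (level lam b k x)))
          \<le> (SUP (k, l). indicator (dcube D k l) x * \<beta> k l)" .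
        moreover have "ennreal (norm (partial_sum lam b N x)) \<le> (\<Sum>k<N. ennreal (norm (level lam b k x)))"
          by (simp add: partial_sum_def norm_sum ennreal_leI)
        ultimately show "ennreal (norm (partial_sum lam b N x))
          \<le> (SUP (k, l). indicator (dcube D k l) x * \<beta> k l)"
          by simp
      qed
      also have "lq_norm p (\<lambda>k. ennreal (2 powr (- (real k * (?n * ?e)))) * lq_norm p (\<beta> k))
        \<le> lq_norm p (\<lambda>k. (ennreal M * ?b) * ennreal (t ^ k))"
      proof (rule lq_norm_mono[OF p])
        fix k
        have tk: "2 powr (- (real k * (?n * ?e))) * (1 / t ^ k) = t ^ k * 2 powr (real k * (s - ?n * ?e))"
        proof -
          have tk: "t ^ k = 2 powr (real k * (- (s / 2)))"
            by (simp add: t_def powr_powr mult.commute flip: powr_realpow)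
          show ?thesis unfolding tk divide_inverse powr_minus[symmetric] mult_1_left powr_add[symmetric]
            by (rule arg_cong[where f = "(powr) 2"]) (simp add: field_simps)
        qed
        have "ennreal (2 powr (- (real k * (?n * ?e)))) * lq_norm p (\<beta> k)
            = ennreal M * (ennreal (2 powr (- (real k * (?n * ?e))) * (1 / t ^ k)) * lq_norm p
              (\<lambda>l. ennreal (norm (lam k l))))"
          unfolding \<beta>_def[abs_def] lq_norm_cmult[OF p] using t
          by (subst ennreal_mult[of "2 powr (- (real k * (?n * ?e)))"]) (auto simp: mult_ac)
        also have "\<dots> = ennreal M * (ennreal (t ^ k) * (ennreal (2 powr (real k * (s - ?n * ?e)))
          * lq_norm p (\<lambda>l. ennreal (norm (lam k l)))))"
          unfolding tk using t by (subst ennreal_mult) (auto simp: mult.assoc)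
        also have "\<dots> \<le> ennreal M * (ennreal (t ^ k) * ?b)"
          by (intro mult_left_mono weighted_level_le_b_norm[OF q]) auto
        finally show "ennreal (2 powr (- (real k * (?n * ?e)))) * lq_norm p (\<beta> k)
          \<le> (ennreal M * ?b) * ennreal (t ^ k)"
          by (simp add: mult_ac)
      qed
      also have "\<dots> = (ennreal M * ?b) * lq_norm p (\<lambda>k. ennreal (t ^ k))"
        by (rule lq_norm_cmult[OF p])
      also have "\<dots> \<le> (ennreal M * ?b) * ennreal c"
        by (intro mult_left_mono c(2)) auto
      finally have "Lp_norm p (partial_sum lam b N) \<le> ennreal B * ((ennreal M * ?b) * ennreal c)"
        by (simp add: mult_left_mono)
      then show ?thesis using M c(1) by (simp add: ennreal_mult B_def mult_ac)
    qed
    have "Lp_norm p f \<le> ennreal C0 * (Lp_norm p (\<lambda>x. f x - partial_sum lam b N x) + ennreal (B * M * c)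
      * ?b)" for N
    proof -
      have ps: "partial_sum lam b N \<in> borel_measurable lebesgue"
        by (rule continuous_imp_lebesgue_measurable[OF partial_sum_continuous[OF D0 rgh]])
      have "Lp_norm p (\<lambda>x. (f x - partial_sum lam b N x) + partial_sum lam b N x)
          \<le> ennreal C0 * (Lp_norm p (\<lambda>x. f x - partial_sum lam b N x) + Lp_norm p (partial_sum lam b N))"
        by (intro C0(2) borel_measurable_diff f ps)
      also have "\<dots> \<le> ennreal C0 * (Lp_norm p (\<lambda>x. f x - partial_sum lam b N x) + ennreal (B * M * c) * ?b)"
        by (intro mult_left_mono add_left_mono bound) auto
      finally show ?thesis by simp
    qed
    moreover have "(\<lambda>N. ennreal C0 * (Lp_norm p (\<lambda>x. f x - partial_sum lam b N x) + ennreal (B * M * c) * ?b))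
        \<longlonglongrightarrow> ennreal C0 * (0 + ennreal (B * M * c) * ?b)"
      using ex unfolding Lp_expansion_iff
      by (intro tendsto_intros ennreal_tendsto_cmult) auto
    ultimately have "Lp_norm p f \<le> ennreal C0 * (0 + ennreal (B * M * c) * ?b)"
      by (intro LIMSEQ_le_const) auto
    also have "\<dots> = ennreal (C0 * (B * M * c)) * ?b"
      using C0(1) M c(1) by (subst ennreal_mult[of C0]) (auto simp: B_def mult.assoc)
    finally show "Lp_norm p f \<le> ennreal (C0 * (B * M * c)) * ?b" .
  qed
qed

section \<open>Smoothing of partial sums\<close>

lemma b_norm_mono:
  assumes "0 < p" "0 < q" "\<And>j m. norm (lam j m) \<le> norm (mu j m)"
  shows "b_norm s p q lam \<le> b_norm s p q mu"
  unfolding b_norm_eq using assms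
  by (intro lq_norm_mono mult_left_mono ennreal_leI) auto

lemma b_norm_cmult:
  assumes "0 < p" "0 < q"
  shows "b_norm s p q (\<lambda>j m. c * lam j m) = ennreal (norm c) * b_norm s p q lam"
  unfolding b_norm_eq using assms
  by (simp add: norm_mult ennreal_mult lq_norm_cmult mult.left_commute[of _ "ennreal (norm c)"])

text \<open>The operator \<open>T\<^sub>j\<close>.  It reproduces constants and is local.\<close>

definition quasi_interp :: "(real \<Rightarrow> real) \<Rightarrow> nat \<Rightarrow> (real^'n \<Rightarrow> complex) \<Rightarrow> real^'n \<Rightarrow> complex" where
  "quasi_interp \<eta> j u x = (\<Sum>\<^sub>\<infinity>m. u (node j m) * unity_part \<eta> 0 j m x)"

lemma near_node_dist: "m \<in> near E j z \<Longrightarrow> \<bar>node j m $ i - z $ i\<bar> \<le> E / 2 ^ j"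
  by (simp add: near_def dcube_iff abs_minus_commute)

text \<open>Near \<open>z\<close> the values of \<open>T\<^sub>j u - c\<close> only involve differences \<open>u - c\<close> at nodes near \<open>z\<close>.\<close>

lemma quasi_interp_minus_const:
  assumes \<eta>: "partition_profile k \<rho> B \<eta>" and \<rho>: "0 \<le> \<rho>" and R: "0 \<le> R"
    and x: "\<And>i. \<bar>x $ i - z $ i\<bar> \<le> R / 2 ^ j"
  shows "quasi_interp \<eta> j u x - c = (\<Sum>m\<in>near (\<rho> + R) j z. (u (node j m) - c) * unity_part \<eta> 0 j m x)"
proof -
  have "quasi_interp \<eta> j u x = (\<Sum>m\<in>near (\<rho> + R) j z. u (node j m) * unity_part \<eta> 0 j m x)"
    unfolding quasi_interp_def
    by (rule infsum_localized[OF _ x \<rho> R]) (use unity_part_support[OF \<eta>] in auto)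
  moreover have "(\<Sum>m\<in>near (\<rho> + R) j z. unity_part \<eta> 0 j m x) = 1"
    using \<rho> R in_near_shift[OF _ x] by (intro sum_pu_eq_1[OF \<eta> \<rho>] card_near_le) auto
  ultimately show ?thesis
    by (simp add: left_diff_distrib sum_subtractf flip: sum_distrib_left)
qed

lemma quasi_interp_continuous:
  assumes \<eta>: "partition_profile k \<rho> B \<eta>" and \<rho>: "0 \<le> \<rho>"
  shows "continuous_on UNIV (quasi_interp \<eta> j u)"
proof -
  have "continuous_on UNIV (\<lambda>x. \<Sum>\<^sub>\<infinity>m. u (node j m) * unity_part \<eta> 0 j m x)"
    using unity_part_support[OF \<eta>] smooth_bd_continuous[OF unity_part_smooth[OF \<eta>]] \<rho>
    by (intro continuous_on_locally_finite_sum[where D = \<rho> and k = j] continuous_intros) auto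
  then show ?thesis by (simp add: quasi_interp_def[abs_def])
qed

text \<open>The function \<open>h\<^sub>j\<close>.\<close>

definition increment ::
  "(real \<Rightarrow> real) \<Rightarrow> (nat \<Rightarrow> int^'n \<Rightarrow> complex) \<Rightarrow>
    (nat \<Rightarrow> int^'n \<Rightarrow> real^'n \<Rightarrow> complex) \<Rightarrow> nat \<Rightarrow> real^'n \<Rightarrow> complex" where
  "increment \<eta> lam b j x =
     quasi_interp \<eta> (Suc j) (partial_sum lam b (Suc j)) x - quasi_interp \<eta> j (partial_sum lam b j) x"

text \<open>The telescoping sum starts with \<open>P\<^sub>0 = 0\<close>.\<close>

lemma sum_increment:
  "(\<Sum>j<N. increment \<eta> lam b j x) = quasi_interp \<eta> N (partial_sum lam b N) x"
proof -
  have "quasi_interp \<eta> 0 (partial_sum lam b 0) x = 0"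
    by (simp add: quasi_interp_def partial_sum_def)
  then show ?thesis
    unfolding increment_def
    by (subst sum_lessThan_telescope) simp
qed

lemma sum_pu_increment:
  assumes "partition_profile k \<rho> B \<eta>" "0 \<le> \<rho>"
  shows "(\<Sum>\<^sub>\<infinity>m. unity_part \<eta> e j m x * v) = v"
proof -
  have "(\<Sum>\<^sub>\<infinity>m. unity_part \<eta> e j m x * v) = (\<Sum>m\<in>near \<rho> j x. unity_part \<eta> e j m x * v)"
    using assms unity_part_support[OF assms(1)] by (intro infsum_near) auto
  also have "\<dots> = v"
    using assms sum_pu_eq_1[OF assms card_near_le(1)[OF assms(2)], of x j j x e]
    by (simp add: near_def flip: sum_distrib_right)
  finally show ?thesis .
qed

text \<open>On the support of \<open>\<psi>\<^sub>j\<^sub>,\<^sub>m\<close> both interpolants in \<open>h\<^sub>j\<close> differ from the same constant \<open>P\<^sub>j(z)\<close>, \<open>z = 2\<^sup>-\<^sup>j m\<close>, by finite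
combinations of bumps, whose coefficients are oscillations of partial sums near \<open>z\<close>.  All nodes
involved lie within \<open>4 \<cdot> 2\<^sup>-\<^sup>j\<close> of \<open>z\<close>, and there are at most \<open>13\<^sup>n\<close> of each kind.\<close>

lemma increment_localized:
  fixes lam :: "nat \<Rightarrow> int^'n \<Rightarrow> complex" and b :: "nat \<Rightarrow> int^'n \<Rightarrow> real^'n \<Rightarrow> complex"
  assumes \<eta>: "partition_profile K \<rho> B \<eta>" and \<rho>: "0 \<le> \<rho>" "\<rho> \<le> 2"
    and D: "0 \<le> D" and rough: "\<And>k m. rough D A k m (b k m)"
  defines "\<Psi> \<equiv> (2 ^ K * B) ^ CARD('n)"
  shows "smooth_bd K (2 ^ j)
     (2 * 13 ^ CARD('n) * (2 ^ K * \<Psi> * (2 ^ K * \<Psi>)) * (A * (2 * real CARD('n) * 4 + 1)) * spread (D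
       + 4) lam j (node j m))
     (\<lambda>x. unity_part \<eta> e j m x * increment \<eta> lam b j x)"
proof -
  define z where "z = node j m"
  define T where "T = A * (2 * real CARD('n) * 4 + 1) * spread (D + 4) lam j z"
  define Q where "Q = 2 ^ K * \<Psi> * (2 ^ K * \<Psi>)"
  let ?P = "partial_sum lam b"
  let ?c = "?P j z"
  let ?S1 = "near (\<rho> + 4) (Suc j) z" and ?S0 = "near (\<rho> + 2) j z"
  have \<Psi>0: "0 \<le> \<Psi>"
    using smooth_bd_nonneg[OF unity_part_smooth[OF \<eta>, of j e m]] by (simp add: \<Psi>_def)
  have A0: "0 \<le> A" using rough[of 0 0] norm_ge_zero order_trans unfolding rough_def by blast
  have T0: "0 \<le> T" using A0 by (simp add: T_def spread_nonneg)
  have Q0: "0 \<le> Q" using \<Psi>0 by (simp add: Q_def)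
  have osc: "norm (?P i y - ?c) \<le> T" if "i = j \<or> i = Suc j" "\<And>i. \<bar>y $ i - z $ i\<bar> \<le> 4 / 2 ^ j" for i y
    unfolding T_def using that by (intro partial_sum_oscillation[OF D rough]) auto
  have c1: "norm (?P (Suc j) (node (Suc j) m') - ?c) \<le> T" if "m' \<in> ?S1" for m'
  proof (rule osc)
    fix i
    have "\<bar>node (Suc j) m' $ i - z $ i\<bar> \<le> (\<rho> + 4) / 2 ^ Suc j" by (rule near_node_dist[OF that])
    also have "\<dots> \<le> 4 / 2 ^ j" using \<rho> by (simp add: divide_simps)
    finally show "\<bar>node (Suc j) m' $ i - z $ i\<bar> \<le> 4 / 2 ^ j" .
  qed simp
  have c0: "norm (?P j (node j m') - ?c) \<le> T" if "m' \<in> ?S0" for m'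
  proof (rule osc)
    fix i
    have "\<bar>node j m' $ i - z $ i\<bar> \<le> (\<rho> + 2) / 2 ^ j" by (rule near_node_dist[OF that])
    also have "\<dots> \<le> 4 / 2 ^ j" using \<rho> by (simp add: divide_simps)
    finally show "\<bar>node j m' $ i - z $ i\<bar> \<le> 4 / 2 ^ j" .
  qed simp
  have card13: "real (card (near E k z)) \<le> 13 ^ CARD('n)" if "0 \<le> E" "E \<le> 6" for E k
  proof -
    have "real (card (near E k z)) \<le> (2 * E + 1) ^ CARD('n)" by (rule card_near_le[OF that(1)])
    also have "\<dots> \<le> 13 ^ CARD('n)" using that by (intro power_mono) auto
    finally show ?thesis .
  qed
  have s0: "smooth_bd K (2 ^ j) \<Psi> (unity_part \<eta> e j m)" for e and m :: "int^'n"
    unfolding \<Psi>_def by (rule unity_part_smooth[OF \<eta>])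
  have s1: "smooth_bd K (2 ^ j) (2 ^ K * \<Psi>) (unity_part \<eta> e (Suc j) m)" for e and m :: "int^'n"
    using unity_part_smooth[OF \<eta>, of "Suc j" e m] unfolding \<Psi>_def by (intro smooth_bd_scale) auto
  have "\<Psi> \<le> 2 ^ K * \<Psi>" using \<Psi>0 by (simp add: mult_right_mono[of 1 "2 ^ K" \<Psi>, simplified])
  then have s0': "smooth_bd K (2 ^ j) (2 ^ K * \<Psi>) (unity_part \<eta> e j m)" for e and m :: "int^'n"
    using s0 smooth_bd_mono by (meson zero_le_numeral zero_le_power)
  have combination: "smooth_bd K (2 ^ j) (13 ^ CARD('n) * Q * T) (\<lambda>x. \<Sum>m'\<in>S. g m' * (unity_part \<eta> e j m x
    * w m' x))"
    if S: "finite S" "real (card S) \<le> 13 ^ CARD('n)" and g: "\<And>m'. m' \<in> S \<Longrightarrow> norm (g m') \<le> T"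
      and w: "\<And>m'. smooth_bd K (2 ^ j) (2 ^ K * \<Psi>) (w m')"
    for S :: "(int^'n) set" and g :: "int^'n \<Rightarrow> complex" and w
  proof (rule smooth_bd_mono)
    show "smooth_bd K (2 ^ j) (\<Sum>m'\<in>S. norm (g m') * Q) (\<lambda>x. \<Sum>m'\<in>S. g m' * (unity_part \<eta> e j m x * w m' x))"
      unfolding Q_def by (intro smooth_bd_sum S smooth_bd_cmult smooth_bd_mult s0 w) simp
    have "(\<Sum>m'\<in>S. norm (g m') * Q) \<le> (\<Sum>m'\<in>S. T * Q)"
      using g Q0 by (intro sum_mono mult_right_mono)
    also have "\<dots> = real (card S) * (T * Q)" by simp
    also have "\<dots> \<le> 13 ^ CARD('n) * (T * Q)"
      using S(2) T0 Q0 by (intro mult_right_mono) auto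
    finally show "(\<Sum>m'\<in>S. norm (g m') * Q) \<le> 13 ^ CARD('n) * Q * T" by (simp add: mult_ac)
  qed simp
  have "smooth_bd K (2 ^ j) (13 ^ CARD('n) * Q * T + 13 ^ CARD('n) * Q * T)
    (\<lambda>x. (\<Sum>m'\<in>?S1. (?P (Suc j) (node (Suc j) m') - ?c) * (unity_part \<eta> e j m x * unity_part \<eta> 0 (Suc j) m' x))
       + (\<Sum>m'\<in>?S0. (- (?P j (node j m') - ?c)) * (unity_part \<eta> e j m x * unity_part \<eta> 0 j m' x)))"
    using \<rho> c0 by (intro smooth_bd_add combination card13 card_near_le c1 s1 s0')
      (auto simp: norm_minus_commute)
  then have "smooth_bd K (2 ^ j) (13 ^ CARD('n) * Q * T + 13 ^ CARD('n) * Q * T) (\<lambda>x. unity_part \<eta> e j m x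
    * increment \<eta> lam b j x)"
  proof (rule smooth_bd_cong)
    fix x
    show "(\<Sum>m'\<in>?S1. (?P (Suc j) (node (Suc j) m') - ?c) * (unity_part \<eta> e j m x * unity_part \<eta> 0 (Suc j) m' x))
       + (\<Sum>m'\<in>?S0. (- (?P j (node j m') - ?c)) * (unity_part \<eta> e j m x * unity_part \<eta> 0 j m' x))
         = unity_part \<eta> e j m x * increment \<eta> lam b j x"
    proof (cases "unity_part \<eta> e j m x = 0")
      case False
      then have "x \<in> dcube \<rho> j m" by (rule unity_part_support[OF \<eta>])
      then have xz: "\<bar>x $ i - z $ i\<bar> \<le> \<rho> / 2 ^ j" for i by (simp add: dcube_iff z_def)
      have "\<rho> / 2 ^ j \<le> 2 / 2 ^ j" using \<rho> by (simp add: divide_right_mono)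
      with xz have x0: "\<bar>x $ i - z $ i\<bar> \<le> 2 / 2 ^ j" for i by (meson order_trans)
      then have x1: "\<bar>x $ i - z $ i\<bar> \<le> 4 / 2 ^ Suc j" for i by simp
      have "increment \<eta> lam b j x
        = (quasi_interp \<eta> (Suc j) (?P (Suc j)) x - ?c) - (quasi_interp \<eta> j (?P j) x - ?c)"
        by (simp add: increment_def)
      also have "quasi_interp \<eta> (Suc j) (?P (Suc j)) x - ?c
        = (\<Sum>m'\<in>?S1. (?P (Suc j) (node (Suc j) m') - ?c) * unity_part \<eta> 0 (Suc j) m' x)"
        using x1 by (intro quasi_interp_minus_const[OF \<eta> \<rho>(1)]) auto
      also have "quasi_interp \<eta> j (?P j) x - ?c = (\<Sum>m'\<in>?S0. (?P j (node j m') - ?c) * unity_part \<eta> 0 j m' x)"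
        using x0 by (intro quasi_interp_minus_const[OF \<eta> \<rho>(1)]) auto
      finally show ?thesis
        by (simp add: right_diff_distrib sum_distrib_left sum_negf[symmetric] mult_ac)
    qed simp
  qed
  then show ?thesis
    by (simp add: Q_def T_def z_def mult_ac)
qed

text \<open>\<open>T\<^sub>N P\<^sub>N - P\<^sub>N\<close> at \<open>x\<close> is a combination, with bounded weights, of differences \<open>P\<^sub>N(y) - P\<^sub>N(x)\<close> for
nodes \<open>y\<close> at distance \<open>O(2\<^sup>-\<^sup>N)\<close>.\<close>

lemma quasi_interp_error:
  fixes lam :: "nat \<Rightarrow> int^'n \<Rightarrow> complex" and b :: "nat \<Rightarrow> int^'n \<Rightarrow> real^'n \<Rightarrow> complex"
  assumes \<eta>: "partition_profile K \<rho> B \<eta>" and \<rho>: "0 \<le> \<rho>" "\<rho> \<le> 2"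
    and D: "0 \<le> D" and rough: "\<And>k m. rough D A k m (b k m)"
    and x: "x \<in> dcube 1 N m"
  defines "\<Psi> \<equiv> (2 ^ K * B) ^ CARD('n)"
  shows "norm (quasi_interp \<eta> N (partial_sum lam b N) x - partial_sum lam b N x)
    \<le> 13 ^ CARD('n) * \<Psi> * (A * (2 * real CARD('n) * 4 + 1)) * spread (D + 4) lam N (node N m)"
proof -
  define z where "z = node N m"
  define T where "T = A * (2 * real CARD('n) * 4 + 1) * spread (D + 4) lam N z"
  let ?P = "partial_sum lam b N"
  have A0: "0 \<le> A" using rough[of 0 0] norm_ge_zero order_trans unfolding rough_def by blast
  have T0: "0 \<le> T" using A0 by (simp add: T_def spread_nonneg)
  have unity_part: "norm (unity_part \<eta> 0 N m x) \<le> \<Psi>" for m :: "int^'n" and x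
    using smooth_bd_bound[OF unity_part_smooth[OF \<eta>]] by (simp add: \<Psi>_def)
  then have \<Psi>0: "0 \<le> \<Psi>" using norm_ge_zero order_trans by blast
  have xz: "\<bar>x $ i - z $ i\<bar> \<le> 2 / 2 ^ N" for i
  proof -
    have "\<bar>x $ i - z $ i\<bar> \<le> 1 / 2 ^ N" using x by (simp add: dcube_iff z_def)
    also have "\<dots> \<le> 2 / 2 ^ N" by (simp add: divide_right_mono)
    finally show ?thesis .
  qed
  have "norm (?P (node N m') - ?P x) \<le> T" if "m' \<in> near (\<rho> + 2) N z" for m'
    unfolding T_def
  proof (rule partial_sum_oscillation[OF D rough])
    show "\<bar>x $ i - z $ i\<bar> \<le> 4 / 2 ^ N" for i
      using xz[of i] by (rule order_trans) (simp add: divide_right_mono)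
    show "\<bar>node N m' $ i - z $ i\<bar> \<le> 4 / 2 ^ N" for i
      using near_node_dist[OF that, of i] by (rule order_trans) (use \<rho> in \<open>simp add: divide_right_mono\<close>)
  qed auto
  then have "norm (quasi_interp \<eta> N ?P x - ?P x) \<le> (\<Sum>m'\<in>near (\<rho> + 2) N z. T * \<Psi>)"
    unfolding quasi_interp_minus_const[OF \<eta> \<rho>(1) _ xz, simplified]
    using T0 unity_part by (intro sum_norm_le) (auto simp: norm_mult intro!: mult_mono)
  also have "\<dots> = real (card (near (\<rho> + 2) N z)) * (T * \<Psi>)" by simp
  also have "\<dots> \<le> 13 ^ CARD('n) * (T * \<Psi>)"
  proof (rule mult_right_mono)
    have "real (card (near (\<rho> + 2) N z)) \<le> (2 * (\<rho> + 2) + 1) ^ CARD('n)"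
      using \<rho> by (intro card_near_le) auto
    also have "\<dots> \<le> 13 ^ CARD('n)" using \<rho> by (intro power_mono) auto
    finally show "real (card (near (\<rho> + 2) N z)) \<le> 13 ^ CARD('n)" .
  qed (use T0 \<Psi>0 in auto)
  finally show ?thesis by (simp add: T_def z_def mult_ac)
qed

text \<open>The increments \<open>h\<^sub>j\<close> have the required local bounds by \<open>increment_localized\<close>.  For the convergence,
\<open>quasi_interp_error\<close> and the fact that \<open>\<nu>\<close> belongs to the sequence space show that \<open>T\<^sub>N P\<^sub>N - P\<^sub>N\<close> is \<open>O(2\<^sup>-\<^sup>N\<^sup>s)\<close>
in \<open>L\<^sub>p\<close>.\<close>

theorem smooth_decomposition:
  fixes s D A :: real and q p :: ennreal
  assumes p: "0 < p" and q: "0 < q" and s: "0 < s" "s < 1" and D: "0 \<le> D" and A: "0 \<le> A"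
    and \<eta>: "partition_profile K \<rho> B \<eta>" and \<rho>: "0 \<le> \<rho>" "\<rho> \<le> 2"
  shows "\<exists>C>0::real. \<forall>(f :: real^'n \<Rightarrow> complex) lam b.
     f \<in> borel_measurable lebesgue \<longrightarrow> (\<forall>k m. rough D A k m (b k m)) \<longrightarrow> lam \<in> b_space s p q
       \<longrightarrow> Lp_expansion p f lam b \<longrightarrow>
     (\<exists>(mu :: nat \<Rightarrow> int^'n \<Rightarrow> real) h. (\<forall>j m. 0 \<le> mu j m) \<and>
        b_norm s p q (\<lambda>j m. complex_of_real (mu j m)) \<le> ennreal C * b_norm s p q lam \<and>
        (\<forall>e j m. smooth_bd K (2 ^ j) (mu j m) (\<lambda>x. unity_part \<eta> e j m x * h j x)) \<and>
        (\<lambda>N. Lp_norm p (\<lambda>x. f x - (\<Sum>j<N. h j x))) \<longlonglongrightarrow> 0)"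
proof -
  let ?n = "real CARD('n)" and ?e = "enn2real (1 / p)"
  define \<Psi> where "\<Psi> = (2 ^ K * B) ^ CARD('n)"
  have \<Psi>0: "0 \<le> \<Psi>"
    using smooth_bd_nonneg[OF unity_part_smooth[OF \<eta>, of 0 0 "0 :: int^'n"]] by (simp add: \<Psi>_def)
  define C1 where "C1 = 2 * 13 ^ CARD('n) * (2 ^ K * \<Psi> * (2 ^ K * \<Psi>)) * (A * (2 * ?n * 4 + 1))"
  define C2 where "C2 = 13 ^ CARD('n) * \<Psi> * (A * (2 * ?n * 4 + 1))"
  have C12: "0 \<le> C1" "0 \<le> C2" using \<Psi>0 A by (simp_all add: C1_def C2_def)
  have D4: "0 \<le> D + 4" using D by simp
  obtain C3 where C3: "0 < C3" "\<And>(lam :: nat \<Rightarrow> int^'n \<Rightarrow> complex) nu.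
     (\<forall>j m. norm (nu j m) \<le> spread (D + 4) lam j (node j m)) \<Longrightarrow> b_norm s p q nu \<le> ennreal C3 * b_norm s p q lam"
    using b_norm_spread_le[OF p q s(2) D4, where 'n = 'n] by blast
  obtain C0 where C0: "0 < C0" "\<And>f g. f \<in> borel_measurable lebesgue \<Longrightarrow> g \<in> borel_measurable lebesgue \<Longrightarrow>
           Lp_norm p (\<lambda>x::real^'n. f x + g x) \<le> ennreal C0 * (Lp_norm p f + Lp_norm p g)"
    using Lp_norm_triangle[OF p, where 'n = 'n] by blast
  show ?thesis
  proof (intro exI[of _ "(C1 + 1) * C3"] conjI allI impI)
    \<comment> \<open>\<open>C1\<close> may vanish, hence \<open>C1 + 1\<close>.\<close>
    show "0 < (C1 + 1) * C3" using C12 C3 by simp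
    fix f :: "real^'n \<Rightarrow> complex" and lam b
    assume f: "f \<in> borel_measurable lebesgue" and rough: "\<forall>k m. rough D A k m (b k m)"
      and lam: "lam \<in> b_space s p q" and ex: "Lp_expansion p f lam b"
    have rgh: "rough D A k m (b k m)" for k m using rough by blast
    define nu where "nu j m = complex_of_real (spread (D + 4) lam j (node j m))" for j m
    have nu: "b_norm s p q nu \<le> ennreal C3 * b_norm s p q lam"
      by (rule C3(2)) (simp add: nu_def spread_nonneg)
    have lam_fin: "b_norm s p q lam < \<infinity>" using lam by (simp add: b_space_def)
    with nu have nu_fin: "b_norm s p q nu < top"
      by (metis ennreal_less_top ennreal_mult_less_top infinity_ennreal_def le_less_trans)
    define mu where "mu j m = C1 * spread (D + 4) lam j (node j m)" for j m
    let ?P = "partial_sum lam b" and ?T = "\<lambda>N. quasi_interp \<eta> N (partial_sum lam b N)"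
    have P_meas: "?P N \<in> borel_measurable lebesgue" for N
      by (rule continuous_imp_lebesgue_measurable[OF partial_sum_continuous[OF D rgh]])
    have T_meas: "?T N \<in> borel_measurable lebesgue" for N
      by (rule continuous_imp_lebesgue_measurable[OF quasi_interp_continuous[OF \<eta> \<rho>(1)]])
    define M where "M = 2 powr (?n * ?e) * C2"
    have err: "Lp_norm p (\<lambda>x. ?P N x - ?T N x) \<le> ennreal (M * (2 powr - s) ^ N) * b_norm s p q nu" for N
    proof -
      define \<beta> where "\<beta> k l = (if k = N then ennreal C2 * ennreal (norm (nu N l)) else 0)" for k l
      have "Lp_norm p (\<lambda>x. ?P N x - ?T N x) \<le> ennreal ((2 * 1) powr (?n * ?e)) *
          lq_norm p (\<lambda>k. ennreal (2 powr (- (real k * (?n * ?e)))) * lq_norm p (\<beta> k))"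
      proof (rule Lp_norm_cubes[OF p])
        show "(\<lambda>x. ?P N x - ?T N x) \<in> borel_measurable lebesgue"
          by (rule borel_measurable_diff[OF P_meas T_meas])
        fix x :: "real^'n"
        obtain m where m: "x \<in> dcube 1 N m" using dcube_cover by blast
        have "norm (?P N x - ?T N x) \<le> C2 * spread (D + 4) lam N (node N m)"
          using quasi_interp_error[OF \<eta> \<rho> D rgh m, of lam] by (simp add: C2_def \<Psi>_def norm_minus_commute)
        then have "ennreal (norm (?P N x - ?T N x)) \<le> ennreal (C2 * spread (D + 4) lam N (node N m))"
          by (rule ennreal_leI)
        also have "\<dots> = indicator (dcube 1 N m) x * \<beta> N m"
          using m C12 by (simp add: \<beta>_def nu_def spread_nonneg ennreal_mult)
        also have "\<dots> \<le> (SUP (k, l). indicator (dcube 1 k l) x * \<beta> k l)"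
          by (intro SUP_upper2[of "(N, m)"]) auto
        finally show "ennreal (norm (?P N x - ?T N x)) \<le> (SUP (k, l). indicator (dcube 1 k l) x * \<beta> k l)" .
      qed simp
      also have "(\<lambda>k. ennreal (2 powr (- (real k * (?n * ?e)))) * lq_norm p (\<beta> k))
          = (\<lambda>k. if k = N then ennreal (2 powr (- (real N * (?n * ?e)))) * (ennreal C2 * lq_norm p
            (\<lambda>l. ennreal (norm (nu N l)))) else 0)"
        using p by (auto simp: \<beta>_def[abs_def] fun_eq_iff lq_norm_cmult)
      also have "lq_norm p \<dots>
        = ennreal (2 powr (- (real N * (?n * ?e)))) * (ennreal C2 * lq_norm p (\<lambda>l. ennreal (norm (nu N l))))"
        by (rule lq_norm_single[OF p])
      also have "2 powr (- (real N * (?n * ?e))) = (2 powr - s) ^ N * 2 powr (real N * (s - ?n * ?e))"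
      proof -
        have pw: "(2 powr - s) ^ N = 2 powr (real N * (- s))"
          by (simp add: powr_powr mult.commute flip: powr_realpow)
        show ?thesis unfolding pw powr_add[symmetric]
          by (rule arg_cong[where f = "(powr) 2"]) (simp add: field_simps)
      qed
      also have "ennreal ((2 * 1) powr (?n * ?e)) * (ennreal ((2 powr - s) ^ N * 2 powr (real N * (s - ?n
        * ?e))) *
            (ennreal C2 * lq_norm p (\<lambda>l. ennreal (norm (nu N l)))))
          = ennreal (M * (2 powr - s) ^ N) * (ennreal (2 powr (real N * (s - ?n * ?e))) * lq_norm p
            (\<lambda>l. ennreal (norm (nu N l))))"
        using C12 by (simp add: M_def ennreal_mult mult_ac)
      also have "\<dots> \<le> ennreal (M * (2 powr - s) ^ N) * b_norm s p q nu"
        by (intro mult_left_mono weighted_level_le_b_norm[OF q]) auto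
      finally show ?thesis .
    qed
    have le: "Lp_norm p (\<lambda>x. f x - ?T N x)
      \<le> ennreal C0 * (Lp_norm p (\<lambda>x. f x - ?P N x) + ennreal (M * (2 powr - s) ^ N) * b_norm s p q nu)" for N
    proof -
      have "Lp_norm p (\<lambda>x. (f x - ?P N x) + (?P N x - ?T N x))
        \<le> ennreal C0 * (Lp_norm p (\<lambda>x. f x - ?P N x) + Lp_norm p (\<lambda>x. ?P N x - ?T N x))"
        by (intro C0(2) borel_measurable_diff f P_meas T_meas)
      also have "\<dots> \<le> ennreal C0 * (Lp_norm p (\<lambda>x. f x - ?P N x) + ennreal (M * (2 powr - s) ^ N)
        * b_norm s p q nu)"
        by (intro mult_left_mono add_left_mono err) auto
      finally show ?thesis by simp
    qed
    have "(\<lambda>N. M * (2 powr - s) ^ N) \<longlonglongrightarrow> M * 0"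
      using s by (intro tendsto_intros LIMSEQ_power_zero) (auto simp: powr_less_one)
    then have "(\<lambda>N. ennreal (M * (2 powr - s) ^ N)) \<longlonglongrightarrow> ennreal (M * 0)" by (rule tendsto_ennrealI)
    then have lim0: "(\<lambda>N. b_norm s p q nu * ennreal (M * (2 powr - s) ^ N)) \<longlonglongrightarrow> b_norm s p q nu * ennreal (M * 0)"
      by (rule ennreal_tendsto_cmult[OF nu_fin])
    have "(\<lambda>N. ennreal C0 * (Lp_norm p (\<lambda>x. f x - ?P N x) + b_norm s p q nu * ennreal (M * (2 powr - s) ^ N)))
        \<longlonglongrightarrow> ennreal C0 * (0 + b_norm s p q nu * ennreal (M * 0))"
      using ex unfolding Lp_expansion_iff
      by (intro ennreal_tendsto_cmult[OF ennreal_less_top] tendsto_add[OF _ lim0])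
    then have upper: "(\<lambda>N. ennreal C0 * (Lp_norm p (\<lambda>x. f x - ?P N x) + ennreal (M * (2 powr - s) ^ N)
      * b_norm s p q nu)) \<longlonglongrightarrow> 0"
      by (simp add: mult.commute[of "b_norm s p q nu"])
    have lim: "(\<lambda>N. Lp_norm p (\<lambda>x. f x - ?T N x)) \<longlonglongrightarrow> 0"
    proof (rule tendsto_sandwich[OF _ _ tendsto_const upper])
      show "\<forall>\<^sub>F N in sequentially. 0 \<le> Lp_norm p (\<lambda>x. f x - ?T N x)" by simp
      show "\<forall>\<^sub>F N in sequentially. Lp_norm p (\<lambda>x. f x - ?T N x)
          \<le> ennreal C0 * (Lp_norm p (\<lambda>x. f x - ?P N x) + ennreal (M * (2 powr - s) ^ N) * b_norm s p q nu)"
        by (rule always_eventually) (rule allI, rule le)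
    qed
    show "\<exists>(mu :: nat \<Rightarrow> int^'n \<Rightarrow> real) h. (\<forall>j m. 0 \<le> mu j m) \<and>
        b_norm s p q (\<lambda>j m. complex_of_real (mu j m)) \<le> ennreal ((C1 + 1) * C3) * b_norm s p q lam \<and>
        (\<forall>e j m. smooth_bd K (2 ^ j) (mu j m) (\<lambda>x. unity_part \<eta> e j m x * h j x)) \<and>
        (\<lambda>N. Lp_norm p (\<lambda>x. f x - (\<Sum>j<N. h j x))) \<longlonglongrightarrow> 0"
    proof (intro exI[of _ mu] exI[of _ "increment \<eta> lam b"] conjI allI)
      show "0 \<le> mu j m" for j m using C12 by (simp add: mu_def spread_nonneg)
      have "(\<lambda>j m. complex_of_real (mu j m)) = (\<lambda>j m. complex_of_real C1 * nu j m)"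
        by (simp add: mu_def nu_def fun_eq_iff)
      then have "b_norm s p q (\<lambda>j m. complex_of_real (mu j m)) = ennreal C1 * b_norm s p q nu"
        using C12 by (simp add: b_norm_cmult[OF p q])
      also have "\<dots> \<le> ennreal (C1 + 1) * (ennreal C3 * b_norm s p q lam)"
        using nu by (intro mult_mono ennreal_leI) auto
      also have "\<dots> = ennreal ((C1 + 1) * C3) * b_norm s p q lam"
        using C12 C3(1) by (subst ennreal_mult) (auto simp: mult.assoc)
      finally show "b_norm s p q (\<lambda>j m. complex_of_real (mu j m))
        \<le> ennreal ((C1 + 1) * C3) * b_norm s p q lam" .
      show "smooth_bd K (2 ^ j) (mu j m) (\<lambda>x. unity_part \<eta> e j m x * increment \<eta> lam b j x)" for e j m
        using increment_localized[OF \<eta> \<rho> D rgh, of j lam m e] by (simp add: mu_def C1_def \<Psi>_def)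
      show "(\<lambda>N. Lp_norm p (\<lambda>x. f x - (\<Sum>j<N. increment \<eta> lam b j x))) \<longlonglongrightarrow> 0"
        unfolding sum_increment by (rule lim)
    qed
  qed
qed

section \<open>From rough atoms to smooth atoms and to Lipschitz atoms\<close>

lemma CARD_ge_1: "1 \<le> real CARD('n::finite)"
  by (simp add: Suc_leI)

lemma supp_subset: "(\<And>x. a x \<noteq> 0 \<Longrightarrow> x \<in> dcube d j m) \<Longrightarrow> supp a \<subseteq> dcube d j m"
  unfolding supp_def by (intro closure_minimal closed_dcube) auto

lemma supp_subset_D: "supp a \<subseteq> dcube d j m \<Longrightarrow> a x \<noteq> 0 \<Longrightarrow> x \<in> dcube d j m"
  unfolding supp_def using closure_subset[of "{x. a x \<noteq> 0}"] by blast

lemma K_atom_rough: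
  fixes a :: "real^'n \<Rightarrow> complex"
  assumes "K_atom d K j m a" "1 \<le> K"
  shows "rough d (real CARD('n)) j m a"
proof -
  have "x \<in> dcube d j m" if "a x \<noteq> 0" for x
    using assms(1) that by (auto simp: K_atom_def dest: supp_subset_D)
  moreover have "norm (a x) \<le> real CARD('n)" for x
    using K_atom_lipschitz(1)[OF assms] CARD_ge_1[where 'n = 'n] by (rule order_trans)
  ultimately show ?thesis using K_atom_lipschitz(2)[OF assms] by (simp add: rough_def)
qed

lemma Lip_atom_rough:
  fixes a :: "real^'n \<Rightarrow> real"
  assumes "Lip_atom d j m a"
  shows "rough d 1 j m (\<lambda>x. complex_of_real (a x))"
proof -
  have "x \<in> dcube d j m" if "a x \<noteq> 0" for x
    using assms that by (auto simp: Lip_atom_def dest: supp_subset_D)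
  then show ?thesis using assms
    by (simp add: rough_def Lip_atom_def norm_of_real flip: of_real_diff)
qed

text \<open>The coefficients are the bounds \<open>mu\<close> of the pieces of \<open>h\<^sub>j\<close>.  Where \<open>mu\<close> vanishes so does the piece, and division by
zero gives the zero atom.\<close>

theorem K_rep_of_rough:
  fixes s D A d :: real and p q :: ennreal
  assumes p: "0 < p" and q: "0 < q" and s: "0 < s" "s < 1" and D: "0 \<le> D" and A: "0 \<le> A"
    and d: "1 < d"
  shows "\<exists>C>0::real. \<forall>(f :: real^'n \<Rightarrow> complex) lam b.
     f \<in> borel_measurable lebesgue \<longrightarrow> (\<forall>k m. rough D A k m (b k m)) \<longrightarrow> lam \<in> b_space s p q
       \<longrightarrow> Lp_expansion p f lam b \<longrightarrow>
     (\<exists>lam' a. K_rep d K s p q f lam' a \<and> b_norm s p q lam' \<le> ennreal C * b_norm s p q lam)"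
proof -
  define \<rho> where "\<rho> = min d 2"
  have \<rho>: "1 < \<rho>" "\<rho> \<le> 2" "\<rho> \<le> d" "0 \<le> \<rho>" using d by (auto simp: \<rho>_def)
  obtain B \<eta> where \<eta>: "partition_profile K \<rho> B \<eta>" using partition_profile_exists[OF \<rho>(1,2)] by blast
  obtain C where C: "0 < C" and dec: "\<forall>(f :: real^'n \<Rightarrow> complex) lam b.
     f \<in> borel_measurable lebesgue \<longrightarrow> (\<forall>k m. rough D A k m (b k m)) \<longrightarrow> lam \<in> b_space s p q
       \<longrightarrow> Lp_expansion p f lam b \<longrightarrow>
     (\<exists>(mu :: nat \<Rightarrow> int^'n \<Rightarrow> real) h. (\<forall>j m. 0 \<le> mu j m) \<and>
        b_norm s p q (\<lambda>j m. complex_of_real (mu j m)) \<le> ennreal C * b_norm s p q lam \<and>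
        (\<forall>e j m. smooth_bd K (2 ^ j) (mu j m) (\<lambda>x. unity_part \<eta> e j m x * h j x)) \<and>
        (\<lambda>N. Lp_norm p (\<lambda>x. f x - (\<Sum>j<N. h j x))) \<longlonglongrightarrow> 0)"
    using smooth_decomposition[OF p q s D A \<eta> \<rho>(4,2), where 'n = 'n] by (elim exE conjE) (rule that)
  show ?thesis
  proof (intro exI[of _ C] conjI allI impI C)
    fix f :: "real^'n \<Rightarrow> complex" and lam b
    assume "f \<in> borel_measurable lebesgue" "\<forall>k m. rough D A k m (b k m)" "lam \<in> b_space s p q"
      "Lp_expansion p f lam b"
    note fin = \<open>lam \<in> b_space s p q\<close>
    obtain mu h where mu0: "\<And>j m. 0 \<le> mu j m"
      and mu: "b_norm s p q (\<lambda>j m. complex_of_real (mu j m)) \<le> ennreal C * b_norm s p q lam"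
      and sm: "\<And>e j m. smooth_bd K (2 ^ j) (mu j m) (\<lambda>x. unity_part \<eta> e j m x * h j x)"
      and lim: "(\<lambda>N. Lp_norm p (\<lambda>x. f x - (\<Sum>j<N. h j x))) \<longlonglongrightarrow> 0"
      using dec[THEN spec, THEN spec, THEN spec, THEN mp, THEN mp, THEN mp, THEN mp,
          OF \<open>f \<in> borel_measurable lebesgue\<close> \<open>\<forall>k m. rough D A k m (b k m)\<close> fin \<open>Lp_expansion p f lam b\<close>]
      by blast
    define a where "a j m x = (1 / complex_of_real (mu j m)) * (unity_part \<eta> 0 j m x * h j x)" for j m x
    have "K_atom d K j m (a j m)" for j m
    proof -
      have "smooth_bd K (2 ^ j) (norm (1 / complex_of_real (mu j m)) * mu j m) (a j m)"
        unfolding a_def by (rule smooth_bd_cmult[OF sm])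
      then have sa: "smooth_bd K (2 ^ j) 1 (a j m)"
        by (rule smooth_bd_mono) (auto simp: norm_divide mu0)
      have "a j m x \<noteq> 0 \<Longrightarrow> x \<in> dcube d j m" for x
        using unity_part_support[OF \<eta>, of 0 j m x] dcube_mono[OF \<rho>(3), of j m] by (auto simp: a_def)
      then have "supp (a j m) \<subseteq> dcube d j m" by (rule supp_subset)
      with sa smooth_bd_multi_deriv[OF sa] show ?thesis
        by (auto simp: K_atom_def smooth_bd_imp_cont_diff mult.commute[of _ j] power_mult)
    qed
    moreover have "(\<lambda>j m. complex_of_real (mu j m)) \<in> b_space s p q"
      using fin mu by (auto simp: b_space_def ennreal_mult_less_top elim!: le_less_trans)
    moreover have "Lp_expansion p f (\<lambda>j m. complex_of_real (mu j m)) a"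
    proof -
      have "complex_of_real (mu j m) * a j m x = unity_part \<eta> 0 j m x * h j x" for j m x
      proof (cases "mu j m = 0")
        case True
        then show ?thesis using smooth_bd_bound[OF sm[of j m 0], of x] by simp
      qed (simp add: a_def)
      then show ?thesis using lim by (simp add: Lp_expansion_def sum_pu_increment[OF \<eta> \<rho>(4)])
    qed
    ultimately show "\<exists>lam' a. K_rep d K s p q f lam' a \<and> b_norm s p q lam' \<le> ennreal C * b_norm s p q lam"
      using mu unfolding K_rep_def by blast
  qed
qed

text \<open>A derivative bound \<open>2\<^sup>j\<close> for each coordinate gives the Lipschitz constant \<open>n 2\<^sup>j\<close>, whence the factor \<open>n\<close> in the
coefficients.  Real parts occupy the indices in \<open>2\<int>\<^sup>n\<close>, imaginary parts those in \<open>2\<int>\<^sup>n + (1, \<dots>, 1)\<close>; at the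
remaining indices the atom is zero.\<close>

theorem Lip_rep_of_rough:
  fixes s D A d :: real and p q :: ennreal
  assumes p: "0 < p" and q: "0 < q" and s: "0 < s" "s < 1" and D: "0 \<le> D" and A: "0 \<le> A"
    and d: "1 < d"
  shows "\<exists>C>0::real. \<forall>(f :: real^'n \<Rightarrow> complex) lam b.
     f \<in> borel_measurable lebesgue \<longrightarrow> (\<forall>k m. rough D A k m (b k m)) \<longrightarrow> lam \<in> b_space s p q
       \<longrightarrow> Lp_expansion p f lam b \<longrightarrow>
     (\<exists>lam' a. Lip_rep d s p q f lam' a \<and> b_norm s p q lam' \<le> ennreal C * b_norm s p q lam)"
proof -
  let ?n = "real CARD('n)"
  define \<rho> where "\<rho> = min d 2"
  have \<rho>: "1 < \<rho>" "\<rho> \<le> 2" "\<rho> \<le> d" "0 \<le> \<rho>" using d by (auto simp: \<rho>_def)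
  obtain B \<eta> where \<eta>: "partition_profile 1 \<rho> B \<eta>" using partition_profile_exists[OF \<rho>(1,2)] by blast
  obtain C where C: "0 < C" and dec: "\<forall>(f :: real^'n \<Rightarrow> complex) lam b.
     f \<in> borel_measurable lebesgue \<longrightarrow> (\<forall>k m. rough D A k m (b k m)) \<longrightarrow> lam \<in> b_space s p q
       \<longrightarrow> Lp_expansion p f lam b \<longrightarrow>
     (\<exists>(mu :: nat \<Rightarrow> int^'n \<Rightarrow> real) h. (\<forall>j m. 0 \<le> mu j m) \<and>
        b_norm s p q (\<lambda>j m. complex_of_real (mu j m)) \<le> ennreal C * b_norm s p q lam \<and>
        (\<forall>e j m. smooth_bd 1 (2 ^ j) (mu j m) (\<lambda>x. unity_part \<eta> e j m x * h j x)) \<and>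
        (\<lambda>N. Lp_norm p (\<lambda>x. f x - (\<Sum>j<N. h j x))) \<longlonglongrightarrow> 0)"
    using smooth_decomposition[OF p q s D A \<eta> \<rho>(4,2), where 'n = 'n] by (elim exE conjE) (rule that)
  show ?thesis
  proof (intro exI[of _ "?n * C"] conjI allI impI)
    show "0 < ?n * C" using C by simp
    fix f :: "real^'n \<Rightarrow> complex" and lam b
    assume "f \<in> borel_measurable lebesgue" "\<forall>k m. rough D A k m (b k m)" "lam \<in> b_space s p q"
      "Lp_expansion p f lam b"
    note fin = \<open>lam \<in> b_space s p q\<close>
    obtain mu h where mu0: "\<And>j m. 0 \<le> mu j m"
      and mu: "b_norm s p q (\<lambda>j m. complex_of_real (mu j m)) \<le> ennreal C * b_norm s p q lam"
      and sm: "\<And>e j m. smooth_bd 1 (2 ^ j) (mu j m) (\<lambda>x. unity_part \<eta> e j m x * h j x)"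
      and lim: "(\<lambda>N. Lp_norm p (\<lambda>x. f x - (\<Sum>j<N. h j x))) \<longlonglongrightarrow> 0"
      using dec[THEN spec, THEN spec, THEN spec, THEN mp, THEN mp, THEN mp, THEN mp,
          OF \<open>f \<in> borel_measurable lebesgue\<close> \<open>\<forall>k m. rough D A k m (b k m)\<close> fin \<open>Lp_expansion p f lam b\<close>]
      by blast
    define lam' where "lam' j m = (if m \<in> range (coset 0) then 1 else \<i>) * complex_of_real (?n * mu j m)"
      for j m
    define a where "a j m x
      = (if m \<in> range (coset 0) then Re (unity_part \<eta> 0 j m x * h j x) else Im (unity_part \<eta> 1 j m x
        * h j x)) / (?n * mu j m)"
      for j m x
    have "Lip_atom d j m (a j m)" for j m
    proof -
      define e where "e = (if m \<in> range (coset 0) then 0 else 1 :: int)"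
      define u where "u x = unity_part \<eta> e j m x * h j x" for x
      have u: "smooth_bd 1 (2 ^ j) (mu j m) u" unfolding u_def by (rule sm)
      have a1: "\<bar>a j m x\<bar> \<le> norm (u x) / (?n * mu j m)" for x
        using mu0[of j m] abs_Re_le_cmod[of "u x"] abs_Im_le_cmod[of "u x"]
        by (auto simp: a_def u_def e_def abs_mult divide_right_mono)
      have a2: "\<bar>a j m x - a j m y\<bar> \<le> norm (u x - u y) / (?n * mu j m)" for x y
        using mu0[of j m] abs_Re_le_cmod[of "u x - u y"] abs_Im_le_cmod[of "u x - u y"]
        by (auto simp: a_def u_def e_def abs_mult divide_right_mono simp flip: diff_divide_distrib)
      have bd: "\<bar>a j m x\<bar> \<le> 1" for x
      proof (rule order_trans[OF a1])
        have "norm (u x) \<le> mu j m" by (rule smooth_bd_bound[OF u])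
        also have "\<dots> \<le> ?n * mu j m" using mult_right_mono[OF CARD_ge_1[where 'n = 'n] mu0[of j m]] by simp
        finally show "norm (u x) / (?n * mu j m) \<le> 1" by (cases "mu j m = 0") (use mu0[of j m]
          in \<open>simp_all add: divide_le_eq_1 zero_less_mult_iff\<close>)
      qed
      have lip: "\<bar>a j m x - a j m y\<bar> \<le> 2 ^ j * norm (x - y)" for x y
      proof (rule order_trans[OF a2])
        have "norm (u x - u y) \<le> ?n * (mu j m * 2 ^ j) * norm (x - y)" by (rule smooth_bd_lipschitz[OF u]) simp
        then have "norm (u x - u y) / (?n * mu j m) \<le> ?n * (mu j m * 2 ^ j) * norm (x - y) / (?n * mu j m)"
          using mu0[of j m] by (intro divide_right_mono) auto
        also have "\<dots> \<le> 2 ^ j * norm (x - y)" by simp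
        finally show "norm (u x - u y) / (?n * mu j m) \<le> 2 ^ j * norm (x - y)" .
      qed
      have "x \<in> dcube d j m" if "a j m x \<noteq> 0" for x
      proof -
        have "u x \<noteq> 0" using a1[of x] that by auto
        then have "unity_part \<eta> e j m x \<noteq> 0" by (auto simp: u_def)
        then show ?thesis using unity_part_support[OF \<eta>] dcube_mono[OF \<rho>(3), of j m] by blast
      qed
      then have "supp (a j m) \<subseteq> dcube d j m" by (rule supp_subset)
      moreover have "a j m \<in> Lip"
      proof -
        have "bounded (range (a j m))" using bd by (auto intro!: boundedI)
        moreover have "(2 ^ j)-lipschitz_on UNIV (a j m)"
          using lip by (auto intro!: lipschitz_onI simp: dist_norm)
        ultimately show ?thesis by (auto simp: Lip_def)
      qed
      ultimately show ?thesis using bd lip by (simp add: Lip_atom_def)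
    qed
    moreover have lam': "b_norm s p q lam' \<le> ennreal (?n * C) * b_norm s p q lam"
    proof -
      have "b_norm s p q lam' \<le> b_norm s p q (\<lambda>j m. complex_of_real ?n * complex_of_real (mu j m))"
        by (intro b_norm_mono p q) (simp add: lam'_def norm_mult)
      also have "\<dots> = ennreal ?n * b_norm s p q (\<lambda>j m. complex_of_real (mu j m))"
        by (simp add: b_norm_cmult[OF p q])
      also have "\<dots> \<le> ennreal ?n * (ennreal C * b_norm s p q lam)" using mu by (rule mult_left_mono) simp
      finally show ?thesis using C by (simp add: ennreal_mult mult.assoc)
    qed
    moreover have "lam' \<in> b_space s p q"
      using fin lam' by (auto simp: b_space_def ennreal_mult_less_top elim!: le_less_trans)
    moreover have "Lp_expansion p f lam' (\<lambda>j m x. complex_of_real (a j m x))"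
    proof -
      \<comment> \<open>At most one of the two terms on the right is different from zero.\<close>
      have *: "lam' j m * complex_of_real (a j m x)
          = complex_of_real (Re (unity_part \<eta> 0 j m x * h j x)) + \<i> * complex_of_real (Im
            (unity_part \<eta> 1 j m x * h j x))" for j m x
      proof -
        define v where "v e = unity_part \<eta> e j m x * h j x" for e
        have z: "v e = 0" if "mu j m = 0" for e
          using smooth_bd_bound[OF sm[of j m e], of x] that by (simp add: v_def)
        have v0: "v 0 = 0" if "m \<notin> range (coset 0)"
          using that unfolding v_def unity_part_def by (simp only: if_False mult_zero_left)
        have v1: "v 1 = 0" if "m \<in> range (coset 0)"
          using coset_disjoint[OF that] unfolding v_def unity_part_def by (simp only: if_False mult_zero_left)
        show ?thesis
          unfolding lam'_def a_def v_def[symmetric] using z v0 v1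
          by (cases "mu j m = 0"; cases "m \<in> range (coset 0)") simp_all
      qed
      have "(\<Sum>\<^sub>\<infinity>m. lam' j m * complex_of_real (a j m x)) = h j x" for j x
      proof -
        have one: "(\<Sum>m\<in>near \<rho> j x. unity_part \<eta> e j m x) = 1" for e
          using \<rho> by (intro sum_pu_eq_1[OF \<eta>] card_near_le) (auto simp: near_def)
        have "(\<Sum>\<^sub>\<infinity>m. lam' j m * complex_of_real (a j m x))
            = (\<Sum>m\<in>near \<rho> j x. complex_of_real (Re (unity_part \<eta> 0 j m x * h j x)) + \<i> * complex_of_real
              (Im (unity_part \<eta> 1 j m x * h j x)))"
          unfolding *
        proof (rule infsum_near[OF _ \<rho>(4)])
          fix m assume "complex_of_real (Re (unity_part \<eta> 0 j m x * h j x)) + \<i> * complex_of_real (Im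
            (unity_part \<eta> 1 j m x * h j x)) \<noteq> 0"
          then have "unity_part \<eta> 0 j m x \<noteq> 0 \<or> unity_part \<eta> 1 j m x \<noteq> 0" by auto
          then show "x \<in> dcube \<rho> j m" using unity_part_support[OF \<eta>] by blast
        qed
        also have "\<dots> = complex_of_real (Re (\<Sum>m\<in>near \<rho> j x. unity_part \<eta> 0 j m x * h j x)) + \<i>
          * complex_of_real (Im (\<Sum>m\<in>near \<rho> j x. unity_part \<eta> 1 j m x * h j x))"
          by (simp only: sum.distrib sum_distrib_left Re_sum Im_sum of_real_sum)
        also have "\<dots> = h j x"
          unfolding sum_distrib_right[symmetric] one by (simp add: complex_eq[symmetric])
        finally show ?thesis .
      qed
      then show ?thesis using lim by (simp add: Lp_expansion_def)
    qed
    ultimately show "\<exists>lam' a. Lip_rep d s p q f lam' a \<and> b_norm s p q lam'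
      \<le> ennreal (?n * C) * b_norm s p q lam"
      unfolding Lip_rep_def by blast
  qed
qed

section \<open>The quasi-norm given by Lipschitz atoms\<close>

text \<open>The form in which an estimate for every representation passes to the quasi-norms.\<close>

lemma scaled_le_Inf:
  fixes x :: ennreal and C :: real
  assumes "0 < C" "\<And>y. y \<in> S \<Longrightarrow> x \<le> ennreal C * y"
  shows "ennreal (1 / C) * x \<le> Inf S" "x \<le> ennreal C * Inf S"
proof -
  have one: "ennreal (1 / C) * ennreal C = 1" "ennreal C * ennreal (1 / C) = 1"
    using assms(1) by (simp_all flip: ennreal_mult)
  have "ennreal (1 / C) * x \<le> y" if "y \<in> S" for y
  proof -
    have "ennreal (1 / C) * x \<le> ennreal (1 / C) * (ennreal C * y)"
      using assms(2)[OF that] by (rule mult_left_mono) simp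
    then show ?thesis by (simp only: mult.assoc[symmetric] one mult_1_left)
  qed
  then show le: "ennreal (1 / C) * x \<le> Inf S" by (rule Inf_greatest)
  have "ennreal C * (ennreal (1 / C) * x) \<le> ennreal C * Inf S"
    using le by (rule mult_left_mono) simp
  then show "x \<le> ennreal C * Inf S" by (simp only: mult.assoc[symmetric] one mult_1_left)
qed

lemma b_norm_add:
  assumes p: "0 < p" and q: "0 < q"
  shows "\<exists>C>0::real. \<forall>lam mu :: nat \<Rightarrow> int^'n \<Rightarrow> complex.
    b_norm s p q (\<lambda>j m. complex_of_real (norm (lam j m) + norm (mu j m)))
      \<le> ennreal C * (b_norm s p q lam + b_norm s p q mu)"
proof -
  obtain C1 where C1: "0 < C1" "\<And>F G :: int^'n \<Rightarrow> ennreal. lq_norm p (\<lambda>i. F i + G i)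
    \<le> ennreal C1 * (lq_norm p F + lq_norm p G)"
    using lq_norm_add[OF p] by blast
  obtain C2 where C2: "0 < C2" "\<And>F G :: nat \<Rightarrow> ennreal. lq_norm q (\<lambda>i. F i + G i)
    \<le> ennreal C2 * (lq_norm q F + lq_norm q G)"
    using lq_norm_add[OF q] by blast
  show ?thesis
  proof (intro exI[of _ "C1 * C2"] conjI allI)
    show "0 < C1 * C2" using C1 C2 by simp
    fix lam mu :: "nat \<Rightarrow> int^'n \<Rightarrow> complex"
    define W where "W j = ennreal (2 powr (real j * (s - real CARD('n) * enn2real (1 / p))))" for j :: nat
    let ?L = "\<lambda>lam j. lq_norm p (\<lambda>m. ennreal (norm (lam j m :: complex)))"
    have "b_norm s p q (\<lambda>j m. complex_of_real (norm (lam j m) + norm (mu j m)))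
        = lq_norm q (\<lambda>j. W j * lq_norm p (\<lambda>m. ennreal (norm (lam j m)) + ennreal (norm (mu j m))))"
      by (simp add: b_norm_eq W_def norm_of_real flip: ennreal_plus of_real_add)
    also have "\<dots> \<le> lq_norm q (\<lambda>j. ennreal C1 * (W j * ?L lam j + W j * ?L mu j))"
    proof (rule lq_norm_mono[OF q])
      fix j
      have "W j * lq_norm p (\<lambda>m. ennreal (norm (lam j m)) + ennreal (norm (mu j m)))
        \<le> W j * (ennreal C1 * (?L lam j + ?L mu j))"
        by (intro mult_left_mono C1(2)) simp
      then show "W j * lq_norm p (\<lambda>m. ennreal (norm (lam j m)) + ennreal (norm (mu j m)))
        \<le> ennreal C1 * (W j * ?L lam j + W j * ?L mu j)"
        by (simp add: distrib_left mult_ac)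
    qed
    also have "\<dots> = ennreal C1 * lq_norm q (\<lambda>j. W j * ?L lam j + W j * ?L mu j)"
      by (rule lq_norm_cmult[OF q])
    also have "\<dots> \<le> ennreal C1 * (ennreal C2 * (lq_norm q (\<lambda>j. W j * ?L lam j) + lq_norm q (\<lambda>j. W j * ?L mu j)))"
      by (intro mult_left_mono C2(2)) simp
    also have "\<dots> = ennreal (C1 * C2) * (b_norm s p q lam + b_norm s p q mu)"
      using C1 C2 by (simp add: b_norm_eq W_def ennreal_mult mult.assoc)
    finally show "b_norm s p q (\<lambda>j m. complex_of_real (norm (lam j m) + norm (mu j m)))
      \<le> ennreal (C1 * C2) * (b_norm s p q lam + b_norm s p q mu)" .
  qed
qed

text \<open>The fraction is a weighted mean of the two atoms up to unimodular factors; if both coefficients vanish, it is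
zero.\<close>

lemma rough_weighted_mean:
  assumes "rough D 1 k m a" "rough D 1 k m b"
  shows "rough D 1 k m (\<lambda>x. (c * a x + c' * b x) / complex_of_real (norm c + norm c'))"
proof -
  have le: "norm ((c * u + c' * v) / complex_of_real (norm c + norm c')) \<le> t"
    if "norm u \<le> t" "norm v \<le> t" "0 \<le> t" for u v t
  proof -
    have "norm (c * u + c' * v) \<le> norm c * t + norm c' * t"
      using that by (intro norm_triangle_mono) (auto simp: norm_mult intro: mult_left_mono)
    also have "\<dots> = (norm c + norm c') * t" by (simp add: distrib_right)
    finally have "norm (c * u + c' * v) / (norm c + norm c') \<le> (norm c + norm c') * t / (norm c + norm c')"
      by (intro divide_right_mono) auto
    also have "\<dots> \<le> t" using that by simp
    finally show ?thesis by (simp add: norm_divide flip: of_real_add)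
  qed
  have "(c * a x + c' * b x) / complex_of_real (norm c + norm c') - (c * a y + c' * b y) / complex_of_real
    (norm c + norm c')
      = (c * (a x - a y) + c' * (b x - b y)) / complex_of_real (norm c + norm c')" for x y
    by (simp add: algebra_simps flip: diff_divide_distrib)
  moreover have "x \<in> dcube D k m" if "(c * a x + c' * b x) / complex_of_real (norm c + norm c') \<noteq> 0" for x
  proof -
    have "a x \<noteq> 0 \<or> b x \<noteq> 0" using that by auto
    then show ?thesis using assms unfolding rough_def by blast
  qed
  ultimately show ?thesis
    using assms le unfolding rough_def by (simp del: of_real_add)
qed

lemma weighted_mean_cancel:
  "complex_of_real (norm c + norm c') * ((c * u + c' * v) / complex_of_real (norm c + norm c'))
    = c * u + c' * v"
proof (cases "norm c + norm c' = 0")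
  case True
  then have "c = 0" "c' = 0" by (metis add_nonneg_eq_0_iff norm_eq_zero norm_ge_zero)+
  then show ?thesis by simp
next
  case False
  then have "complex_of_real (norm c + norm c') \<noteq> 0" using of_real_eq_0_iff by blast
  then show ?thesis by simp
qed

lemma Lp_expansion_add:
  fixes f g :: "real^'n \<Rightarrow> complex"
  assumes p: "0 < p" and D: "0
    \<le> D" and f: "f \<in> borel_measurable lebesgue" and g: "g \<in> borel_measurable lebesgue"
    and a: "\<And>k m. rough D A k m (a k m)" and b: "\<And>k m. rough D A k m (b k m)"
    and fe: "Lp_expansion p f lam a" and ge: "Lp_expansion p g mu b"
    and c: "\<And>k m x. nu k m * c k m x = lam k m * a k m x + mu k m * b k m x"
  shows "Lp_expansion p (\<lambda>x. f x + g x) nu c"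
proof -
  obtain C0 where C0: "0 < C0" "\<And>f g. f \<in> borel_measurable lebesgue \<Longrightarrow> g \<in> borel_measurable lebesgue \<Longrightarrow>
           Lp_norm p (\<lambda>x::real^'n. f x + g x) \<le> ennreal C0 * (Lp_norm p f + Lp_norm p g)"
    using Lp_norm_triangle[OF p, where 'n = 'n] by blast
  have "level nu c k x = level lam a k x + level mu b k x" for k x
  proof -
    have "level nu c k x = (\<Sum>m\<in>near D k x. nu k m * c k m x)"
      unfolding level_def
    proof (rule infsum_near[OF _ D])
      fix m assume "nu k m * c k m x \<noteq> 0"
      then have "a k m x \<noteq> 0 \<or> b k m x \<noteq> 0" using c by auto
      then show "x \<in> dcube D k m" using a[of k m] b[of k m] unfolding rough_def by blast
    qed
    also have "\<dots> = level lam a k x + level mu b k x"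
      using level_eq_sum[OF D a, of 0 x x k lam] level_eq_sum[OF D b, of 0 x x k mu]
      by (simp add: c sum.distrib)
    finally show ?thesis .
  qed
  then have ps: "partial_sum nu c N x = partial_sum lam a N x + partial_sum mu b N x" for N x
    by (simp add: partial_sum_def sum.distrib)
  have le: "Lp_norm p (\<lambda>x. (f x + g x) - partial_sum nu c N x)
      \<le> ennreal C0 * (Lp_norm p (\<lambda>x. f x - partial_sum lam a N x) + Lp_norm p
        (\<lambda>x. g x - partial_sum mu b N x))" for N
  proof -
    have "Lp_norm p (\<lambda>x. (f x - partial_sum lam a N x) + (g x - partial_sum mu b N x))
        \<le> ennreal C0 * (Lp_norm p (\<lambda>x. f x - partial_sum lam a N x) + Lp_norm p
          (\<lambda>x. g x - partial_sum mu b N x))"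
      by (intro C0(2) borel_measurable_diff f g continuous_imp_lebesgue_measurable
          partial_sum_continuous[OF D a] partial_sum_continuous[OF D b])
    then show ?thesis by (simp add: ps algebra_simps)
  qed
  have "(\<lambda>N. ennreal C0 * (Lp_norm p (\<lambda>x. f x - partial_sum lam a N x) + Lp_norm p
    (\<lambda>x. g x - partial_sum mu b N x)))
      \<longlonglongrightarrow> ennreal C0 * (0 + 0)"
    using fe ge unfolding Lp_expansion_iff
    by (intro ennreal_tendsto_cmult[OF ennreal_less_top] tendsto_add)
  then have upper: "(\<lambda>N. ennreal C0 * (Lp_norm p (\<lambda>x. f x - partial_sum lam a N x) + Lp_norm p
    (\<lambda>x. g x - partial_sum mu b N x)))
      \<longlonglongrightarrow> 0" by simp
  show ?thesis
    unfolding Lp_expansion_iff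
  proof (rule tendsto_sandwich[OF _ _ tendsto_const upper])
    show "\<forall>\<^sub>F N in sequentially. Lp_norm p (\<lambda>x. (f x + g x) - partial_sum nu c N x)
      \<le> ennreal C0 * (Lp_norm p (\<lambda>x. f x - partial_sum lam a N x) + Lp_norm p (\<lambda>x. g x - partial_sum mu b N x))"
      by (rule always_eventually) (rule allI, rule le)
  qed simp
qed

lemma Lip_rep_rough: "Lip_rep d s p q f lam a \<Longrightarrow> rough d 1 k m (\<lambda>x. complex_of_real (a k m x))"
  by (simp add: Lip_rep_def Lip_atom_rough)

lemma Lip_norm_le: "Lip_rep d s p q f lam a \<Longrightarrow> Lip_norm d s p q f \<le> b_norm s p q lam"
  unfolding Lip_norm_def by (intro Inf_lower) blast

lemma Lip_rep_cong_AE: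
  fixes f g :: "real^'n \<Rightarrow> complex"
  assumes d: "0 \<le> d" and f: "f \<in> borel_measurable lebesgue" and g: "g \<in> borel_measurable lebesgue"
    and fg: "AE x in lebesgue. f x = g x" and rep: "Lip_rep d s p q f lam a"
  shows "Lip_rep d s p q g lam a"
proof -
  let ?a = "\<lambda>j m x. complex_of_real (a j m x)"
  have "partial_sum lam ?a N \<in> borel_measurable lebesgue" for N
    by (intro continuous_imp_lebesgue_measurable partial_sum_continuous[OF d Lip_rep_rough[OF rep]])
  then have "Lp_norm p (\<lambda>x. f x - partial_sum lam ?a N x) = Lp_norm p (\<lambda>x. g x - partial_sum lam ?a N x)" for N
    using fg by (intro Lp_norm_cong_AE borel_measurable_diff f g) auto
  then show ?thesis
    using rep unfolding Lip_rep_def Lp_expansion_iff by simp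
qed

lemma Lip_rep_cmult:
  fixes f :: "real^'n \<Rightarrow> complex"
  assumes p: "0 < p" and q: "0 < q" and d: "0 \<le> d" and f: "f \<in> borel_measurable lebesgue"
    and rep: "Lip_rep d s p q f lam a"
  shows "Lip_rep d s p q (\<lambda>x. c * f x) (\<lambda>j m. c * lam j m) a"
proof -
  let ?a = "\<lambda>j m x. complex_of_real (a j m x)"
  have ps: "partial_sum (\<lambda>j m. c * lam j m) ?a N x = c * partial_sum lam ?a N x" for N x
    by (simp add: partial_sum_def level_def sum_distrib_left mult.assoc infsum_cmult_right')
  have "partial_sum lam ?a N \<in> borel_measurable lebesgue" for N
    by (intro continuous_imp_lebesgue_measurable partial_sum_continuous[OF d Lip_rep_rough[OF rep]])
  then have le: "Lp_norm p (\<lambda>x. c * f x - partial_sum (\<lambda>j m. c * lam j m) ?a N x)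
      \<le> ennreal (norm c) * Lp_norm p (\<lambda>x. f x - partial_sum lam ?a N x)" for N
    unfolding ps right_diff_distrib[symmetric] by (intro Lp_norm_cmult_le[OF p] borel_measurable_diff f)
  have "(\<lambda>N. ennreal (norm c) * Lp_norm p (\<lambda>x. f x - partial_sum lam ?a N x)) \<longlonglongrightarrow> ennreal (norm c) * 0"
    using rep unfolding Lip_rep_def Lp_expansion_iff
    by (intro ennreal_tendsto_cmult[OF ennreal_less_top]) auto
  then have upper: "(\<lambda>N. ennreal (norm c) * Lp_norm p (\<lambda>x. f x - partial_sum lam ?a N x)) \<longlonglongrightarrow> 0" by simp
  have "Lp_expansion p (\<lambda>x. c * f x) (\<lambda>j m. c * lam j m) ?a"
    unfolding Lp_expansion_iff
  proof (rule tendsto_sandwich[OF _ _ tendsto_const upper])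
    show "\<forall>\<^sub>F N in sequentially. Lp_norm p (\<lambda>x. c * f x - partial_sum (\<lambda>j m. c * lam j m) ?a N x)
      \<le> ennreal (norm c) * Lp_norm p (\<lambda>x. f x - partial_sum lam ?a N x)"
      by (rule always_eventually) (rule allI, rule le)
  qed simp
  then show ?thesis
    using rep by (simp add: Lip_rep_def b_space_def b_norm_cmult[OF p q] ennreal_mult_less_top)
qed

lemma Lip_norm_cmult_le:
  fixes f :: "real^'n \<Rightarrow> complex"
  assumes p: "0 < p" and q: "0 < q" and d: "0 \<le> d" and f: "f \<in> borel_measurable lebesgue" and c: "c \<noteq> 0"
  shows "Lip_norm d s p q (\<lambda>x. c * f x) \<le> ennreal (norm c) * Lip_norm d s p q f"
  unfolding Lip_norm_def[of d s p q f]
proof (rule scaled_le_Inf(2))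
  fix y assume "y \<in> {b_norm s p q lam | lam a. Lip_rep d s p q f lam a}"
  then obtain lam a where y: "y = b_norm s p q lam" and rep: "Lip_rep d s p q f lam a" by blast
  show "Lip_norm d s p q (\<lambda>x. c * f x) \<le> ennreal (norm c) * y"
    using Lip_norm_le[OF Lip_rep_cmult[OF p q d f rep, of c]] by (simp add: y b_norm_cmult[OF p q])
qed (use c in simp)

text \<open>The reverse inequality is \<open>Lip_norm_cmult_le\<close> for the factor \<open>1 / c\<close>.\<close>

lemma Lip_norm_cmult:
  fixes f :: "real^'n \<Rightarrow> complex"
  assumes p: "0 < p" and q: "0 < q" and d: "0 \<le> d" and f: "f \<in> borel_measurable lebesgue" and c: "c \<noteq> 0"
  shows "Lip_norm d s p q (\<lambda>x. c * f x) = ennreal (norm c) * Lip_norm d s p q f"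
proof (rule antisym)
  show "Lip_norm d s p q (\<lambda>x. c * f x) \<le> ennreal (norm c) * Lip_norm d s p q f"
    by (rule Lip_norm_cmult_le[OF assms])
  have "Lip_norm d s p q (\<lambda>x. inverse c * (c * f x))
    \<le> ennreal (norm (inverse c)) * Lip_norm d s p q (\<lambda>x. c * f x)"
    using c f by (intro Lip_norm_cmult_le[OF p q d]) auto
  then have "Lip_norm d s p q f \<le> ennreal (norm (inverse c)) * Lip_norm d s p q (\<lambda>x. c * f x)"
    using c by (simp add: mult.assoc[symmetric])
  then have "ennreal (norm c) * Lip_norm d s p q f
    \<le> ennreal (norm c) * (ennreal (norm (inverse c)) * Lip_norm d s p q (\<lambda>x. c * f x))"
    by (rule mult_left_mono) simp
  also have "\<dots> = Lip_norm d s p q (\<lambda>x. c * f x)"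
    using c by (simp add: mult.assoc[symmetric] ennreal_mult[symmetric] norm_mult[symmetric])
  finally show "ennreal (norm c) * Lip_norm d s p q f \<le> Lip_norm d s p q (\<lambda>x. c * f x)" .
qed

text \<open>All coefficients and atoms can be taken to be zero.\<close>

lemma Lip_norm_AE_zero:
  fixes f :: "real^'n \<Rightarrow> complex"
  assumes p: "0 < p" and q: "0 < q" and f: "f \<in> borel_measurable lebesgue" and "AE x in lebesgue. f x = 0"
  shows "Lip_norm d s p q f = 0"
proof -
  have b0: "b_norm s p q (\<lambda>j m. 0 :: complex) = 0"
    using b_norm_cmult[OF p q, of s 0 "\<lambda>j m. 0"] by simp
  have "Lip_atom d j m (\<lambda>x::real^'n. 0)" for j m
  proof -
    have "0-lipschitz_on UNIV (\<lambda>x::real^'n. 0::real)" by (rule lipschitz_onI) auto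
    then show ?thesis by (auto simp: Lip_atom_def Lip_def supp_def)
  qed
  moreover have "Lp_norm p f = 0" using Lp_norm_0_iff[OF p f] assms(4) by simp
  ultimately have "Lip_rep d s p q f (\<lambda>j m. 0) (\<lambda>j m x. 0)"
    by (simp add: Lip_rep_def Lp_expansion_def b_space_def b0)
  then show ?thesis using Lip_norm_le b0 by (metis le_zero_eq)
qed

theorem Lp_norm_le_Lip_norm:
  assumes p: "0 < p" and q: "0 < q" and s: "0 < s" and d: "0 < d"
  shows "\<exists>C>0::real. \<forall>f :: real^'n \<Rightarrow> complex. f \<in> borel_measurable lebesgue \<longrightarrow>
    Lp_norm p f \<le> ennreal C * Lip_norm d s p q f"
proof -
  obtain C where C: "\<forall>(f :: real^'n \<Rightarrow> complex) lam b.
     f \<in> borel_measurable lebesgue \<longrightarrow> (\<forall>k m. rough d 1 k m (b k m)) \<longrightarrow> Lp_expansion p f lam b \<longrightarrow>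
     Lp_norm p f \<le> ennreal C * b_norm s p q lam"
    using Lp_norm_le_b_norm[OF p q s d zero_le_one, where 'n = 'n] by (elim exE) (rule that)
  show ?thesis
  proof (intro exI[of _ "max C 1"] conjI allI impI)
    fix f :: "real^'n \<Rightarrow> complex" assume f: "f \<in> borel_measurable lebesgue"
    show "Lp_norm p f \<le> ennreal (max C 1) * Lip_norm d s p q f"
      unfolding Lip_norm_def
    proof (rule scaled_le_Inf(2))
      fix y assume "y \<in> {b_norm s p q lam | lam a. Lip_rep d s p q f lam a}"
      then obtain lam a where y: "y = b_norm s p q lam" and rep: "Lip_rep d s p q f lam a" by blast
      have "Lp_norm p f \<le> ennreal C * y"
        unfolding y using rep f
        by (intro C[THEN spec, THEN spec, THEN spec, THEN mp, THEN mp, THEN mp])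
          (auto simp: Lip_rep_def Lip_atom_rough)
      also have "\<dots> \<le> ennreal (max C 1) * y" by (intro mult_right_mono ennreal_leI) auto
      finally show "Lp_norm p f \<le> ennreal (max C 1) * y" .
    qed simp
  qed simp
qed

text \<open>Two representations with atoms \<open>a\<close> and \<open>b\<close> cannot be added term by term, since \<open>\<lambda> a + \<mu> b\<close> is in general not a
complex multiple of a real function.  It is a multiple of a rough atom, and \<open>Lip_rep_of_rough\<close> restores
a representation by \<open>Lip\<close>-atoms.\<close>

theorem Lip_norm_triangle:
  assumes p: "0 < p" and q: "0 < q" and s: "0 < s" "s < 1" and d: "1 < d"
  shows "\<exists>C::real. \<forall>f g :: real^'n \<Rightarrow> complex. f \<in> borel_measurable lebesgue \<longrightarrow> g \<in> borel_measurable lebesgue \<longrightarrow>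
    Lip_norm d s p q f < \<infinity> \<longrightarrow> Lip_norm d s p q g < \<infinity> \<longrightarrow>
    Lip_norm d s p q (\<lambda>x. f x + g x) \<le> ennreal C * (Lip_norm d s p q f + Lip_norm d s p q g)"
proof -
  have d0: "0 \<le> d" using d by simp
  obtain C1 where C1: "0 < C1" "\<forall>(f :: real^'n \<Rightarrow> complex) lam b.
     f \<in> borel_measurable lebesgue \<longrightarrow> (\<forall>k m. rough d 1 k m (b k m)) \<longrightarrow> lam \<in> b_space s p q
       \<longrightarrow> Lp_expansion p f lam b \<longrightarrow>
     (\<exists>lam' a. Lip_rep d s p q f lam' a \<and> b_norm s p q lam' \<le> ennreal C1 * b_norm s p q lam)"
    using Lip_rep_of_rough[OF p q s d0 zero_le_one d, where 'n = 'n] by (elim exE conjE) (rule that)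
  obtain C2 where C2: "0 < C2" "\<And>lam mu :: nat \<Rightarrow> int^'n \<Rightarrow> complex.
    b_norm s p q (\<lambda>j m. complex_of_real (norm (lam j m) + norm (mu j m)))
      \<le> ennreal C2 * (b_norm s p q lam + b_norm s p q mu)"
    using b_norm_add[OF p q] by blast
  show ?thesis
  proof (intro exI[of _ "C1 * C2"] allI impI)
    fix f g :: "real^'n \<Rightarrow> complex"
    assume f: "f \<in> borel_measurable lebesgue" and g: "g \<in> borel_measurable lebesgue"
      and ff: "Lip_norm d s p q f < \<infinity>" and gf: "Lip_norm d s p q g < \<infinity>"
    let ?N = "Lip_norm d s p q"
    have step: "?N (\<lambda>x. f x + g x) \<le> ennreal (C1 * C2) * (b_norm s p q lam + b_norm s p q mu)"
      if fr: "Lip_rep d s p q f lam a" and gr: "Lip_rep d s p q g mu b" for lam mu a b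
    proof -
      define nu where "nu j m = complex_of_real (norm (lam j m) + norm (mu j m))" for j m
      define c where "c j m x
        = (lam j m * complex_of_real (a j m x) + mu j m * complex_of_real (b j m x)) / complex_of_real
          (norm (lam j m) + norm (mu j m))"
        for j m x
      have c: "rough d 1 k m (c k m)" for k m
        unfolding c_def by (rule rough_weighted_mean[OF Lip_rep_rough[OF fr] Lip_rep_rough[OF gr]])
      have nu: "b_norm s p q nu \<le> ennreal C2 * (b_norm s p q lam + b_norm s p q mu)"
        unfolding nu_def by (rule C2(2))
      have fin: "nu \<in> b_space s p q"
        using nu fr gr by (auto simp: Lip_rep_def b_space_def ennreal_mult_less_top elim!: le_less_trans)
      have ex: "Lp_expansion p (\<lambda>x. f x + g x) nu c"
      proof (rule Lp_expansion_add[OF p d0 f g Lip_rep_rough[OF fr] Lip_rep_rough[OF gr]])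
        show "Lp_expansion p f lam (\<lambda>k m x. complex_of_real (a k m x))" "Lp_expansion p g mu
          (\<lambda>k m x. complex_of_real (b k m x))"
          using fr gr by (simp_all add: Lip_rep_def)
        show "nu k m * c k m x = lam k m * complex_of_real (a k m x) + mu k m * complex_of_real (b k m x)"
          for k m x
          unfolding nu_def c_def by (rule weighted_mean_cancel)
      qed
      have cr: "\<forall>k m. rough d 1 k m (c k m)" using c by blast
      have "\<exists>lam' a'. Lip_rep d s p q (\<lambda>x. f x + g x) lam' a' \<and> b_norm s p q lam'
        \<le> ennreal C1 * b_norm s p q nu"
        by (rule C1(2)[THEN spec, THEN spec, THEN spec, THEN mp, THEN mp, THEN mp, THEN mp, OF borel_measurable_add[OF f g] cr fin ex])
      then obtain lam' a' where r: "Lip_rep d s p q (\<lambda>x. f x + g x) lam' a'" "b_norm s p q lam'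
        \<le> ennreal C1 * b_norm s p q nu"
        by blast
      have "?N (\<lambda>x. f x + g x) \<le> b_norm s p q lam'" by (rule Lip_norm_le[OF r(1)])
      also note r(2)
      also have "ennreal C1 * b_norm s p q nu
        \<le> ennreal C1 * (ennreal C2 * (b_norm s p q lam + b_norm s p q mu))"
        using nu by (rule mult_left_mono) simp
      also have "\<dots> = ennreal (C1 * C2) * (b_norm s p q lam + b_norm s p q mu)"
        using C1(1) C2(1) by (simp add: ennreal_mult mult.assoc)
      finally show ?thesis .
    qed
    \<comment> \<open>Near-optimal representations exist because the infimum is finite.\<close>
    have pick: "\<exists>lam a. Lip_rep d s p q f lam a \<and> b_norm s p q lam \<le> ?N f + ennreal e"
      if "?N f < \<infinity>" "0 < e" for f :: "real^'n \<Rightarrow> complex" and e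
    proof -
      have "?N f < ?N f + ennreal e"
        using that by (simp add: ennreal_add_left_cancel_less[of "?N f" 0, simplified])
      then show ?thesis
        unfolding Lip_norm_def[of d s p q f] Inf_less_iff by (auto intro: less_imp_le)
    qed
    have C12: "0 < C1 * C2" using C1 C2 by simp
    have one: "ennreal (1 / (C1 * C2)) * ennreal (C1 * C2) = 1"
      "ennreal (C1 * C2) * ennreal (1 / (C1 * C2)) = 1"
      using C1(1) C2(1) by (simp_all flip: ennreal_mult)
    have "ennreal (1 / (C1 * C2)) * ?N (\<lambda>x. f x + g x) \<le> ?N f + ?N g"
    proof (rule ennreal_le_epsilon)
      fix e :: real assume e: "0 < e"
      obtain lam a where l: "Lip_rep d s p q f lam a" "b_norm s p q lam \<le> ?N f + ennreal (e / 2)"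
        using pick[OF ff, of "e / 2"] e by auto
      obtain mu b where m: "Lip_rep d s p q g mu b" "b_norm s p q mu \<le> ?N g + ennreal (e / 2)"
        using pick[OF gf, of "e / 2"] e by auto
      have "ennreal (1 / (C1 * C2)) * ?N (\<lambda>x. f x + g x)
        \<le> ennreal (1 / (C1 * C2)) * (ennreal (C1 * C2) * (b_norm s p q lam + b_norm s p q mu))"
        by (rule mult_left_mono[OF step[OF l(1) m(1)]]) simp
      also have "\<dots> = b_norm s p q lam + b_norm s p q mu"
        by (simp only: mult.assoc[symmetric] one mult_1_left)
      also have "\<dots> \<le> (?N f + ennreal (e / 2)) + (?N g + ennreal (e / 2))"
        using l(2) m(2) by (rule add_mono)
      also have "\<dots> = ?N f + ?N g + (ennreal (e / 2) + ennreal (e / 2))" by (simp add: ac_simps)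
      also have "ennreal (e / 2) + ennreal (e / 2) = ennreal e"
        using e by (subst ennreal_plus[symmetric]) auto
      finally show "ennreal (1 / (C1 * C2)) * ?N (\<lambda>x. f x + g x) \<le> ?N f + ?N g + ennreal e" .
    qed
    then have "ennreal (C1 * C2) * (ennreal (1 / (C1 * C2)) * ?N (\<lambda>x. f x + g x))
      \<le> ennreal (C1 * C2) * (?N f + ?N g)"
      by (rule mult_left_mono) simp
    then show "?N (\<lambda>x. f x + g x) \<le> ennreal (C1 * C2) * (?N f + ?N g)"
      by (simp only: mult.assoc[symmetric] one mult_1_left)
  qed
qed

theorem corollary2p8:
  fixes p q :: ennreal and s d d\<^sub>0 :: real and K :: nat
  assumes "0 < p" and "0 < q" and "0 < s" and "s < 1" and "1 < d"
    and "1 < d\<^sub>0" and "1 + \<lfloor>s\<rfloor> \<le> int K"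
  shows "(\<forall>f :: real^'n \<Rightarrow> complex. f \<in> Lp p \<longrightarrow>
            (f \<in> Besov d\<^sub>0 K s p q \<longleftrightarrow> (\<exists>lam a. Lip_rep d s p q f lam a))) \<and>
         quasi_norm_on (Besov d\<^sub>0 K s p q :: (real^'n \<Rightarrow> complex) set) (Lip_norm d s p q) \<and>
         equivalent_on (Besov d\<^sub>0 K s p q :: (real^'n \<Rightarrow> complex) set)
           (Besov_norm d\<^sub>0 K s p q) (Lip_norm d s p q)"
proof -
  note p = assms(1) and q = assms(2) and s = assms(3,4) and d = assms(5) and d0 = assms(6)
  let ?V = "Besov d\<^sub>0 K s p q :: (real^'n \<Rightarrow> complex) set" and ?N
    = "Lip_norm d s p q :: (real^'n \<Rightarrow> complex) \<Rightarrow> ennreal"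
  have "\<lfloor>s\<rfloor> = 0" using s by (simp add: floor_eq_iff)
  then have K: "1 \<le> K" using assms(7) by simp
  have nn: "0 \<le> d" "0 \<le> d\<^sub>0" "0 \<le> real CARD('n)" using d d0 by simp_all
  obtain C1 where C1: "0 < C1" "\<forall>(f :: real^'n \<Rightarrow> complex) lam b.
     f \<in> borel_measurable lebesgue \<longrightarrow> (\<forall>k m. rough d\<^sub>0 (real CARD('n)) k m (b k m)) \<longrightarrow> lam \<in> b_space s p q
       \<longrightarrow> Lp_expansion p f lam b \<longrightarrow>
     (\<exists>lam' a. Lip_rep d s p q f lam' a \<and> b_norm s p q lam' \<le> ennreal C1 * b_norm s p q lam)"
    using Lip_rep_of_rough[OF p q s nn(2,3) d, where 'n = 'n] by (elim exE conjE) (rule that)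
  obtain C2 where C2: "0 < C2" "\<forall>(f :: real^'n \<Rightarrow> complex) lam b.
     f \<in> borel_measurable lebesgue \<longrightarrow> (\<forall>k m. rough d 1 k m (b k m)) \<longrightarrow> lam \<in> b_space s p q
       \<longrightarrow> Lp_expansion p f lam b \<longrightarrow>
     (\<exists>lam' a. K_rep d\<^sub>0 K s p q f lam' a \<and> b_norm s p q lam' \<le> ennreal C2 * b_norm s p q lam)"
    using K_rep_of_rough[OF p q s nn(1) zero_le_one d0, where 'n = 'n and K = K] by (elim exE conjE) (rule that)
  have to_Lip: "\<exists>lam' a'. Lip_rep d s p q f lam' a' \<and> b_norm s p q lam' \<le> ennreal C1 * b_norm s p q lam"
    if "f \<in> borel_measurable lebesgue" "K_rep d\<^sub>0 K s p q f lam a" for f :: "real^'n \<Rightarrow> complex" and lam a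
  proof -
    have "\<forall>k m. rough d\<^sub>0 (real CARD('n)) k m (a k m)"
      using that(2) K_atom_rough[OF _ K] unfolding K_rep_def by blast
    with that show ?thesis
      by (intro C1(2)[THEN spec, THEN spec, THEN spec, THEN mp, THEN mp, THEN mp, THEN mp])
        (auto simp: K_rep_def)
  qed
  have to_K: "\<exists>lam' a'. K_rep d\<^sub>0 K s p q f lam' a' \<and> b_norm s p q lam' \<le> ennreal C2 * b_norm s p q lam"
    if "f \<in> borel_measurable lebesgue" "Lip_rep d s p q f lam a" for f :: "real^'n \<Rightarrow> complex" and lam a
  proof -
    have "\<forall>k m. rough d 1 k m (\<lambda>x. complex_of_real (a k m x))"
      using that(2) by (simp add: Lip_rep_rough)
    with that show ?thesis
      by (intro C2(2)[THEN spec, THEN spec, THEN spec, THEN mp, THEN mp, THEN mp, THEN mp])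
        (auto simp: Lip_rep_def)
  qed
  have meas: "f \<in> borel_measurable lebesgue" if "f \<in> ?V" for f using that by (simp add: Besov_def Lp_def)
  have iff: "f \<in> ?V \<longleftrightarrow> (\<exists>lam a. Lip_rep d s p q f lam a)" if "f \<in> Lp p" for f
  proof -
    have f: "f \<in> borel_measurable lebesgue" using that by (simp add: Lp_def)
    show ?thesis using that to_Lip[OF f] to_K[OF f] unfolding Besov_def by blast
  qed
  have fin: "?N f < \<infinity>" if "f \<in> ?V" for f
  proof -
    have "f \<in> Lp p" using that by (simp add: Besov_def)
    with that obtain lam a where rep: "Lip_rep d s p q f lam a" using iff by blast
    then have "b_norm s p q lam < \<infinity>" by (simp add: Lip_rep_def b_space_def)
    with Lip_norm_le[OF rep] show ?thesis by (rule le_less_trans)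
  qed
  have "quasi_norm_on ?V ?N"
    unfolding quasi_norm_on_def
  proof (intro conjI ballI impI allI)
    show "?N f < \<infinity>" if "f \<in> ?V" for f by (rule fin[OF that])
    show "?N f = ?N g" if "f \<in> ?V" "g \<in> ?V" and fg: "AE x in lebesgue. f x = g x" for f g
    proof -
      have gf: "AE x in lebesgue. g x = f x" using fg by eventually_elim simp
      have "Lip_rep d s p q f lam a \<longleftrightarrow> Lip_rep d s p q g lam a" for lam a
        using Lip_rep_cong_AE[OF nn(1) meas[OF that(1)] meas[OF that(2)] fg]
          Lip_rep_cong_AE[OF nn(1) meas[OF that(2)] meas[OF that(1)] gf] by blast
      then show ?thesis by (simp add: Lip_norm_def)
    qed
    show "?N f = 0 \<longleftrightarrow> (AE x in lebesgue. f x = 0)" if "f \<in> ?V" for f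
    proof
      assume "?N f = 0"
      moreover have "0 < d" using d by simp
      ultimately have "Lp_norm p f = 0"
        using Lp_norm_le_Lip_norm[OF p q s(1), of d, where 'n = 'n] meas[OF that]
          by (metis le_zero_eq mult_zero_right)
      then show "AE x in lebesgue. f x = 0" using Lp_norm_0_iff[OF p meas[OF that]] by simp
    qed (rule Lip_norm_AE_zero[OF p q meas[OF that]])
    show "?N (\<lambda>x. c * f x) = ennreal (norm c) * ?N f" if "f \<in> ?V" for f c
    proof (cases "c = 0")
      case True
      then show ?thesis using Lip_norm_AE_zero[OF p q, of "\<lambda>x::real^'n. 0"] by simp
    qed (rule Lip_norm_cmult[OF p q nn(1) meas[OF that]])
    show "\<exists>C::real. \<forall>f\<in>?V. \<forall>g\<in>?V. ?N (\<lambda>x. f x + g x) \<le> ennreal C * (?N f + ?N g)"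
      using Lip_norm_triangle[OF p q s d, where 'n = 'n] meas fin by (elim exE) (intro exI, blast)
  qed
  moreover have "equivalent_on ?V (Besov_norm d\<^sub>0 K s p q) ?N"
    unfolding equivalent_on_def
  proof (rule exI[of _ "1 / C2"], rule exI[of _ C1], intro conjI ballI)
    fix f assume "f \<in> ?V"
    note f = meas[OF this]
    show "ennreal (1 / C2) * Besov_norm d\<^sub>0 K s p q f \<le> ?N f"
      unfolding Lip_norm_def
    proof (rule scaled_le_Inf(1)[OF C2(1)])
      fix y assume "y \<in> {b_norm s p q lam | lam a. Lip_rep d s p q f lam a}"
      then obtain lam a where y: "y = b_norm s p q lam" and rep: "Lip_rep d s p q f lam a" by blast
      obtain lam' a' where r: "K_rep d\<^sub>0 K s p q f lam' a'" "b_norm s p q lam' \<le> ennreal C2 * b_norm s p q lam"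
        using to_K[OF f rep] by blast
      have "Besov_norm d\<^sub>0 K s p q f \<le> b_norm s p q lam'"
        unfolding Besov_norm_def using r(1) by (intro Inf_lower) blast
      from this r(2) show "Besov_norm d\<^sub>0 K s p q f \<le> ennreal C2 * y" unfolding y by (rule order_trans)
    qed
    show "?N f \<le> ennreal C1 * Besov_norm d\<^sub>0 K s p q f"
      unfolding Besov_norm_def
    proof (rule scaled_le_Inf(2)[OF C1(1)])
      fix y assume "y \<in> {b_norm s p q lam | lam a. K_rep d\<^sub>0 K s p q f lam a}"
      then obtain lam a where y: "y = b_norm s p q lam" and rep: "K_rep d\<^sub>0 K s p q f lam a" by blast
      obtain lam' a' where r: "Lip_rep d s p q f lam' a'" "b_norm s p q lam' \<le> ennreal C1 * b_norm s p q lam"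
        using to_Lip[OF f rep] by blast
      from Lip_norm_le[OF r(1)] r(2) show "?N f \<le> ennreal C1 * y" unfolding y by (rule order_trans)
    qed
  qed (use C1 C2 in auto)
  ultimately show ?thesis using iff by blast
qed

end
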